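(* Let $1\le r<\min\{m,n\}$ and $G,\widetilde G=G+E\in\mathbb{C}^{m\times n}$. Let $U\in\mathbb{C}^{m\times m}$ and $V\in\mathbb{C}^{n\times n}$ be unitary such that $$U^{H}GV=\begin{bmatrix} G_1 & 0 \\ 0 & G_2 \end{bmatrix},\qquad U^{H}\widetilde GV=\begin{bmatrix} G_1+E_{11} & E_{12} \\ E_{21} & G_2+E_{22} \end{bmatrix},$$ where $G_1,E_{11}\in\mathbb{C}^{r\times r}$, $E_{12}\in\mathbb{C}^{r\times(n-r)}$, $E_{21}\in\mathbb{C}^{(m-r)\times r}$, $G_2,E_{22}\in\mathbb{C}^{(m-r)\times(n-r)}$. Let $$\delta=\min_{\mu\in\mathrm{sv}(G_1),\,\nu\in\mathrm{sv}_{\mathrm{ext}}(G_2)}|\mu-\nu|,\quad \underline\delta=\delta-\|E_{11}\|_2-\|E_{22}\|_2,\quad \varepsilon=\max\{\|E_{12}\|_2,\|E_{21}\|_2\},$$ and consider the following system for $(\Gamma,\Omega)\in\mathbb{C}^{(m-r)\times r}\times\mathbb{C}^{(n-r)\times r}$: $$(\ast)\quad \Gamma(G_1+E_{11})-(G_2+E_{22})\Omega=E_{21}-\Gamma E_{12}\Omega,\qquad \Omega(G_1+E_{11})^{H}-(G_2+E_{22})^{H}\Gamma=E_{12}^{H}-\Omega E_{21}^{H}\Gamma .$$ (i) If $\underline\delta>0$ and $\kappa_2:=\left(\frac{\pi}{2}\right)^2\frac{\varepsilon^2}{\underline\delta^2}<\frac14$, then $(\ast)$ has a solution $(\Gamma,\Omega)$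 that satisfies $$\max\{\|\Gamma\|_2,\|\Omega\|_2\}\le\frac{1+\sqrt{1-4\kappa_2}}{1-2\kappa_2+\sqrt{1-4\kappa_2}}\,\frac{\pi}{2}\,\frac{\varepsilon}{\underline\delta}<\pi\,\frac{\varepsilon}{\underline\delta}.$$ (ii) If $\sigma_{\min}(G_1)>\sigma_{\max}(G_2)$ and if $\underline\delta>0$ and $\kappa_2:=\frac{\varepsilon^2}{\underline\delta^2}<\frac14$, then $(\ast)$ has a solution $(\Gamma,\Omega)$ that satisfies $$\max\{\|\Gamma\|_2,\|\Omega\|_2\}\le\frac{1+\sqrt{1-4\kappa_2}}{1-2\kappa_2+\sqrt{1-4\kappa_2}}\,\frac{\varepsilon}{\underline\delta}<2\,\frac{\varepsilon}{\underline\delta}.$$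
   Context: $X^H$ is the conjugate transpose; $\|\cdot\|_2$ is the spectral norm. A matrix $B\in\mathbb{C}^{p\times q}$ has $\min\{p,q\}$ singular values $\sigma_1(B)\ge\dots\ge\sigma_{\min\{p,q\}}(B)$; $\sigma_{\max}(B)=\sigma_1(B)$, $\sigma_{\min}(B)=\sigma_{\min\{p,q\}}(B)$; $\mathrm{sv}(B)$ is the multiset of these singular values and $\mathrm{sv}_{\mathrm{ext}}(B)$ is $\mathrm{sv}(B)$ together with $|p-q|$ additional copies of $0$.
   Formalization: The final strict inequalities (< π ε/δ̲ in (i), < 2 ε/δ̲ in (ii)) are stated only for ε > 0, since for ε = 0 both sides are 0 and the strict inequality fails; everything else holds for all ε. *)

theory Defs
  imports Jordan_Normal_Form.Schur_Decomposition
begin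

definition unitary_mat :: "complex mat \<Rightarrow> bool" where
  "unitary_mat A \<longleftrightarrow> square_mat A \<and>
     mat_adjoint A * A = 1\<^sub>m (dim_row A) \<and> A * mat_adjoint A = 1\<^sub>m (dim_row A)"

definition vec_norm2 :: "complex vec \<Rightarrow> real" where
  "vec_norm2 v = sqrt (\<Sum>i<dim_vec v. (cmod (v $ i))\<^sup>2)"

(* The operator norm induced by the Euclidean norms. The supremum is over the closed unit
   ball rather than the unit sphere, so that it is never taken over the empty set. *)
definition spectral_norm :: "complex mat \<Rightarrow> real" where
  "spectral_norm A = (SUP v \<in> {v \<in> carrier_vec (dim_col A). vec_norm2 v \<le> 1}. vec_norm2 (A *\<^sub>v v))"

(* The smaller of the two Gram matrices has size min p q, so the roots of its characteristic
   polynomial, with multiplicity, yield exactly min p q singular values. These roots are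
   nonnegative reals, so Re discards nothing. *)
definition sv :: "complex mat \<Rightarrow> real multiset" where
  "sv B = image_mset (\<lambda>z. sqrt (Re z))
     (proots (char_poly (if dim_row B \<le> dim_col B then B * mat_adjoint B else mat_adjoint B * B)))"

(* sigma B i is the i-th largest singular value, meaningful for 1 <= i <= min p q. *)
definition sigma :: "complex mat \<Rightarrow> nat \<Rightarrow> real" where
  "sigma B i = rev (sorted_list_of_multiset (sv B)) ! (i - 1)"

definition sigma_max :: "complex mat \<Rightarrow> real" where
  "sigma_max B = sigma B 1"

definition sigma_min :: "complex mat \<Rightarrow> real" where
  "sigma_min B = sigma B (min (dim_row B) (dim_col B))"

(* With truncated subtraction, one of the two differences is 0 and the other is |p - q|. *)
definition sv_ext :: "complex mat \<Rightarrow> real multiset" where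
  "sv_ext B = sv B + replicate_mset ((dim_row B - dim_col B) + (dim_col B - dim_row B)) 0"

definition solves_system ::
  "complex mat \<Rightarrow> complex mat \<Rightarrow> complex mat \<Rightarrow> complex mat \<Rightarrow> complex mat \<Rightarrow> complex mat \<Rightarrow>
   complex mat \<Rightarrow> complex mat \<Rightarrow> bool" where
  "solves_system G1 G2 E11 E12 E21 E22 \<Gamma> \<Omega> \<longleftrightarrow>
     \<Gamma> * (G1 + E11) - (G2 + E22) * \<Omega> = E21 - \<Gamma> * E12 * \<Omega> \<and>
     \<Omega> * mat_adjoint (G1 + E11) - mat_adjoint (G2 + E22) * \<Gamma>
       = mat_adjoint E12 - \<Omega> * mat_adjoint E21 * \<Gamma>"

end

theory Submission
  imports Defs "HOL-Analysis.Gamma_Function"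
begin

text \<open>
  The system asks for a solution \<open>X = (\<Gamma>, \<Omega>)\<close> of \<open>T X = R - \<Phi> X\<close>, where
  \<open>T (\<Gamma>, \<Omega>) = (\<Gamma> A - B \<Omega>, \<Omega> A\<^sup>H - B\<^sup>H \<Gamma>)\<close> is linear with \<open>A = G\<^sub>1 + E\<^sub>1\<^sub>1\<close> and \<open>B = G\<^sub>2 + E\<^sub>2\<^sub>2\<close>, and
  \<open>\<Phi>\<close> is quadratic. Measure pairs by the larger of the two spectral norms. If \<open>T\<close> is onto and
  \<open>\<parallel>X\<parallel> \<le> c \<parallel>T X\<parallel>\<close>, then \<open>X \<mapsto> T\<^sup>-\<^sup>1 (R - \<Phi> X)\<close> maps the ball of radius \<open>b\<close> into itself,
  where \<open>b\<close> is the smaller root of \<open>c \<epsilon> + c \<epsilon> x\<^sup>2 = x\<close>, and contracts it by a factor below 1 as soon as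
  \<open>4 (c \<epsilon>)\<^sup>2 < 1\<close>. So there is a solution of norm at most \<open>b\<close> (lemma \<open>quadratic_system_solvable\<close>), and
  \<open>b = 2 c \<epsilon> / (1 + sqrt (1 - 4 (c \<epsilon>)\<^sup>2))\<close> is the bound of the theorem (lemma \<open>smaller_root_form\<close>). All
  that remains is the constant: \<open>c = \<pi> / (2 \<delta>')\<close> in the first part and \<open>c = 1 / \<delta>'\<close> in the second.

  For the first constant, replace a block \<open>G\<close> by its Hermitian dilation \<open>[[0, G], [G\<^sup>H, 0]]\<close>. Then \<open>T\<close> becomes
  the Sylvester operator \<open>X \<mapsto> X H\<^sub>A - H\<^sub>B X\<close> on block diagonal matrices, where \<open>H\<^sub>A\<close> and \<open>H\<^sub>B\<close> are the
  dilations of \<open>A\<close> and \<open>B\<close>. The eigenvalues of a dilation are, up to sign, the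
  extended singular values, and they move by at most the norm of a perturbation (lemma
  \<open>singular_value_perturbation\<close>), so the two spectra are at least \<open>\<delta>'\<close> apart.
  In eigenbases the inverse of the operator divides the entry at \<open>(i, j)\<close> by the difference
  \<open>d\<^sub>j - e\<^sub>i\<close> of eigenvalues of \<open>H\<^sub>A\<close> and \<open>H\<^sub>B\<close>; as it is never 0, \<open>T\<close> is onto, also in the second part. That this
  costs only the factor \<open>\<pi> / (2 \<delta>')\<close> is a theorem of Bhatia, Davis and McIntosh, and it reduces to the
  Bohr-Favard inequality for sums of sines with frequencies of modulus at least \<open>\<delta>'\<close> (lemma
  \<open>bohr_favard_sine_sum\<close>): the sesquilinear form of the solution, evaluated at two vectors, is a sum of quotients
  by differences of eigenvalues, and the corresponding sine sum is up to the factor \<open>1 / (2 \<i>)\<close> the difference of two values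
  of the form of the right-hand side, taken at vectors of the same norms.

  The Bohr-Favard inequality in turn comes from the extremal function of Sz.-Nagy, which represents
  \<open>1 / s\<close> for \<open>s \<ge> 1\<close> as
  \<open>\<integral>\<^sub>0\<^sup>\<infinity> tanh (\<pi> u / 2) \<integral>\<^sub>0\<^sup>\<infinity> exp (- u t) sin t sin (s t) dt du\<close>. With the sine of \<open>s t\<close> replaced by a function
  bounded by \<open>C\<close> the inner integral is at most \<open>C coth (\<pi> u / 2) / (1 + u\<^sup>2)\<close>, so that the hyperbolic
  functions cancel and the outer integral is at most \<open>C \<pi> / 2\<close>.

  In the second part all singular values of \<open>A\<close> exceed those of \<open>B\<close> by at least \<open>\<delta>'\<close>, and the triangle inequality
  gives \<open>c = 1 / \<delta>'\<close> at once (lemma \<open>coupled_sylvester_norm_le_separated\<close>).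
\<close>

(* From here on vec, mat and row belong to the matrices whose dimensions are natural numbers. *)
unbundle no vec_syntax
unbundle no inner_syntax
hide_type (open) Finite_Cartesian_Product.vec
hide_const (open) Finite_Cartesian_Product.vec Finite_Cartesian_Product.mat Finite_Cartesian_Product.row

section \<open>The Bohr-Favard inequality for sine sums\<close>

lemma sinh_product_formula:
  fixes x :: real
  shows "(\<lambda>n. pi * x * (\<Prod>k=1..n. 1 + x\<^sup>2 / (real k)\<^sup>2)) \<longlonglongrightarrow> sinh (pi * x)"
proof -
  have "(\<lambda>n. complex_of_real (pi * x * (\<Prod>k=1..n. 1 + x\<^sup>2 / (real k)\<^sup>2)))
          \<longlonglongrightarrow> complex_of_real (sinh (pi * x))"
  proof -
    have "(\<lambda>n. complex_of_real pi * (\<i> * of_real x) * (\<Prod>k=1..n. 1 - (\<i> * of_real x)\<^sup>2 / (of_nat k)\<^sup>2))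
            \<longlonglongrightarrow> sin (complex_of_real pi * (\<i> * of_real x))"
      by (rule sin_product_formula_complex)
    hence "(\<lambda>n. - \<i> * (complex_of_real pi * (\<i> * of_real x) * (\<Prod>k=1..n. 1 - (\<i> * of_real x)\<^sup>2 / (of_nat k)\<^sup>2)))
            \<longlonglongrightarrow> - \<i> * sin (complex_of_real pi * (\<i> * of_real x))"
      by (intro tendsto_mult tendsto_const)
    moreover have "- \<i> * sin (complex_of_real pi * (\<i> * of_real x)) = complex_of_real (sinh (pi * x))"
    proof -
      have "complex_of_real (sinh (pi * x)) = of_real ((exp (pi * x) - inverse (exp (pi * x))) / 2)"
        by (simp add: sinh_def exp_minus)
      also have "\<dots> = - \<i> * sin (\<i> * of_real (pi * x))" by (rule sinh_real)
      also have "\<i> * of_real (pi * x) = complex_of_real pi * (\<i> * of_real x)" by simp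
      finally show ?thesis by simp
    qed
    ultimately show ?thesis
      by (simp add: power_mult_distrib algebra_simps)
  qed
  thus ?thesis by (simp only: tendsto_of_real_iff)
qed

text \<open>Split the product for \<open>sinh (\<pi> x)\<close> into even and odd factors: the even ones are the product for
  \<open>sinh (\<pi> x / 2)\<close>, and \<open>sinh (\<pi> x) = 2 sinh (\<pi> x / 2) cosh (\<pi> x / 2)\<close>.\<close>

lemma cosh_product_formula:
  fixes x :: real
  assumes "x > 0"
  shows "(\<lambda>n. \<Prod>j<n. 1 + x\<^sup>2 / (real (2 * j + 1))\<^sup>2) \<longlonglongrightarrow> cosh (pi * x / 2)"
proof -
  let ?S = "\<lambda>y n. pi * y * (\<Prod>k=1..n. 1 + y\<^sup>2 / (real k)\<^sup>2)"
  have split: "(\<Prod>k=1..2*n. 1 + x\<^sup>2 / (real k)\<^sup>2) =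
      (\<Prod>k=1..n. 1 + (x/2)\<^sup>2 / (real k)\<^sup>2) * (\<Prod>j<n. 1 + x\<^sup>2 / (real (2 * j + 1))\<^sup>2)" for n
  proof (induction n)
    case (Suc n)
    have "(1 + x\<^sup>2 / (real (Suc (Suc (2*n))))\<^sup>2) = 1 + (x/2)\<^sup>2 / (real (Suc n))\<^sup>2"
    proof -
      have "real (Suc (Suc (2*n))) = 2 * real (Suc n)" by simp
      thus ?thesis by (simp only: power_mult_distrib power_divide divide_divide_eq_left)
    qed
    moreover have "(\<Prod>k=1..2 * Suc n. 1 + x\<^sup>2 / (real k)\<^sup>2) =
        (\<Prod>k=1..2*n. 1 + x\<^sup>2 / (real k)\<^sup>2) * (1 + x\<^sup>2 / (real (2*n + 1))\<^sup>2) *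
        (1 + x\<^sup>2 / (real (Suc (Suc (2*n))))\<^sup>2)"
      by simp
    ultimately show ?case unfolding Suc by (simp only: prod.lessThan_Suc prod.nat_ivl_Suc' mult_ac)
  qed simp
  have pos: "(\<Prod>k=1..n. 1 + (x/2)\<^sup>2 / (real k)\<^sup>2) > 0" for n
    by (intro prod_pos) (auto intro: add_pos_nonneg)
  have "strict_mono (\<lambda>n::nat. 2 * n)" by (auto simp: strict_mono_def)
  from LIMSEQ_subseq_LIMSEQ[OF sinh_product_formula[of x] this]
  have A: "(\<lambda>n. ?S x (2*n)) \<longlonglongrightarrow> sinh (pi * x)" by (simp add: o_def)
  have "sinh (pi * (x/2)) \<noteq> 0" using assms by (simp add: sinh_real_zero_iff)
  hence B: "(\<lambda>n. ?S x (2*n) / (2 * ?S (x/2) n)) \<longlonglongrightarrow> sinh (pi * x) / (2 * sinh (pi * (x/2)))"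
    by (intro tendsto_intros A sinh_product_formula) auto
  have "?S x (2*n) / (2 * ?S (x/2) n) = (\<Prod>j<n. 1 + x\<^sup>2 / (real (2 * j + 1))\<^sup>2)" for n
  proof -
    have "pi * x * (p * q) / (2 * (pi * (x / 2) * p)) = q" if "p > 0" for p q :: real
      using that assms by simp
    from this[OF pos] show ?thesis unfolding split .
  qed
  moreover have "sinh (pi * x) / (2 * sinh (pi * (x/2))) = cosh (pi * x / 2)"
    using sinh_double[of "pi * (x/2)"] \<open>sinh (pi * (x/2)) \<noteq> 0\<close> by (simp add: field_simps)
  ultimately show ?thesis using B by simp
qed

text \<open>The sum is a partial sum of the logarithmic derivative of the product for \<open>cosh (\<pi> u / 2)\<close>. The
  difference of the two sides is, up to the factor \<open>\<pi> / 2\<close>, the logarithmic derivative of a tail of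
  that product, which increases. Working with the partial sums instead of \<open>tanh\<close> keeps all later
  sums finite.\<close>

lemma tanh_partial_fractions_le:
  fixes u :: real
  assumes u: "u > 0"
  shows "4 * u / pi * (\<Sum>j<N. 1 / (u\<^sup>2 + (real (2 * j + 1))\<^sup>2)) \<le> tanh (pi * u / 2)"
proof (rule ccontr)
  assume contr: "\<not> ?thesis"
  let ?k = "\<lambda>j. real (2 * j + 1)"
  define L where "L n x = (\<Sum>j<n. ln (1 + x\<^sup>2 / (?k j)\<^sup>2))" for n and x :: real
  define H where "H x = ln (cosh (pi * x / 2)) - L N x" for x :: real
  have pos: "1 + x\<^sup>2 / (?k j)\<^sup>2 > 0" for x j by (intro add_pos_nonneg) auto
  have lim: "(\<lambda>n. L n x) \<longlonglongrightarrow> ln (cosh (pi * x / 2))" if "x > 0" for x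
  proof -
    have "L n x = ln (\<Prod>j<n. 1 + x\<^sup>2 / (?k j)\<^sup>2)" for n
      unfolding L_def using pos by (subst ln_prod) (auto simp: less_imp_neq[symmetric])
    thus ?thesis using tendsto_ln[OF cosh_product_formula[OF that]] by simp
  qed
  \<comment> \<open>\<open>H\<close> is the limit of the logarithms of the tails of the product, and every tail increases.\<close>
  have mono: "H x \<le> H y" if "0 < x" "x \<le> y" for x y
  proof (rule LIMSEQ_le)
    show "(\<lambda>n. L n x - L N x) \<longlonglongrightarrow> H x" unfolding H_def using that
      by (intro tendsto_intros lim)
    show "(\<lambda>n. L n y - L N y) \<longlonglongrightarrow> H y" unfolding H_def using that
      by (intro tendsto_intros lim) auto
    have "L n x - L N x \<le> L n y - L N y" if "n \<ge> N" for n
    proof -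
      have eq: "L n z - L N z = (\<Sum>j\<in>{N..<n}. ln (1 + z\<^sup>2 / (?k j)\<^sup>2))" for z
        unfolding L_def using that sum_diff_nat_ivl[of 0 N n "\<lambda>j. ln (1 + z\<^sup>2 / (?k j)\<^sup>2)"]
        by (simp add: atLeast0LessThan)
      show ?thesis unfolding eq using \<open>0 < x\<close> \<open>x \<le> y\<close> pos
        by (intro sum_mono) (simp add: ln_le_cancel_iff divide_right_mono power_mono del: of_nat_add of_nat_mult)
    qed
    thus "\<exists>M. \<forall>n\<ge>M. L n x - L N x \<le> L n y - L N y" by blast
  qed
  have "(H has_real_derivative
      (pi / 2 * sinh (pi * u / 2)) / cosh (pi * u / 2) -
      (\<Sum>j<N. (2 * u / (?k j)\<^sup>2) / (1 + u\<^sup>2 / (?k j)\<^sup>2))) (at u)"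
    unfolding H_def L_def
  proof (intro DERIV_diff DERIV_sum)
    show "((\<lambda>x. ln (cosh (pi * x / 2))) has_real_derivative
        (pi / 2 * sinh (pi * u / 2)) / cosh (pi * u / 2)) (at u)"
      by (auto intro!: derivative_eq_intros simp: cosh_real_pos field_simps)
    show "((\<lambda>x. ln (1 + x\<^sup>2 / (?k j)\<^sup>2)) has_real_derivative
        (2 * u / (?k j)\<^sup>2) / (1 + u\<^sup>2 / (?k j)\<^sup>2)) (at u)" for j
    proof -
      have "((\<lambda>x. 1 + x\<^sup>2 / (?k j)\<^sup>2) has_real_derivative 0 + 2 * u / (?k j)\<^sup>2) (at u)"
        by (intro DERIV_add DERIV_const DERIV_cdivide) (auto intro!: derivative_eq_intros)
      from DERIV_chain2[OF DERIV_ln_divide[OF pos] this] show ?thesis by (simp add: mult_ac)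
    qed
  qed
  moreover have "(\<Sum>j<N. (2 * u / (?k j)\<^sup>2) / (1 + u\<^sup>2 / (?k j)\<^sup>2)) =
      2 * u * (\<Sum>j<N. 1 / (u\<^sup>2 + (?k j)\<^sup>2))"
    unfolding sum_distrib_left
  proof (intro sum.cong refl)
    fix j :: nat
    have "?k j \<noteq> 0" by linarith
    moreover have "u\<^sup>2 + (?k j)\<^sup>2 > 0" using u by (intro add_pos_nonneg) auto
    ultimately show "2 * u / (?k j)\<^sup>2 / (1 + u\<^sup>2 / (?k j)\<^sup>2) = 2 * u * (1 / (u\<^sup>2 + (?k j)\<^sup>2))"
      by (simp add: divide_simps add.commute mult_ac del: of_nat_add of_nat_mult)
  qed
  ultimately have D: "(H has_real_derivative
      (pi / 2 * tanh (pi * u / 2) - 2 * u * (\<Sum>j<N. 1 / (u\<^sup>2 + (?k j)\<^sup>2)))) (at u)"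
    by (simp add: tanh_def)
  have "pi / 2 * tanh (pi * u / 2) - 2 * u * (\<Sum>j<N. 1 / (u\<^sup>2 + (?k j)\<^sup>2)) < 0"
    using contr by (simp add: field_simps)
  from DERIV_neg_dec_right[OF D this] obtain d where "d > 0" "\<forall>h>0. h < d \<longrightarrow> H (u + h) < H u"
    by blast
  hence "H (u + d/2) < H u" by simp
  with mono[of u "u + d/2"] u \<open>d > 0\<close> show False by simp
qed

text \<open>The Laplace transform of \<open>t \<mapsto> sin t * sin (s * t)\<close> at \<open>u\<close>.\<close>

definition sin_sin_laplace :: "real \<Rightarrow> real \<Rightarrow> real" where
  "sin_sin_laplace u s = (u / (u\<^sup>2 + (s - 1)\<^sup>2) - u / (u\<^sup>2 + (s + 1)\<^sup>2)) / 2"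

text \<open>This takes the place of estimating an integral by the integral of a majorant.\<close>

lemma DERIV_abs_increment_le:
  fixes P W :: "real \<Rightarrow> real"
  assumes "a \<le> b"
    and P: "\<And>x. a < x \<Longrightarrow> x < b \<Longrightarrow> (P has_real_derivative p x) (at x)"
    and W: "\<And>x. a < x \<Longrightarrow> x < b \<Longrightarrow> (W has_real_derivative w x) (at x)"
    and le: "\<And>x. a < x \<Longrightarrow> x < b \<Longrightarrow> \<bar>p x\<bar> \<le> w x"
    and contP: "continuous_on {a..b} P" and contW: "continuous_on {a..b} W"
  shows "\<bar>P b - P a\<bar> \<le> W b - W a"
proof -
  have "W a - P a \<le> W b - P b"
  proof (rule DERIV_nonneg_imp_increasing_open[OF assms(1)])
    fix x assume x: "a < x" "x < b"
    show "\<exists>y. ((\<lambda>x. W x - P x) has_real_derivative y) (at x) \<and> 0 \<le> y"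
      using DERIV_diff[OF W[OF x] P[OF x]] le[OF x] by (intro exI conjI) auto
  qed (intro continuous_intros contP contW)
  moreover have "W a + P a \<le> W b + P b"
  proof (rule DERIV_nonneg_imp_increasing_open[OF assms(1)])
    fix x assume x: "a < x" "x < b"
    show "\<exists>y. ((\<lambda>x. W x + P x) has_real_derivative y) (at x) \<and> 0 \<le> y"
      using DERIV_add[OF W[OF x] P[OF x]] le[OF x] by (intro exI conjI) auto
  qed (intro continuous_intros contP contW)
  ultimately show ?thesis by linarith
qed

text \<open>The left-hand side is \<open>\<integral>\<^sub>0\<^sup>\<infinity> exp (- u t) sin t F t dt\<close> with the sine sum \<open>F\<close>, and
  \<open>\<integral>\<^sub>0\<^sup>\<infinity> exp (- u t) \<bar>sin t\<bar> dt = 1 / (tanh (\<pi> u / 2) (1 + u\<^sup>2))\<close>: over the successive half periods of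
  the sine the integral is a geometric series. In the proof \<open>P\<close> and \<open>W\<close> are antiderivatives of
  \<open>exp (- u t) sin t F t\<close> and of \<open>exp (- u t) sin t\<close>.\<close>

lemma sin_sin_laplace_sum_le:
  fixes c s :: "'i \<Rightarrow> real"
  assumes bound: "\<And>t. \<bar>\<Sum>i\<in>I. c i * sin (s i * t)\<bar> \<le> C" and u: "u > 0"
  shows "\<bar>\<Sum>i\<in>I. c i * sin_sin_laplace u (s i)\<bar> \<le> C / (tanh (pi * u / 2) * (1 + u\<^sup>2))"
proof -
  have C: "C \<ge> 0" using bound[of 0] by simp
  define e where "e = exp (- u * pi)"
  have e: "0 < e" "e < 1" using u by (auto simp: e_def)
  have upos: "u\<^sup>2 + a\<^sup>2 > 0" for a using u by (intro add_pos_nonneg) auto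
  \<comment> \<open>\<open>q a\<close> is an antiderivative of \<open>exp (- u t) cos (a t)\<close>, and
    \<open>2 sin t sin (s t) = cos ((s - 1) t) - cos ((s + 1) t)\<close>.\<close>
  define q where "q a t = exp (- u * t) * ((a * sin (a * t) - u * cos (a * t)) / (u\<^sup>2 + a\<^sup>2))" for a t
  have dq: "(q a has_real_derivative exp (- u * t) * cos (a * t)) (at t)" for a t
  proof -
    have "((\<lambda>t. exp (- u * t) * (a * sin (a * t) - u * cos (a * t))) has_real_derivative
        (u\<^sup>2 + a\<^sup>2) * (exp (- u * t) * cos (a * t))) (at t)"
      by (auto intro!: derivative_eq_intros simp: algebra_simps power2_eq_square)
    from DERIV_cdivide[OF this, of "u\<^sup>2 + a\<^sup>2"] show ?thesis
      using less_imp_neq[OF upos[of a]] unfolding q_def[abs_def]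
      by (simp only: nonzero_mult_div_cancel_left times_divide_eq_right not_sym)
  qed
  define P where "P t = (\<Sum>i\<in>I. c i * ((q (s i - 1) t - q (s i + 1) t) / 2))" for t
  define F where "F t = (\<Sum>i\<in>I. c i * sin (s i * t))" for t
  have dP: "(P has_real_derivative exp (- u * t) * (sin t * F t)) (at t)" for t
  proof -
    have "(P has_real_derivative
        (\<Sum>i\<in>I. c i * ((exp (- u * t) * cos ((s i - 1) * t) - exp (- u * t) * cos ((s i + 1) * t)) / 2))) (at t)"
      unfolding P_def by (intro DERIV_sum DERIV_cmult DERIV_cdivide DERIV_diff dq)
    also have "(\<Sum>i\<in>I. c i * ((exp (- u * t) * cos ((s i - 1) * t) - exp (- u * t) * cos ((s i + 1) * t)) / 2))
        = exp (- u * t) * (sin t * F t)"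
      unfolding F_def sum_distrib_left
      by (intro sum.cong refl) (simp add: left_diff_distrib distrib_right cos_diff cos_add field_simps)
    finally show ?thesis .
  qed
  define W where "W t = - exp (- u * t) * ((u * sin t + cos t) / (1 + u\<^sup>2))" for t
  have pos1: "1 + u\<^sup>2 > 0" by (intro add_pos_nonneg) auto
  have dW: "(W has_real_derivative exp (- u * t) * sin t) (at t)" for t
  proof -
    have "((\<lambda>t. - exp (- u * t) * (u * sin t + cos t)) has_real_derivative
        (1 + u\<^sup>2) * (exp (- u * t) * sin t)) (at t)"
      by (auto intro!: derivative_eq_intros simp: algebra_simps power2_eq_square)
    from DERIV_cdivide[OF this, of "1 + u\<^sup>2"] show ?thesis
      using pos1 by (simp add: W_def[abs_def])
  qed
  have step: "\<bar>P (real (Suc n) * pi) - P (real n * pi)\<bar> \<le> C * (1 + e) / (1 + u\<^sup>2) * e ^ n" for n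
  proof -
    have "\<bar>P (real (Suc n) * pi) - P (real n * pi)\<bar>
        \<le> C * (-1) ^ n * W (real (Suc n) * pi) - C * (-1) ^ n * W (real n * pi)"
    proof (rule DERIV_abs_increment_le[OF _ dP DERIV_cmult[OF dW]])
      fix x assume x: "real n * pi < x" "x < real (Suc n) * pi"
      have "sin (x - real n * pi) = (-1) ^ n * sin x"
        by (simp add: sin_diff)
      moreover have "sin (x - real n * pi) \<ge> 0"
        using x by (intro sin_ge_zero) (auto simp: algebra_simps)
      ultimately have "\<bar>sin x\<bar> = (-1) ^ n * sin x"
        by (metis abs_of_nonneg abs_mult abs_neg_one mult_1 power_abs power_one)
      moreover have "\<bar>F x\<bar> \<le> C" using bound by (simp add: F_def)
      ultimately have "\<bar>sin x\<bar> * \<bar>F x\<bar> \<le> ((-1) ^ n * sin x) * C" by (intro mult_mono) auto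
      hence "exp (- u * x) * (\<bar>sin x\<bar> * \<bar>F x\<bar>) \<le> exp (- u * x) * (((-1) ^ n * sin x) * C)"
        by (intro mult_left_mono) auto
      thus "\<bar>exp (- u * x) * (sin x * F x)\<bar> \<le> C * (- 1) ^ n * (exp (- u * x) * sin x)"
        by (simp add: abs_mult mult_ac)
    next
      show "continuous_on {real n * pi..real (Suc n) * pi} P"
        by (rule DERIV_continuous_on[OF has_field_derivative_at_within[OF dP]])
      show "continuous_on {real n * pi..real (Suc n) * pi} (\<lambda>x. C * (- 1) ^ n * W x)"
        by (intro continuous_intros DERIV_continuous_on[OF has_field_derivative_at_within[OF dW]])
    qed simp
    also have "\<dots> = C * (1 + e) / (1 + u\<^sup>2) * e ^ n"
    proof -
      have Wn: "W (real k * pi) = - (e ^ k * ((-1) ^ k / (1 + u\<^sup>2)))" for k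
      proof -
        have "exp (- u * (real k * pi)) = e ^ k" unfolding e_def exp_of_nat_mult[symmetric] by (simp add: mult_ac)
        thus ?thesis by (simp add: W_def)
      qed
      have sq: "(-1::real) ^ n * (-1) ^ n = 1" by (simp flip: power_mult_distrib)
      have "C * (-1) ^ n * W (real (Suc n) * pi) - C * (-1) ^ n * W (real n * pi) =
          ((-1::real) ^ n * (-1) ^ n) * (C * (1 + e) / (1 + u\<^sup>2) * e ^ n)"
        unfolding Wn by (simp add: divide_inverse algebra_simps)
      thus ?thesis unfolding sq by simp
    qed
    finally show ?thesis .
  qed
  have tot: "\<bar>P (real n * pi) - P 0\<bar> \<le> C / (tanh (pi * u / 2) * (1 + u\<^sup>2))" for n
  proof -
    have "P (real n * pi) - P 0 = (\<Sum>k<n. P (real (Suc k) * pi) - P (real k * pi))"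
      by (subst sum_lessThan_telescope) simp
    also have "\<bar>\<dots>\<bar> \<le> (\<Sum>k<n. C * (1 + e) / (1 + u\<^sup>2) * e ^ k)"
      by (intro order.trans[OF sum_abs] sum_mono step)
    also have "\<dots> = C * (1 + e) / (1 + u\<^sup>2) * ((1 - e ^ n) / (1 - e))"
      using e by (simp only: sum_distrib_left[symmetric] sum_gp_strict) simp
    also have "\<dots> \<le> C * (1 + e) / (1 + u\<^sup>2) * (1 / (1 - e))"
      using e C pos1 by (intro mult_left_mono divide_right_mono) auto
    also have "\<dots> = C / (((1 - e) / (1 + e)) * (1 + u\<^sup>2))" by simp
    also have "(1 - e) / (1 + e) = tanh (pi * u / 2)"
      by (simp add: tanh_real_altdef e_def mult_ac)
    finally show ?thesis .
  qed
  have lim: "(\<lambda>n. P (real n * pi)) \<longlonglongrightarrow> 0"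
  proof -
    have "(\<lambda>n. q a (real n * pi)) \<longlonglongrightarrow> 0" for a
    proof (rule Lim_null_comparison)
      have "norm (q a (real n * pi)) \<le> e ^ n * ((\<bar>a\<bar> + u) / (u\<^sup>2 + a\<^sup>2))" for n
      proof -
        have "exp (- u * (real n * pi)) = e ^ n" unfolding e_def exp_of_nat_mult[symmetric] by (simp add: mult_ac)
        moreover have "\<bar>a * sin (a * t) - u * cos (a * t)\<bar> \<le> \<bar>a\<bar> + u" for t
        proof -
          have "\<bar>a * sin (a * t)\<bar> \<le> \<bar>a\<bar>" "\<bar>u * cos (a * t)\<bar> \<le> u"
            using u by (auto simp: abs_mult mult_left_le)
          thus ?thesis by linarith
        qed
        ultimately show ?thesis using e upos[of a]
          by (simp add: q_def abs_mult del: mult_minus_left) (intro mult_left_mono divide_right_mono, auto)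
      qed
      thus "\<forall>\<^sub>F n in sequentially. norm (q a (real n * pi)) \<le> e ^ n * ((\<bar>a\<bar> + u) / (u\<^sup>2 + a\<^sup>2))"
        by simp
      show "(\<lambda>n. e ^ n * ((\<bar>a\<bar> + u) / (u\<^sup>2 + a\<^sup>2))) \<longlonglongrightarrow> 0"
        using e by (intro tendsto_mult_left_zero LIMSEQ_power_zero) auto
    qed
    hence "(\<lambda>n. P (real n * pi)) \<longlonglongrightarrow> (\<Sum>i\<in>I. c i * ((0 - 0) / 2))"
      unfolding P_def by (intro tendsto_intros) auto
    thus ?thesis by simp
  qed
  have "(\<lambda>n. \<bar>P (real n * pi) - P 0\<bar>) \<longlonglongrightarrow> \<bar>0 - P 0\<bar>"
    by (intro tendsto_intros lim)
  hence "\<bar>0 - P 0\<bar> \<le> C / (tanh (pi * u / 2) * (1 + u\<^sup>2))"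
    by (rule LIMSEQ_le_const2) (use tot in blast)
  moreover have "0 - P 0 = (\<Sum>i\<in>I. c i * sin_sin_laplace u (s i))"
    unfolding P_def q_def sin_sin_laplace_def
    by (simp add: sum_negf[symmetric] diff_divide_distrib algebra_simps)
  ultimately show ?thesis by simp
qed
text \<open>An explicit antiderivative shows that the integral of \<open>u\<^sup>2 / ((u\<^sup>2 + a\<^sup>2) (u\<^sup>2 + k\<^sup>2))\<close> over the half line
  is \<open>\<pi> / (2 (a + k))\<close>. When \<open>a = 0\<close> the integrand jumps at 0 because a quotient by 0 is 0, hence
  the derivative for \<open>u > 0\<close> only, with continuity at 0.\<close>

lemma rational_antiderivative_limit:
  fixes a k :: real
  assumes a: "a \<ge> 0" and k: "k > 0"
  obtains R where "R 0 = 0" "continuous_on {0..} R"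
    "\<And>u. u > 0 \<Longrightarrow> (R has_real_derivative u\<^sup>2 / ((u\<^sup>2 + a\<^sup>2) * (u\<^sup>2 + k\<^sup>2))) (at u)"
    "(R \<longlongrightarrow> pi / (2 * (a + k))) at_top"
proof -
  have lim: "((\<lambda>u. arctan (u / b)) \<longlongrightarrow> pi / 2) at_top" if "b > 0" for b :: real
    using that by (intro filterlim_compose[OF tendsto_arctan_at_top] filterlim_at_top_mult_tendsto_pos)
      (auto simp: divide_inverse intro!: filterlim_tendsto_pos_mult_at_top filterlim_ident 
        filterlim_at_top_mult_tendsto_pos[where c = "inverse b"])
  have darc: "((\<lambda>u. b * arctan (u / b)) has_real_derivative b\<^sup>2 / (u\<^sup>2 + b\<^sup>2)) (at u)"
    if "b \<ge> 0" "u > 0" for b u :: real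
  proof (cases "b = 0")
    case False
    have "((\<lambda>u. b * arctan (u / b)) has_real_derivative b * (inverse (1 + (u / b)\<^sup>2) * (1 / b))) (at u)"
      using False by (auto intro!: derivative_eq_intros simp: field_simps)
    moreover have "b * (inverse (1 + (u / b)\<^sup>2) * (1 / b)) = b\<^sup>2 / (u\<^sup>2 + b\<^sup>2)"
    proof -
      have "u\<^sup>2 + b\<^sup>2 > 0" using that by (intro add_pos_nonneg) auto
      moreover have "1 + (u / b)\<^sup>2 = (u\<^sup>2 + b\<^sup>2) / b\<^sup>2" using False by (simp add: field_simps)
      ultimately show ?thesis using False by (simp add: power2_eq_square)
    qed
    ultimately show ?thesis by simp
  qed simp
  show ?thesis
  proof (cases "a = k")
    case False
    hence ne: "k\<^sup>2 - a\<^sup>2 \<noteq> 0" using a k by (simp add: power2_eq_iff_nonneg)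
    define R where "R u = (k * arctan (u / k) - a * arctan (u / a)) / (k\<^sup>2 - a\<^sup>2)" for u
    show ?thesis
    proof (rule that[of R])
      show "R 0 = 0" by (simp add: R_def)
      have "continuous_on {0..} (\<lambda>u. b * arctan (u / b))" for b :: real
        by (cases "b = 0") (auto intro!: continuous_intros)
      thus "continuous_on {0..} R" unfolding R_def[abs_def]
        by (intro continuous_on_divide continuous_on_diff continuous_on_const) (use ne in auto)
      show "(R has_real_derivative u\<^sup>2 / ((u\<^sup>2 + a\<^sup>2) * (u\<^sup>2 + k\<^sup>2))) (at u)" if u: "u > 0" for u
      proof -
        have "(R has_real_derivative (k\<^sup>2 / (u\<^sup>2 + k\<^sup>2) - a\<^sup>2 / (u\<^sup>2 + a\<^sup>2)) / (k\<^sup>2 - a\<^sup>2)) (at u)"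
          unfolding R_def[abs_def] using a k u by (intro DERIV_cdivide DERIV_diff darc) auto
        moreover have "u\<^sup>2 + k\<^sup>2 > 0" "u\<^sup>2 + a\<^sup>2 > 0" using u by (auto intro: add_pos_nonneg)
        hence "k\<^sup>2 / (u\<^sup>2 + k\<^sup>2) - a\<^sup>2 / (u\<^sup>2 + a\<^sup>2) = (k\<^sup>2 - a\<^sup>2) * (u\<^sup>2 / ((u\<^sup>2 + a\<^sup>2) * (u\<^sup>2 + k\<^sup>2)))"
        proof -
          have "k\<^sup>2 / X - a\<^sup>2 / Y = (k\<^sup>2 * Y - a\<^sup>2 * X) / (Y * X)" if "X > 0" "Y > 0" for X Y :: real
            using that by (simp add: field_simps)
          from this[OF \<open>u\<^sup>2 + k\<^sup>2 > 0\<close> \<open>u\<^sup>2 + a\<^sup>2 > 0\<close>] show ?thesis by (simp add: algebra_simps)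
        qed
        ultimately show ?thesis using ne by simp
      qed
      have "((\<lambda>u. b * arctan (u / b)) \<longlongrightarrow> b * (pi / 2)) at_top" if "b \<ge> 0" for b
      proof (cases "b = 0")
        case False
        thus ?thesis using that by (intro tendsto_mult tendsto_const lim) auto
      qed simp
      hence "(R \<longlongrightarrow> (k * (pi / 2) - a * (pi / 2)) / (k\<^sup>2 - a\<^sup>2)) at_top"
        unfolding R_def[abs_def] using k ne
        by (intro tendsto_divide tendsto_diff tendsto_const) (use a k in auto)
      moreover have "(k * (pi / 2) - a * (pi / 2)) / (k\<^sup>2 - a\<^sup>2) = pi / (2 * (a + k))"
      proof -
        have "k\<^sup>2 - a\<^sup>2 = (k - a) * (a + k)" by (simp add: power2_eq_square algebra_simps)
        thus ?thesis using False a k by (simp add: divide_simps) (simp add: algebra_simps)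
      qed
      ultimately show "(R \<longlongrightarrow> pi / (2 * (a + k))) at_top" by simp
    qed
  next
    case True
    define R where "R u = arctan (u / k) / (2 * k) - u / (2 * (u\<^sup>2 + k\<^sup>2))" for u
    have pos: "u\<^sup>2 + k\<^sup>2 > 0" for u using k by (auto intro: add_nonneg_pos)
    show ?thesis
    proof (rule that[of R])
      show "R 0 = 0" by (simp add: R_def)
      show "continuous_on {0..} R" unfolding R_def[abs_def]
      proof (intro continuous_intros)
        show "\<forall>x\<in>{0..}. 2 * (x\<^sup>2 + k\<^sup>2) \<noteq> 0" using pos by (metis mult_eq_0_iff less_irrefl zero_neq_numeral)
      qed (use k in auto)
      show "(R has_real_derivative u\<^sup>2 / ((u\<^sup>2 + a\<^sup>2) * (u\<^sup>2 + k\<^sup>2))) (at u)" if u: "u > 0" for u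
      proof -
        have "((\<lambda>u. arctan (u / k) / (2 * k)) has_real_derivative 1 / (2 * (u\<^sup>2 + k\<^sup>2))) (at u)"
        proof -
          from DERIV_cdivide[OF darc[OF less_imp_le[OF k] u], of "2 * k\<^sup>2"] 
          show ?thesis using k by (simp add: power2_eq_square mult_ac)
        qed
        moreover have "((\<lambda>u. u / (2 * (u\<^sup>2 + k\<^sup>2))) has_real_derivative
            (1 * (2 * (u\<^sup>2 + k\<^sup>2)) - u * (2 * (2 * u))) / ((2 * (u\<^sup>2 + k\<^sup>2)) * (2 * (u\<^sup>2 + k\<^sup>2)))) (at u)"
        proof (rule DERIV_divide)
          show "2 * (u\<^sup>2 + k\<^sup>2) \<noteq> 0"
            using less_imp_neq[OF pos[of u]] by (metis mult_eq_0_iff zero_neq_numeral)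
        qed (auto intro!: derivative_eq_intros)
        ultimately have "(R has_real_derivative 1 / (2 * (u\<^sup>2 + k\<^sup>2)) - 
            (1 * (2 * (u\<^sup>2 + k\<^sup>2)) - u * (2 * (2 * u))) / ((2 * (u\<^sup>2 + k\<^sup>2)) * (2 * (u\<^sup>2 + k\<^sup>2)))) (at u)"
          unfolding R_def[abs_def] by (rule DERIV_diff)
        moreover have "1 / (2 * D) - (1 * (2 * D) - u * (2 * (2 * u))) / ((2 * D) * (2 * D)) = u\<^sup>2 / (D * D)"
          if "D > 0" for D :: real
          using that by (simp add: divide_simps power2_eq_square)
        from this[OF pos[of u]] have "1 / (2 * (u\<^sup>2 + k\<^sup>2)) -
            (1 * (2 * (u\<^sup>2 + k\<^sup>2)) - u * (2 * (2 * u))) / ((2 * (u\<^sup>2 + k\<^sup>2)) * (2 * (u\<^sup>2 + k\<^sup>2))) =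
            u\<^sup>2 / ((u\<^sup>2 + a\<^sup>2) * (u\<^sup>2 + k\<^sup>2))"
          unfolding True .
        ultimately show ?thesis by (simp only:)
      qed
      have "((\<lambda>u. u / (2 * (u\<^sup>2 + k\<^sup>2))) \<longlongrightarrow> 0) at_top" 
      proof (rule Lim_null_comparison)
        show "\<forall>\<^sub>F u in at_top. norm (u / (2 * (u\<^sup>2 + k\<^sup>2))) \<le> inverse u"
          using eventually_gt_at_top[of 0]
        proof eventually_elim
          case (elim u)
          thus ?case using pos[of u] by (simp add: divide_simps power2_eq_square)
        qed
        show "(inverse \<longlongrightarrow> (0::real)) at_top" by (rule tendsto_inverse_0_at_top[OF filterlim_ident])
      qed
      hence "(R \<longlongrightarrow> (pi / 2) / (2 * k) - 0) at_top"
        unfolding R_def[abs_def] using k by (intro tendsto_diff tendsto_divide tendsto_const lim) auto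
      thus "(R \<longlongrightarrow> pi / (2 * (a + k))) at_top" using True k by simp
    qed
  qed
qed

text \<open>The summands arise when the partial fractions of \<open>tanh\<close> are integrated term by term against
  \<open>sin_sin_laplace u s\<close>.\<close>

lemma reciprocal_telescope:
  fixes s :: real
  shows "(\<Sum>j<N. 2 / pi * (pi / (2 * (s - 1 + real (2 * j + 1))) - pi / (2 * (s + 1 + real (2 * j + 1))))) =
    1 / s - 1 / (s + 2 * real N)"
proof -
  have cancel: "2 / pi * (pi / (2 * x) - pi / (2 * y)) = 1 / x - 1 / y" for x y :: real
    by (simp add: right_diff_distrib)
  have "s - 1 + real (2 * j + 1) = s + 2 * real j" "s + 1 + real (2 * j + 1) = s + 2 * real (Suc j)" for j
    by simp_all
  hence "(\<Sum>j<N. 2 / pi * (pi / (2 * (s - 1 + real (2 * j + 1))) - pi / (2 * (s + 1 + real (2 * j + 1))))) =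
      (\<Sum>j<N. 1 / (s + 2 * real j) - 1 / (s + 2 * real (Suc j)))"
    by (simp only: cancel)
  also have "\<dots> = 1 / (s + 2 * real 0) - 1 / (s + 2 * real N)"
    by (rule sum_lessThan_telescope')
  finally show ?thesis by simp
qed

text \<open>Integrate the bound of \<open>sin_sin_laplace_sum_le\<close> against the partial fraction sum \<open>\<tau>\<close> of \<open>tanh\<close>. Since
  \<open>\<tau> \<le> tanh\<close>, the result is at most \<open>C \<integral>\<^sub>0\<^sup>\<infinity> du / (1 + u\<^sup>2) = C \<pi> / 2\<close>. Integrated exactly, each
  frequency \<open>s\<close> contributes the telescoping sum \<open>1 / s - 1 / (s + 2 N)\<close>, which tends to \<open>1 / s\<close>. The
  hypothesis \<open>s \<ge> 1\<close> makes \<open>s - 1\<close> nonnegative, as the value \<open>\<pi> / (2 (a + k))\<close> of the integrals requires of \<open>a\<close>.\<close>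

lemma bohr_favard_sine_sum_unit:
  fixes c s :: "'i \<Rightarrow> real"
  assumes bound: "\<And>t. \<bar>\<Sum>i\<in>I. c i * sin (s i * t)\<bar> \<le> C" and s: "\<And>i. i \<in> I \<Longrightarrow> s i \<ge> 1"
  shows "\<bar>\<Sum>i\<in>I. c i / s i\<bar> \<le> C * (pi / 2)"
proof -
  have C: "C \<ge> 0" using bound[of 0] by simp
  have "\<exists>R. \<forall>a k. a \<ge> 0 \<and> k > 0 \<longrightarrow> R a k 0 = 0 \<and> continuous_on {0..} (R a k) \<and>
    (\<forall>u>0. (R a k has_real_derivative u\<^sup>2 / ((u\<^sup>2 + a\<^sup>2) * (u\<^sup>2 + k\<^sup>2))) (at u)) \<and>
    (R a k \<longlongrightarrow> pi / (2 * (a + k))) at_top"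
  proof (intro choice allI)
    fix a k :: real
    show "\<exists>R. a \<ge> 0 \<and> k > 0 \<longrightarrow> R 0 = 0 \<and> continuous_on {0..} R \<and>
      (\<forall>u>0. (R has_real_derivative u\<^sup>2 / ((u\<^sup>2 + a\<^sup>2) * (u\<^sup>2 + k\<^sup>2))) (at u)) \<and>
      (R \<longlongrightarrow> pi / (2 * (a + k))) at_top"
      using rational_antiderivative_limit[of a k] by metis
  qed
  then obtain R where R: "\<And>a k. a \<ge> 0 \<Longrightarrow> k > 0 \<Longrightarrow> R a k 0 = 0"
    and contR: "\<And>a k. a \<ge> 0 \<Longrightarrow> k > 0 \<Longrightarrow> continuous_on {0..} (R a k)"
    and derR: "\<And>a k u. a \<ge> 0 \<Longrightarrow> k > 0 \<Longrightarrow> u > 0 \<Longrightarrow>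
      (R a k has_real_derivative u\<^sup>2 / ((u\<^sup>2 + a\<^sup>2) * (u\<^sup>2 + k\<^sup>2))) (at u)"
    and limR: "\<And>a k. a \<ge> 0 \<Longrightarrow> k > 0 \<Longrightarrow> (R a k \<longlongrightarrow> pi / (2 * (a + k))) at_top"
    by blast
  let ?k = "\<lambda>j. real (2 * j + 1)"
  have k: "?k j > 0" for j by simp
  have s1: "s i - 1 \<ge> 0" "s i + 1 \<ge> 0" "s i > 0" if "i \<in> I" for i using s[OF that] by auto
  have partial: "\<bar>\<Sum>i\<in>I. c i * (1 / s i - 1 / (s i + 2 * real N))\<bar> \<le> C * (pi / 2)" for N
  proof -
    \<comment> \<open>\<open>Q\<close> is the antiderivative of \<open>\<tau> * \<Phi>\<close> that vanishes at 0.\<close>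
    define Q where "Q u = (\<Sum>i\<in>I. c i * (\<Sum>j<N. 2 / pi * (R (s i - 1) (?k j) u - R (s i + 1) (?k j) u)))" for u
    define \<tau> where "\<tau> u = 4 * u / pi * (\<Sum>j<N. 1 / (u\<^sup>2 + (?k j)\<^sup>2))" for u
    define \<Phi> where "\<Phi> u = (\<Sum>i\<in>I. c i * sin_sin_laplace u (s i))" for u
    have dQ: "(Q has_real_derivative \<tau> u * \<Phi> u) (at u)" if u: "u > 0" for u
    proof -
      have "(Q has_real_derivative (\<Sum>i\<in>I. c i * (\<Sum>j<N. 2 / pi *
         (u\<^sup>2 / ((u\<^sup>2 + (s i - 1)\<^sup>2) * (u\<^sup>2 + (?k j)\<^sup>2)) - u\<^sup>2 / ((u\<^sup>2 + (s i + 1)\<^sup>2) * (u\<^sup>2 + (?k j)\<^sup>2)))))) (at u)"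
        unfolding Q_def[abs_def]
      proof (rule DERIV_sum, rule DERIV_cmult, rule DERIV_sum, rule DERIV_cmult)
        fix i j assume "i \<in> I"
        show "((\<lambda>u. R (s i - 1) (?k j) u - R (s i + 1) (?k j) u) has_real_derivative
            u\<^sup>2 / ((u\<^sup>2 + (s i - 1)\<^sup>2) * (u\<^sup>2 + (?k j)\<^sup>2)) - u\<^sup>2 / ((u\<^sup>2 + (s i + 1)\<^sup>2) * (u\<^sup>2 + (?k j)\<^sup>2))) (at u)"
          by (rule DERIV_diff[OF derR[OF s1(1)[OF \<open>i \<in> I\<close>] k u] derR[OF s1(2)[OF \<open>i \<in> I\<close>] k u]])
      qed
      moreover have "(\<Sum>j<N. 2 / pi *
         (u\<^sup>2 / ((u\<^sup>2 + (s i - 1)\<^sup>2) * (u\<^sup>2 + (?k j)\<^sup>2)) - u\<^sup>2 / ((u\<^sup>2 + (s i + 1)\<^sup>2) * (u\<^sup>2 + (?k j)\<^sup>2))))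
         = \<tau> u * sin_sin_laplace u (s i)" for i
      proof -
        have alg: "2 / pi * (u\<^sup>2 / (A * D) - u\<^sup>2 / (B * D)) = 4 * u / pi * ((u / A - u / B) / 2) * (1 / D)"
          for A B D :: real
        proof -
          have "u\<^sup>2 / (A * D) = u * (u / A) * (1 / D)" for A by (simp add: power2_eq_square)
          moreover have "2 / pi * (u * x * d - u * y * d) = 4 * u / pi * ((x - y) / 2) * d" for x y d :: real
            by (simp add: algebra_simps diff_divide_distrib)
          ultimately show ?thesis by (simp only:)
        qed
        have "\<tau> u * sin_sin_laplace u (s i) = 4 * u / pi * sin_sin_laplace u (s i) * (\<Sum>j<N. 1 / (u\<^sup>2 + (?k j)\<^sup>2))"
          by (simp add: \<tau>_def)
        thus ?thesis
          by (simp only: sin_sin_laplace_def sum_distrib_left alg)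
      qed
      ultimately have "(Q has_real_derivative (\<Sum>i\<in>I. c i * (\<tau> u * sin_sin_laplace u (s i)))) (at u)"
        by (simp only:)
      thus ?thesis by (simp add: \<Phi>_def sum_distrib_left mult_ac)
    qed
    have le: "\<bar>\<tau> u * \<Phi> u\<bar> \<le> C * inverse (1 + u\<^sup>2)" if u: "u > 0" for u
    proof -
      let ?T = "tanh (pi * u / 2)"
      have T: "?T > 0" using u by (simp add: tanh_real_pos_iff)
      have "0 \<le> \<tau> u" unfolding \<tau>_def using u by (intro mult_nonneg_nonneg sum_nonneg) auto
      hence "\<bar>\<tau> u\<bar> \<le> ?T" using tanh_partial_fractions_le[OF u, of N] by (simp add: \<tau>_def)
      moreover have "\<bar>\<Phi> u\<bar> \<le> C / (?T * (1 + u\<^sup>2))"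
        unfolding \<Phi>_def by (rule sin_sin_laplace_sum_le[OF bound u])
      ultimately have "\<bar>\<tau> u * \<Phi> u\<bar> \<le> ?T * (C / (?T * (1 + u\<^sup>2)))"
        unfolding abs_mult using T by (intro mult_mono) auto
      also have "x * (C / (x * D)) = C * inverse D" if "x > 0" for x D :: real
        using that by (simp add: field_simps)
      from this[OF T] have "?T * (C / (?T * (1 + u\<^sup>2))) = C * inverse (1 + u\<^sup>2)" .
      finally show ?thesis .
    qed
    have inc: "\<bar>Q L - Q 0\<bar> \<le> C * (pi / 2)" if L: "L \<ge> 0" for L
    proof -
      have "\<bar>Q L - Q 0\<bar> \<le> C * arctan L - C * arctan 0"
      proof (rule DERIV_abs_increment_le[where p = "\<lambda>u. \<tau> u * \<Phi> u" and w = "\<lambda>u. C * inverse (1 + u\<^sup>2)"])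
        fix u :: real assume u: "0 < u"
        show "(Q has_real_derivative \<tau> u * \<Phi> u) (at u)" by (rule dQ[OF u])
        show "((\<lambda>u. C * arctan u) has_real_derivative C * inverse (1 + u\<^sup>2)) (at u)"
          by (rule DERIV_cmult[OF DERIV_arctan])
        show "\<bar>\<tau> u * \<Phi> u\<bar> \<le> C * inverse (1 + u\<^sup>2)" by (rule le[OF u])
      next
        show "continuous_on {0..L} Q" unfolding Q_def[abs_def]
        proof (rule continuous_on_sum, rule continuous_on_mult[OF continuous_on_const],
            rule continuous_on_sum, rule continuous_on_mult[OF continuous_on_const])
          fix i j assume "i \<in> I"
          show "continuous_on {0..L} (\<lambda>u. R (s i - 1) (?k j) u - R (s i + 1) (?k j) u)"
            by (rule continuous_on_subset[OF continuous_on_diff[OF contR[OF s1(1)[OF \<open>i \<in> I\<close>] k]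
                contR[OF s1(2)[OF \<open>i \<in> I\<close>] k]]]) auto
        qed
        show "continuous_on {0..L} (\<lambda>x. C * arctan x)" by (intro continuous_intros)
      qed (rule L)
      also have "\<dots> \<le> C * (pi / 2)"
        using mult_left_mono[OF less_imp_le[OF arctan_ubound[of L]] C] by simp
      finally show ?thesis .
    qed
    have "Q 0 = 0" unfolding Q_def
    proof (intro sum.neutral ballI)
      fix i assume i: "i \<in> I"
      have "R (s i - 1) (?k j) 0 = 0" "R (s i + 1) (?k j) 0 = 0" for j
        by (rule R[OF s1(1)[OF i] k], rule R[OF s1(2)[OF i] k])
      thus "c i * (\<Sum>j<N. 2 / pi * (R (s i - 1) (?k j) 0 - R (s i + 1) (?k j) 0)) = 0"
        by (simp only: diff_0_right mult_zero_right sum.neutral_const)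
    qed
    have limQ: "(Q \<longlongrightarrow> (\<Sum>i\<in>I. c i * (\<Sum>j<N. 2 / pi *
        (pi / (2 * (s i - 1 + ?k j)) - pi / (2 * (s i + 1 + ?k j)))))) at_top"
      unfolding Q_def[abs_def]
    proof (rule tendsto_sum, rule tendsto_mult[OF tendsto_const], rule tendsto_sum, rule tendsto_mult[OF tendsto_const])
      fix i j assume "i \<in> I"
      show "((\<lambda>u. R (s i - 1) (?k j) u - R (s i + 1) (?k j) u) \<longlongrightarrow>
          pi / (2 * (s i - 1 + ?k j)) - pi / (2 * (s i + 1 + ?k j))) at_top"
        by (rule tendsto_diff[OF limR[OF s1(1)[OF \<open>i \<in> I\<close>] k] limR[OF s1(2)[OF \<open>i \<in> I\<close>] k]])
    qed
    have telescope: "(\<Sum>i\<in>I. c i * (\<Sum>j<N. 2 / pi * (pi / (2 * (s i - 1 + ?k j)) - pi / (2 * (s i + 1 + ?k j)))))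
        = (\<Sum>i\<in>I. c i * (1 / s i - 1 / (s i + 2 * real N)))"
      by (simp only: reciprocal_telescope)
    from tendsto_rabs[OF limQ[unfolded telescope]]
    have "((\<lambda>L. \<bar>Q L\<bar>) \<longlongrightarrow> \<bar>\<Sum>i\<in>I. c i * (1 / s i - 1 / (s i + 2 * real N))\<bar>) at_top" .
    thus ?thesis
    proof (rule tendsto_upperbound)
      show "\<forall>\<^sub>F L in at_top. \<bar>Q L\<bar> \<le> C * (pi / 2)"
        using eventually_ge_at_top[of 0]
      proof eventually_elim
        case (elim L)
        from inc[OF elim] show ?case by (simp only: \<open>Q 0 = 0\<close> diff_0_right)
      qed
    qed simp
  qed
  have "(\<lambda>N. \<bar>\<Sum>i\<in>I. c i * (1 / s i - 1 / (s i + 2 * real N))\<bar>) \<longlonglongrightarrow> \<bar>\<Sum>i\<in>I. c i * (1 / s i - 0)\<bar>"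
  proof (intro tendsto_rabs tendsto_sum tendsto_mult tendsto_const tendsto_diff)
    fix i
    have "filterlim (\<lambda>N. s i + 2 * real N) at_top sequentially"
      by (intro filterlim_tendsto_add_at_top[OF tendsto_const]
          filterlim_tendsto_pos_mult_at_top[OF tendsto_const] filterlim_real_sequentially) auto
    from tendsto_inverse_0_at_top[OF this] show "(\<lambda>N. 1 / (s i + 2 * real N)) \<longlonglongrightarrow> 0"
      by (simp add: divide_inverse)
  qed
  hence "\<bar>\<Sum>i\<in>I. c i * (1 / s i - 0)\<bar> \<le> C * (pi / 2)"
    by (rule LIMSEQ_le_const2) (use partial in blast)
  thus ?thesis by simp
qed

text \<open>Complex coefficients, frequencies of either sign and an arbitrary gap reduce to the previous lemma by
  a phase, the oddness of sine and a change of time scale.\<close>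

lemma bohr_favard_sine_sum:
  fixes c :: "'i \<Rightarrow> complex" and s :: "'i \<Rightarrow> real"
  assumes bound: "\<And>t. cmod (\<Sum>i\<in>I. c i * of_real (sin (s i * t))) \<le> C"
    and gap: "\<And>i. i \<in> I \<Longrightarrow> \<bar>s i\<bar> \<ge> \<delta>" and \<delta>: "\<delta> > 0"
  shows "cmod (\<Sum>i\<in>I. c i / of_real (s i)) \<le> pi / (2 * \<delta>) * C"
proof -
  define S where "S = (\<Sum>i\<in>I. c i / of_real (s i))"
  define w where "w = cnj (sgn S)"
  have w: "cmod w \<le> 1" by (simp add: w_def norm_sgn)
  \<comment> \<open>Turning by a phase makes the sum real, and \<open>\<bar>s i\<bar>\<close> may replace \<open>s i\<close> because sine is odd.\<close>
  have Sw: "w * S = of_real (cmod S)"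
  proof (cases "S = 0")
    case False
    have "cnj S * S = of_real (cmod S) * of_real (cmod S)"
      using complex_norm_square[of S] by (simp add: power2_eq_square mult.commute)
    thus ?thesis using False by (simp add: w_def sgn_eq)
  qed simp
  define d where "d i = Re (w * c i) * sgn (s i)" for i
  have bd: "\<bar>\<Sum>i\<in>I. d i * sin (\<bar>s i\<bar> / \<delta> * t)\<bar> \<le> C" for t
  proof -
    have "d i * sin (\<bar>s i\<bar> / \<delta> * t) = Re (w * (c i * of_real (sin (s i * (t / \<delta>)))))" for i
    proof -
      have "sgn (s i) * sin (\<bar>s i\<bar> * (t / \<delta>)) = sin (s i * (t / \<delta>))"
        by (cases "s i" "0::real" rule: linorder_cases) auto
      moreover have "Re (w * (c i * of_real x)) = Re (w * c i) * x" for x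
        by (simp flip: mult.assoc)
      ultimately show ?thesis by (simp add: d_def)
    qed
    hence "(\<Sum>i\<in>I. d i * sin (\<bar>s i\<bar> / \<delta> * t)) = Re (w * (\<Sum>i\<in>I. c i * of_real (sin (s i * (t / \<delta>)))))"
      by (simp only: sum_distrib_left Re_sum)
    also have "\<bar>\<dots>\<bar> \<le> cmod w * cmod (\<Sum>i\<in>I. c i * of_real (sin (s i * (t / \<delta>))))"
      by (metis abs_Re_le_cmod norm_mult)
    also have "\<dots> \<le> 1 * C" by (intro mult_mono w bound) auto
    finally show ?thesis by simp
  qed
  have "\<bar>\<Sum>i\<in>I. d i / (\<bar>s i\<bar> / \<delta>)\<bar> \<le> C * (pi / 2)"
    using gap \<delta> by (intro bohr_favard_sine_sum_unit bd) (auto simp: field_simps)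
  moreover have "(\<Sum>i\<in>I. d i / (\<bar>s i\<bar> / \<delta>)) = \<delta> * Re (w * S)"
  proof -
    have "d i / (\<bar>s i\<bar> / \<delta>) = \<delta> * Re (w * (c i / of_real (s i)))" for i
    proof -
      have "w * (c i / of_real (s i)) = (w * c i) / of_real (s i)" by simp
      hence "Re (w * (c i / of_real (s i))) = Re (w * c i) / s i" by (simp only: Re_divide_of_real)
      thus ?thesis
        by (cases "s i" "0::real" rule: linorder_cases) (simp_all add: d_def del: times_complex.sel)
    qed
    thus ?thesis by (simp only: S_def sum_distrib_left Re_sum)
  qed
  ultimately have "\<delta> * cmod S \<le> C * (pi / 2)" using Sw \<delta> by simp
  thus ?thesis unfolding S_def[symmetric] using \<delta> by (simp add: field_simps)
qed

section \<open>Adjoints, Euclidean norms and spectral norms\<close>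

lemma dim_mat_adjoint [simp]:
  "dim_row (mat_adjoint A) = dim_col A" "dim_col (mat_adjoint A) = dim_row A"
  by (simp_all add: mat_adjoint_def)

lemma mat_adjoint_carrier [simp]: "mat_adjoint A \<in> carrier_mat m n \<longleftrightarrow> A \<in> carrier_mat n m"
  by (auto simp only: carrier_mat_def dim_mat_adjoint)

lemma index_mat_adjoint [simp]:
  "i < dim_col A \<Longrightarrow> j < dim_row A \<Longrightarrow> mat_adjoint A $$ (i, j) = conjugate (A $$ (j, i))"
  by (simp add: mat_adjoint_def mat_of_rows_index)

lemma mat_adjoint_adjoint [simp]: "mat_adjoint (mat_adjoint A) = A"
  by (intro eq_matI) auto

lemma mat_adjoint_mult:
  fixes A B :: "complex mat"
  assumes "A \<in> carrier_mat n k" "B \<in> carrier_mat k m"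
  shows "mat_adjoint (A * B) = mat_adjoint B * mat_adjoint A"
proof (rule eq_matI)
  fix i j assume "i < dim_row (mat_adjoint B * mat_adjoint A)" "j < dim_col (mat_adjoint B * mat_adjoint A)"
  hence ij: "i < m" "j < n" using assms by auto
  have "mat_adjoint (A * B) $$ (i, j) = cnj (\<Sum>l\<in>{0..<k}. A $$ (j, l) * B $$ (l, i))"
    using assms ij by (simp add: scalar_prod_def)
  also have "\<dots> = (\<Sum>l\<in>{0..<k}. cnj (B $$ (l, i)) * cnj (A $$ (j, l)))"
    unfolding cnj_sum complex_cnj_mult by (intro sum.cong refl mult.commute)
  also have "\<dots> = (mat_adjoint B * mat_adjoint A) $$ (i, j)"
    using assms ij by (simp add: scalar_prod_def)
  finally show "mat_adjoint (A * B) $$ (i, j) = (mat_adjoint B * mat_adjoint A) $$ (i, j)" .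
qed (use assms in auto)

lemma mat_adjoint_add:
  assumes "A \<in> carrier_mat n m" "B \<in> carrier_mat n m"
  shows "mat_adjoint (A + B) = mat_adjoint A + mat_adjoint B"
  using assms by (intro eq_matI) (auto simp: conjugate_dist_add)

lemma mat_adjoint_zero [simp]: "mat_adjoint (0\<^sub>m n m) = (0\<^sub>m m n :: complex mat)"
  by (rule eq_matI) simp_all

lemma mat_adjoint_four_block:
  assumes "A \<in> carrier_mat n1 m1" "B \<in> carrier_mat n1 m2" "C \<in> carrier_mat n2 m1" "D \<in> carrier_mat n2 m2"
  shows "mat_adjoint (four_block_mat A B C D) =
    four_block_mat (mat_adjoint A) (mat_adjoint C) (mat_adjoint B) (mat_adjoint D)"
  using assms by (intro eq_matI) auto

lemma cscalar_prod_mult_mat_vec: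
  fixes A :: "complex mat"
  assumes "A \<in> carrier_mat n m" "v \<in> carrier_vec m" "w \<in> carrier_vec n"
  shows "(A *\<^sub>v v) \<bullet>c w = v \<bullet>c (mat_adjoint A *\<^sub>v w)"
proof -
  have "(A *\<^sub>v v) \<bullet>c w = (\<Sum>i\<in>{0..<n}. (\<Sum>j\<in>{0..<m}. A $$ (i, j) * v $ j) * cnj (w $ i))"
    using assms by (simp add: scalar_prod_def)
  also have "\<dots> = (\<Sum>i\<in>{0..<n}. \<Sum>j\<in>{0..<m}. v $ j * (A $$ (i, j) * cnj (w $ i)))"
    unfolding sum_distrib_right by (intro sum.cong refl) (simp only: mult_ac)
  also have "\<dots> = (\<Sum>j\<in>{0..<m}. \<Sum>i\<in>{0..<n}. v $ j * (A $$ (i, j) * cnj (w $ i)))"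
    by (rule sum.swap)
  also have "\<dots> = (\<Sum>j\<in>{0..<m}. v $ j * cnj (\<Sum>i\<in>{0..<n}. cnj (A $$ (i, j)) * w $ i))"
    unfolding sum_distrib_left[symmetric] cnj_sum complex_cnj_mult complex_cnj_cnj ..
  also have "\<dots> = v \<bullet>c (mat_adjoint A *\<^sub>v w)"
    using assms by (simp add: scalar_prod_def)
  finally show ?thesis .
qed

lemma vec_norm2_L2_set: "vec_norm2 v = L2_set (\<lambda>i. cmod (v $ i)) {..<dim_vec v}"
  by (simp add: vec_norm2_def L2_set_def)

lemma vec_norm2_nonneg [simp]: "vec_norm2 v \<ge> 0"
  by (simp add: vec_norm2_L2_set L2_set_nonneg)

lemma vec_norm2_sq: "(vec_norm2 v)\<^sup>2 = (\<Sum>i<dim_vec v. (cmod (v $ i))\<^sup>2)"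
  by (simp add: vec_norm2_def sum_nonneg)

lemma vec_norm2_cscalar: "complex_of_real ((vec_norm2 v)\<^sup>2) = v \<bullet>c v"
  unfolding vec_norm2_sq of_real_sum complex_norm_square
  by (simp add: scalar_prod_def atLeast0LessThan)

lemma vec_norm2_zero [simp]: "vec_norm2 (0\<^sub>v n) = 0"
  by (simp add: vec_norm2_def)

lemma vec_norm2_eq_0: "vec_norm2 v = 0 \<Longrightarrow> v = 0\<^sub>v (dim_vec v)"
  by (intro eq_vecI) (auto simp: vec_norm2_def sum_nonneg sum_nonneg_eq_0_iff)

lemma vec_norm2_pos: "v \<in> carrier_vec n \<Longrightarrow> v \<noteq> 0\<^sub>v n \<Longrightarrow> vec_norm2 v > 0"
  using vec_norm2_eq_0[of v] vec_norm2_nonneg[of v] by (metis carrier_vecD less_eq_real_def)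

lemma vec_norm2_smult [simp]: "vec_norm2 (a \<cdot>\<^sub>v v) = cmod a * vec_norm2 v"
  by (simp add: vec_norm2_def norm_mult power_mult_distrib sum_distrib_left[symmetric] real_sqrt_mult)

lemma vec_norm2_add:
  assumes "v \<in> carrier_vec n" "w \<in> carrier_vec n"
  shows "vec_norm2 (v + w) \<le> vec_norm2 v + vec_norm2 w"
proof -
  have "vec_norm2 (v + w) \<le> L2_set (\<lambda>i. cmod (v $ i) + cmod (w $ i)) {..<n}"
    unfolding vec_norm2_L2_set using assms by (auto intro!: L2_set_mono norm_triangle_ineq)
  also have "\<dots> \<le> vec_norm2 v + vec_norm2 w"
    unfolding vec_norm2_L2_set using assms L2_set_triangle_ineq by auto
  finally show ?thesis .
qed

lemma cauchy_schwarz_cscalar: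
  fixes v w :: "complex vec"
  assumes "v \<in> carrier_vec n" "w \<in> carrier_vec n"
  shows "cmod (v \<bullet>c w) \<le> vec_norm2 v * vec_norm2 w"
proof -
  have "cmod (v \<bullet>c w) \<le> (\<Sum>i<n. \<bar>cmod (v $ i)\<bar> * \<bar>cmod (w $ i)\<bar>)"
    using assms by (auto simp: scalar_prod_def atLeast0LessThan norm_mult intro!: order.trans[OF norm_sum] sum_mono)
  also have "\<dots> \<le> vec_norm2 v * vec_norm2 w"
    unfolding vec_norm2_L2_set
    using assms L2_set_mult_ineq[of "\<lambda>i. cmod (v $ i)" "\<lambda>i. cmod (w $ i)" "{..<n}"] by simp
  finally show ?thesis .
qed

lemma vec_norm2_append:
  "(vec_norm2 (v @\<^sub>v w))\<^sup>2 = (vec_norm2 v)\<^sup>2 + (vec_norm2 w)\<^sup>2"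
proof -
  have "(\<Sum>i<a + b. f i) = (\<Sum>i<a. f i) + (\<Sum>i<b. f (a + i))" for a b and f :: "nat \<Rightarrow> real"
    by (induction b) (simp_all add: add.assoc)
  from this[of "\<lambda>i. (cmod ((v @\<^sub>v w) $ i))\<^sup>2" "dim_vec v" "dim_vec w"] show ?thesis by (simp add: vec_norm2_sq)
qed

lemma cmod_index_le_vec_norm2: "i < dim_vec v \<Longrightarrow> cmod (v $ i) \<le> vec_norm2 v"
  unfolding vec_norm2_L2_set by (rule member_le_L2_set) auto

text \<open>Any constant will do here: it shows that the supremum in the definition of the spectral norm is
  over a bounded set.\<close>

lemma mult_mat_vec_bounded: "\<exists>K. \<forall>v\<in>carrier_vec (dim_col A). vec_norm2 (A *\<^sub>v v) \<le> K * vec_norm2 v"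
proof (intro exI ballI)
  fix v :: "complex vec" assume v: "v \<in> carrier_vec (dim_col A)"
  have "vec_norm2 (A *\<^sub>v v) \<le> (\<Sum>i<dim_row A. cmod ((A *\<^sub>v v) $ i))"
    unfolding vec_norm2_L2_set by (simp add: L2_set_le_sum del: index_mult_mat_vec)
  also have "\<dots> \<le> (\<Sum>i<dim_row A. \<Sum>j<dim_col A. cmod (A $$ (i, j)) * vec_norm2 v)"
  proof (intro sum_mono)
    fix i assume "i \<in> {..<dim_row A}"
    hence "cmod ((A *\<^sub>v v) $ i) \<le> (\<Sum>j<dim_col A. cmod (A $$ (i, j) * v $ j))"
      using v by (auto simp: scalar_prod_def atLeast0LessThan intro!: norm_sum)
    also have "\<dots> \<le> (\<Sum>j<dim_col A. cmod (A $$ (i, j)) * vec_norm2 v)"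
      using v by (auto simp: norm_mult intro!: sum_mono mult_left_mono cmod_index_le_vec_norm2)
    finally show "cmod ((A *\<^sub>v v) $ i) \<le> (\<Sum>j<dim_col A. cmod (A $$ (i, j)) * vec_norm2 v)" .
  qed
  also have "\<dots> = (\<Sum>i<dim_row A. \<Sum>j<dim_col A. cmod (A $$ (i, j))) * vec_norm2 v"
    by (simp add: sum_distrib_right)
  finally show "vec_norm2 (A *\<^sub>v v) \<le> (\<Sum>i<dim_row A. \<Sum>j<dim_col A. cmod (A $$ (i, j))) * vec_norm2 v" .
qed

lemma vec_norm2_mult_mat_vec_le_unit:
  assumes "v \<in> carrier_vec (dim_col A)" "vec_norm2 v \<le> 1"
  shows "vec_norm2 (A *\<^sub>v v) \<le> spectral_norm A"
proof -
  obtain K where K: "\<And>v. v \<in> carrier_vec (dim_col A) \<Longrightarrow> vec_norm2 (A *\<^sub>v v) \<le> K * vec_norm2 v"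
    using mult_mat_vec_bounded by blast
  have "vec_norm2 (A *\<^sub>v v) \<le> \<bar>K\<bar>" if "v \<in> carrier_vec (dim_col A)" "vec_norm2 v \<le> 1" for v
  proof -
    have "K * vec_norm2 v \<le> \<bar>K\<bar> * 1" using that(2) by (intro mult_mono) auto
    thus ?thesis using K[OF that(1)] by linarith
  qed
  hence "bdd_above ((\<lambda>v. vec_norm2 (A *\<^sub>v v)) ` {v \<in> carrier_vec (dim_col A). vec_norm2 v \<le> 1})"
    by (intro bdd_aboveI[of _ "\<bar>K\<bar>"]) auto
  thus ?thesis unfolding spectral_norm_def using assms by (intro cSUP_upper) auto
qed

lemma spectral_norm_nonneg [simp]: "spectral_norm A \<ge> 0"
  by (rule order.trans[OF vec_norm2_nonneg vec_norm2_mult_mat_vec_le_unit[of "0\<^sub>v (dim_col A)" A]]) auto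

lemma vec_norm2_mult_mat_vec_le:
  assumes "A \<in> carrier_mat n m" "v \<in> carrier_vec m"
  shows "vec_norm2 (A *\<^sub>v v) \<le> spectral_norm A * vec_norm2 v"
proof (cases "vec_norm2 v = 0")
  case True
  obtain K where "\<And>v. v \<in> carrier_vec (dim_col A) \<Longrightarrow> vec_norm2 (A *\<^sub>v v) \<le> K * vec_norm2 v"
    using mult_mat_vec_bounded by blast
  from this[of v] show ?thesis using assms True by simp
next
  case False
  let ?a = "complex_of_real (inverse (vec_norm2 v))"
  have norm_a: "cmod ?a = inverse (vec_norm2 v)" by (simp add: norm_inverse del: of_real_inverse)
  hence "vec_norm2 (?a \<cdot>\<^sub>v v) = 1" using False by simp
  hence "vec_norm2 (A *\<^sub>v (?a \<cdot>\<^sub>v v)) \<le> spectral_norm A"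
    using assms by (intro vec_norm2_mult_mat_vec_le_unit) auto
  also have "A *\<^sub>v (?a \<cdot>\<^sub>v v) = ?a \<cdot>\<^sub>v (A *\<^sub>v v)" using assms by (simp add: mult_mat_vec)
  finally have "inverse (vec_norm2 v) * vec_norm2 (A *\<^sub>v v) \<le> spectral_norm A"
    unfolding vec_norm2_smult norm_a .
  moreover have "vec_norm2 v > 0" using False vec_norm2_nonneg[of v] by linarith
  ultimately show ?thesis by (simp add: field_simps)
qed

lemma spectral_norm_leI:
  assumes "A \<in> carrier_mat n m" "c \<ge> 0"
    and "\<And>v. v \<in> carrier_vec m \<Longrightarrow> vec_norm2 (A *\<^sub>v v) \<le> c * vec_norm2 v"
  shows "spectral_norm A \<le> c"
  unfolding spectral_norm_def
proof (rule cSUP_least)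
  have "0\<^sub>v (dim_col A) \<in> {v \<in> carrier_vec (dim_col A). vec_norm2 v \<le> 1}" by simp
  thus "{v \<in> carrier_vec (dim_col A). vec_norm2 v \<le> 1} \<noteq> {}" by blast
next
  fix v assume "v \<in> {v \<in> carrier_vec (dim_col A). vec_norm2 v \<le> 1}"
  hence v: "v \<in> carrier_vec m" "vec_norm2 v \<le> 1" using assms by auto
  have "c * vec_norm2 v \<le> c * 1" using assms v by (intro mult_left_mono) auto
  thus "vec_norm2 (A *\<^sub>v v) \<le> c" using assms(3)[OF v(1)] by simp
qed

lemma spectral_norm_mult:
  assumes "A \<in> carrier_mat n k" "B \<in> carrier_mat k m"
  shows "spectral_norm (A * B) \<le> spectral_norm A * spectral_norm B"
proof (rule spectral_norm_leI)
  show "A * B \<in> carrier_mat n m" using assms by simp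
  fix v :: "complex vec" assume v: "v \<in> carrier_vec m"
  have "vec_norm2 ((A * B) *\<^sub>v v) = vec_norm2 (A *\<^sub>v (B *\<^sub>v v))"
    using assms v by (simp add: assoc_mult_mat_vec)
  also have "\<dots> \<le> spectral_norm A * vec_norm2 (B *\<^sub>v v)"
    using assms v by (intro vec_norm2_mult_mat_vec_le) auto
  also have "\<dots> \<le> spectral_norm A * (spectral_norm B * vec_norm2 v)"
    using assms v by (intro mult_left_mono vec_norm2_mult_mat_vec_le) auto
  finally show "vec_norm2 ((A * B) *\<^sub>v v) \<le> spectral_norm A * spectral_norm B * vec_norm2 v" by simp
qed simp

lemma spectral_norm_add:
  assumes "A \<in> carrier_mat n m" "B \<in> carrier_mat n m"
  shows "spectral_norm (A + B) \<le> spectral_norm A + spectral_norm B"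
proof (rule spectral_norm_leI)
  show "A + B \<in> carrier_mat n m" using assms by simp
  fix v :: "complex vec" assume v: "v \<in> carrier_vec m"
  have "vec_norm2 ((A + B) *\<^sub>v v) = vec_norm2 (A *\<^sub>v v + B *\<^sub>v v)"
    using assms v by (simp add: add_mult_distrib_mat_vec)
  also have "\<dots> \<le> vec_norm2 (A *\<^sub>v v) + vec_norm2 (B *\<^sub>v v)"
    using assms v by (intro vec_norm2_add[of _ n]) auto
  also have "\<dots> \<le> (spectral_norm A + spectral_norm B) * vec_norm2 v"
    using vec_norm2_mult_mat_vec_le[OF assms(1) v] vec_norm2_mult_mat_vec_le[OF assms(2) v]
    by (simp add: algebra_simps)
  finally show "vec_norm2 ((A + B) *\<^sub>v v) \<le> (spectral_norm A + spectral_norm B) * vec_norm2 v" .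
qed simp

lemma spectral_norm_uminus [simp]: "spectral_norm (- A) = spectral_norm A"
proof -
  have "vec_norm2 (- A *\<^sub>v v) = vec_norm2 (A *\<^sub>v v)" if "v \<in> carrier_vec (dim_col A)" for v
  proof -
    have "- A *\<^sub>v v = (-1) \<cdot>\<^sub>v (A *\<^sub>v v)"
      using that by (intro eq_vecI) (auto simp: scalar_prod_def sum_negf)
    thus ?thesis by simp
  qed
  thus ?thesis unfolding spectral_norm_def by (intro SUP_cong) auto
qed

lemma spectral_norm_minus:
  assumes "A \<in> carrier_mat n m" "B \<in> carrier_mat n m"
  shows "spectral_norm (A - B) \<le> spectral_norm A + spectral_norm B"
  using spectral_norm_add[of A n m "- B"] assms by (simp add: minus_add_uminus_mat)

lemma spectral_norm_zero [simp]: "spectral_norm (0\<^sub>m n m) = 0"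
proof -
  have "0\<^sub>m n m *\<^sub>v v = 0\<^sub>v n" if "v \<in> carrier_vec m" for v :: "complex vec"
    using that by (intro eq_vecI) auto
  thus ?thesis by (intro antisym spectral_norm_leI[of _ n m]) auto
qed

text \<open>A bound on the sesquilinear form bounds the norm: take \<open>w = A v\<close>.\<close>

lemma spectral_norm_leI_cscalar:
  assumes "A \<in> carrier_mat n m" "c \<ge> 0"
    and "\<And>v w. v \<in> carrier_vec m \<Longrightarrow> w \<in> carrier_vec n \<Longrightarrow>
      cmod ((A *\<^sub>v v) \<bullet>c w) \<le> c * vec_norm2 v * vec_norm2 w"
  shows "spectral_norm A \<le> c"
proof (rule spectral_norm_leI[OF assms(1,2)])
  fix v :: "complex vec" assume v: "v \<in> carrier_vec m"
  let ?w = "A *\<^sub>v v"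
  have "cmod (?w \<bullet>c ?w) \<le> c * vec_norm2 v * vec_norm2 ?w"
    using assms(1) v by (intro assms(3)) auto
  hence "vec_norm2 ?w * vec_norm2 ?w \<le> c * vec_norm2 v * vec_norm2 ?w"
    unfolding vec_norm2_cscalar[symmetric] norm_of_real by (simp add: power2_eq_square)
  moreover have "c * vec_norm2 v \<ge> 0" using assms(2) by simp
  ultimately show "vec_norm2 ?w \<le> c * vec_norm2 v"
    using vec_norm2_nonneg[of ?w] by (metis less_eq_real_def mult_le_cancel_right not_le)
qed

lemma spectral_norm_adjoint [simp]: "spectral_norm (mat_adjoint A) = spectral_norm A"
proof -
  have le: "spectral_norm (mat_adjoint A) \<le> spectral_norm A" for A
  proof (rule spectral_norm_leI_cscalar)
    show "mat_adjoint A \<in> carrier_mat (dim_col A) (dim_row A)" by simp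
    fix v w :: "complex vec"
    assume v: "v \<in> carrier_vec (dim_row A)" and w: "w \<in> carrier_vec (dim_col A)"
    have "(mat_adjoint A *\<^sub>v v) \<bullet>c w = v \<bullet>c (A *\<^sub>v w)"
      using cscalar_prod_mult_mat_vec[of "mat_adjoint A" "dim_col A" "dim_row A" v w] v w by simp
    also have "cmod \<dots> \<le> vec_norm2 v * vec_norm2 (A *\<^sub>v w)"
      using v w by (intro cauchy_schwarz_cscalar[of _ "dim_row A"] mult_mat_vec_carrier[OF carrier_matI]) auto
    also have "\<dots> \<le> vec_norm2 v * (spectral_norm A * vec_norm2 w)"
      using w by (intro mult_left_mono vec_norm2_mult_mat_vec_le) auto
    finally show "cmod ((mat_adjoint A *\<^sub>v v) \<bullet>c w) \<le> spectral_norm A * vec_norm2 v * vec_norm2 w"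
      by (simp add: mult_ac)
  qed simp
  from le[of A] le[of "mat_adjoint A"] show ?thesis by simp
qed

lemma cmod_index_le_spectral_norm:
  assumes "i < dim_row A" "j < dim_col A"
  shows "cmod (A $$ (i, j)) \<le> spectral_norm A"
proof -
  have u: "vec_norm2 (unit_vec (dim_col A) j) \<le> 1"
  proof -
    have "(\<Sum>i<dim_col A. (cmod (unit_vec (dim_col A) j $ i))\<^sup>2) = (\<Sum>i<dim_col A. if i = j then 1 else 0)"
      using assms by (intro sum.cong) auto
    thus ?thesis by (simp add: vec_norm2_def)
  qed
  have "A *\<^sub>v unit_vec (dim_col A) j = col A j"
    using assms by (intro eq_vecI) auto
  hence "cmod (A $$ (i, j)) = cmod ((A *\<^sub>v unit_vec (dim_col A) j) $ i)" using assms by simp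
  also have "\<dots> \<le> vec_norm2 (A *\<^sub>v unit_vec (dim_col A) j)"
    using assms by (intro cmod_index_le_vec_norm2) auto
  also have "\<dots> \<le> spectral_norm A" using u by (intro vec_norm2_mult_mat_vec_le_unit) auto
  finally show ?thesis .
qed

lemma vec_norm2_unitary:
  assumes "P \<in> carrier_mat n n" "unitary_mat P" "v \<in> carrier_vec n"
  shows "vec_norm2 (P *\<^sub>v v) = vec_norm2 v"
proof -
  have "mat_adjoint P *\<^sub>v (P *\<^sub>v v) = v"
    using assms assoc_mult_mat_vec[of "mat_adjoint P" n n P n v] by (simp add: unitary_mat_def)
  hence "(P *\<^sub>v v) \<bullet>c (P *\<^sub>v v) = v \<bullet>c v"
    using cscalar_prod_mult_mat_vec[of P n n v "P *\<^sub>v v"] assms by simp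
  hence "(vec_norm2 (P *\<^sub>v v))\<^sup>2 = (vec_norm2 v)\<^sup>2"
    unfolding vec_norm2_cscalar[symmetric] of_real_eq_iff .
  thus ?thesis by (simp add: power2_eq_iff_nonneg)
qed

lemma unitary_mat_adjoint: "unitary_mat P \<Longrightarrow> unitary_mat (mat_adjoint P)"
proof -
  assume P: "unitary_mat P"
  hence "dim_col P = dim_row P" by (simp only: unitary_mat_def square_mat.simps)
  thus ?thesis using P by (simp only: unitary_mat_def mat_adjoint_adjoint dim_mat_adjoint square_mat.simps simp_thms)
qed

section \<open>Unitary diagonalization of Hermitian matrices\<close>

lemma index_mult_adjoint_cscalar:
  fixes A B :: "complex mat"
  assumes "A \<in> carrier_mat k n" "B \<in> carrier_mat k m" "i < n" "j < m"
  shows "(mat_adjoint A * B) $$ (i, j) = col B j \<bullet>c col A i"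
  using assms by (auto simp: scalar_prod_def mult.commute intro!: sum.cong)

lemma unitary_matI:
  assumes "P \<in> carrier_mat n n" "mat_adjoint P * P = 1\<^sub>m n"
  shows "unitary_mat P"
  using assms mat_mult_left_right_inverse[OF mat_adjoint_carrier[THEN iffD2, OF assms(1)] assms(1) assms(2)]
  by (simp add: unitary_mat_def)

lemma unitary_matD:
  assumes "P \<in> carrier_mat n n" "unitary_mat P"
  shows "mat_adjoint P * P = 1\<^sub>m n" "P * mat_adjoint P = 1\<^sub>m n"
  using assms by (auto simp: unitary_mat_def)

lemma unitary_mat_mult:
  assumes P: "P \<in> carrier_mat n n" "unitary_mat P" and Q: "Q \<in> carrier_mat n n" "unitary_mat Q"
  shows "unitary_mat (P * Q)"
proof (rule unitary_matI)
  show "P * Q \<in> carrier_mat n n" using P Q by simp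
  have "mat_adjoint (P * Q) * (P * Q) = mat_adjoint Q * (mat_adjoint P * P) * Q"
    using P(1) Q(1) by (simp add: mat_adjoint_mult[of _ n n _ n] assoc_mult_mat[of _ n n _ n _ n])
  also have "\<dots> = 1\<^sub>m n"
    using unitary_matD[OF P] unitary_matD[OF Q] Q(1) by (simp add: right_mult_one_mat[of _ n n])
  finally show "mat_adjoint (P * Q) * (P * Q) = 1\<^sub>m n" .
qed

text \<open>Complete \<open>v\<close> to a basis, orthogonalize by the Gram-Schmidt process, which keeps the first vector, and
  normalize.\<close>

lemma unitary_completion:
  assumes v: "v \<in> carrier_vec n" "v \<noteq> 0\<^sub>v n"
  obtains W a where "W \<in> carrier_mat n n" "unitary_mat W" "col W 0 = a \<cdot>\<^sub>v v"
proof -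
  interpret cof_vec_space n "TYPE(complex)" .
  define b where "b = basis_completion v"
  define ws where "ws = gram_schmidt n b"
  from basis_completion[OF v, folded b_def]
  have dist_b: "distinct b" and indep: "\<not> lin_dep (set b)" and b: "set b \<subseteq> carrier_vec n"
    and hdb: "hd b = v" and len_b: "length b = n" by auto
  from gram_schmidt_result[OF b dist_b indep refl, folded ws_def]
  have ws: "set ws \<subseteq> carrier_vec n" "corthogonal ws" "length ws = n" by (auto simp: len_b)
  have n: "n > 0" using v by (cases n) auto
  with hdb len_b obtain vs where bv: "b = v # vs" by (cases b) auto
  have hdws: "hd ws = v" using gram_schmidt_hd[OF v(1), of vs, folded bv] by (simp add: ws_def)
  define us where "us = map (\<lambda>w. complex_of_real (inverse (vec_norm2 w)) \<cdot>\<^sub>v w) ws"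
  define W where "W = mat_of_cols n us"
  have W: "W \<in> carrier_mat n n" using ws(3) mat_of_cols_carrier(1)[of n us] by (simp add: W_def us_def)
  have wsi: "ws ! i \<in> carrier_vec n" if "i < n" for i using ws that by auto
  have col: "col W i = complex_of_real (inverse (vec_norm2 (ws ! i))) \<cdot>\<^sub>v (ws ! i)" if "i < n" for i
    using that ws wsi[OF that] unfolding W_def us_def by (subst col_mat_of_cols) auto
  have "mat_adjoint W * W = 1\<^sub>m n"
  proof (rule eq_matI)
    fix i j assume "i < dim_row (1\<^sub>m n)" "j < dim_col (1\<^sub>m n)"
    hence i: "i < n" and j: "j < n" by auto
    have "(mat_adjoint W * W) $$ (i, j) = col W j \<bullet>c col W i"
      by (rule index_mult_adjoint_cscalar[OF W W i j])
    also have "\<dots> = complex_of_real (inverse (vec_norm2 (ws ! j))) * complex_of_real (inverse (vec_norm2 (ws ! i)))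
        * (ws ! j \<bullet>c ws ! i)"
      using wsi[OF i] wsi[OF j] unfolding col[OF i] col[OF j]
      by (simp add: conjugate_smult_vec)
    also have "\<dots> = (if i = j then 1 else 0)"
    proof (cases "i = j")
      case True
      have "ws ! i \<bullet>c ws ! i \<noteq> 0" using corthogonalD[OF ws(2), of i i] i ws(3) by auto
      hence "vec_norm2 (ws ! i) \<noteq> 0" unfolding vec_norm2_cscalar[symmetric] by auto
      thus ?thesis unfolding True vec_norm2_cscalar[symmetric]
        by (simp add: power2_eq_square field_simps)
    next
      case False
      thus ?thesis using corthogonalD[OF ws(2), of j i] i j ws(3) by auto
    qed
    finally show "(mat_adjoint W * W) $$ (i, j) = 1\<^sub>m n $$ (i, j)" using i j by simp
  qed (use W in auto)
  hence "unitary_mat W" by (rule unitary_matI[OF W])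
  moreover have "ws ! 0 = v" using hdws ws(3) n by (metis hd_conv_nth length_greater_0_conv)
  ultimately show ?thesis using that[OF W] col[OF n] by metis
qed

lemma ex_eigenvector:
  fixes A :: "complex mat"
  assumes A: "A \<in> carrier_mat n n" and n: "n > 0"
  obtains v e where "v \<in> carrier_vec n" "v \<noteq> 0\<^sub>v n" "A *\<^sub>v v = e \<cdot>\<^sub>v v"
proof -
  obtain es where es: "char_poly A = (\<Prod>a\<leftarrow>es. [:- a, 1:])" "length es = n"
    using char_poly_factorized[OF A] by blast
  then obtain e es' where "es = e # es'" using n by (cases es) auto
  hence "eigenvalue A e" unfolding eigenvalue_root_char_poly[OF A] es(1) by simp
  thus ?thesis using that A unfolding eigenvalue_def eigenvector_def by auto
qed

text \<open>Rotate an eigenvector to the first coordinate axis. The first column of the rotated matrix is then a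
  multiple of the first unit vector, by symmetry so is the first row, and the induction hypothesis
  applies to the remaining block.\<close>

lemma hermitian_unitary_diagonalization:
  fixes A :: "complex mat"
  assumes "A \<in> carrier_mat n n" "mat_adjoint A = A"
  shows "\<exists>P d. P \<in> carrier_mat n n \<and> unitary_mat P \<and> A * P = P * mat_diag n (\<lambda>i. complex_of_real (d i))"
  using assms
proof (induction n arbitrary: A)
  case 0
  thus ?case by (intro exI[of _ "1\<^sub>m 0"] exI[of _ "\<lambda>_. 0"] conjI unitary_matI[of _ 0] eq_matI) (simp_all add: mat_diag_def)
next
  case (Suc n)
  note A = Suc.prems(1) and herm = Suc.prems(2)
  obtain v e where v: "v \<in> carrier_vec (Suc n)" "v \<noteq> 0\<^sub>v (Suc n)" "A *\<^sub>v v = e \<cdot>\<^sub>v v"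
    using ex_eigenvector[OF A] by auto
  obtain W a where W: "W \<in> carrier_mat (Suc n) (Suc n)" "unitary_mat W" "col W 0 = a \<cdot>\<^sub>v v"
    using unitary_completion[OF v(1,2)] by blast
  note WW = unitary_matD[OF W(1,2)]
  define A' where "A' = mat_adjoint W * A * W"
  have A': "A' \<in> carrier_mat (Suc n) (Suc n)" using W A by (simp add: A'_def)
  note assoc = assoc_mult_mat[of _ "Suc n" "Suc n" _ "Suc n" _ "Suc n"]
  have herm': "mat_adjoint A' = A'"
    using W A herm by (simp add: A'_def mat_adjoint_mult[of _ "Suc n" "Suc n" _ "Suc n"] assoc)
  have col0: "A' $$ (i, 0) = (if i = 0 then e else 0)" if i: "i < Suc n" for i
  proof -
    have "A' $$ (i, 0) = (mat_adjoint W * (A * W)) $$ (i, 0)"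
      using W A by (simp add: A'_def assoc)
    also have "\<dots> = col (A * W) 0 \<bullet>c col W i"
      by (rule index_mult_adjoint_cscalar) (use W A i in auto)
    also have "col (A * W) 0 = e \<cdot>\<^sub>v col W 0"
      unfolding col_mult2[OF A W(1) zero_less_Suc] W(3) mult_mat_vec[OF A v(1)] v(3) smult_smult_assoc
      by (simp only: mult.commute)
    also have "(e \<cdot>\<^sub>v col W 0) \<bullet>c col W i = e * (mat_adjoint W * W) $$ (i, 0)"
    proof -
      have "(mat_adjoint W * W) $$ (i, 0) = col W 0 \<bullet>c col W i"
        by (rule index_mult_adjoint_cscalar[OF W(1) W(1) i]) simp
      moreover have "col W k \<in> carrier_vec (Suc n)" for k using W(1) by (intro carrier_vecI) simp
      ultimately show ?thesis by (simp add: smult_scalar_prod_distrib[of _ "Suc n"] del: W(3))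
    qed
    finally show ?thesis using i by (simp add: WW)
  qed
  have row0: "A' $$ (0, j) = (if j = 0 then e else 0)" if "j < Suc n" for j
  proof -
    have "A' $$ (0, j) = mat_adjoint A' $$ (0, j)" by (simp only: herm')
    also have "\<dots> = conjugate (A' $$ (j, 0))" using that A' by simp
    finally have *: "A' $$ (0, j) = conjugate (A' $$ (j, 0))" .
    thus ?thesis using col0[OF that] col0[of 0] by (cases "j = 0") auto
  qed
  have e: "e = complex_of_real (Re e)"
  proof -
    have "A' $$ (0, 0) = mat_adjoint A' $$ (0, 0)" by (simp only: herm')
    hence "e = cnj e" using col0[of 0] A' by simp
    thus ?thesis by (metis complex_cnj_cancel_iff complex_is_Real_iff Reals_cnj_iff of_real_Re)
  qed
  define A3 where "A3 = mat n n (\<lambda>(i, j). A' $$ (Suc i, Suc j))"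
  have A3: "A3 \<in> carrier_mat n n" by (simp add: A3_def)
  have block: "A' = four_block_mat (mat 1 1 (\<lambda>_. e)) (0\<^sub>m 1 n) (0\<^sub>m n 1) A3"
    using A' col0 row0 by (intro eq_matI) (auto simp: A3_def)
  have "mat_adjoint A3 = A3"
  proof (rule eq_matI)
    fix i j assume "i < dim_row A3" "j < dim_col A3"
    hence ij: "i < n" "j < n" by (auto simp: A3_def)
    have "A' $$ (Suc i, Suc j) = mat_adjoint A' $$ (Suc i, Suc j)" by (simp only: herm')
    also have "\<dots> = conjugate (A' $$ (Suc j, Suc i))" using A' ij by simp
    finally show "mat_adjoint A3 $$ (i, j) = A3 $$ (i, j)" using ij by (simp add: A3_def)
  qed (simp_all add: A3_def)
  from Suc.IH[OF A3 this] obtain P d where P: "P \<in> carrier_mat n n" "unitary_mat P"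
    and AP: "A3 * P = P * mat_diag n (\<lambda>i. complex_of_real (d i))" by blast
  let ?Z = "four_block_mat (1\<^sub>m 1) (0\<^sub>m 1 n) (0\<^sub>m n 1) P"
  have Z: "?Z \<in> carrier_mat (Suc n) (Suc n)" using P four_block_carrier_mat[of "1\<^sub>m 1" 1 1 P n n] by simp
  have "unitary_mat ?Z"
  proof (rule unitary_matI[OF Z])
    have "mat_adjoint ?Z = four_block_mat (mat_adjoint (1\<^sub>m 1)) (mat_adjoint (0\<^sub>m n 1)) (mat_adjoint (0\<^sub>m 1 n)) (mat_adjoint P)"
      using P by (intro mat_adjoint_four_block) auto
    also have "mat_adjoint (1\<^sub>m 1) = (1\<^sub>m 1 :: complex mat)" by (intro eq_matI) auto
    finally have "mat_adjoint ?Z * ?Z = four_block_mat (1\<^sub>m 1) (0\<^sub>m 1 n) (0\<^sub>m n 1) (mat_adjoint P * P)"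
      using P by (simp add: mult_four_block_mat[of _ 1 1 _ n _ n _ _ 1 _ n])
    thus "mat_adjoint ?Z * ?Z = 1\<^sub>m (Suc n)" using unitary_matD[OF P] by (simp add: four_block_one_mat[of 1 n, simplified])
  qed
  hence "unitary_mat (W * ?Z)" using W Z by (intro unitary_mat_mult) auto
  moreover have "A * (W * ?Z) = (W * ?Z) * mat_diag (Suc n) (\<lambda>i. complex_of_real (case_nat (Re e) d i))"
  proof -
    let ?D = "mat_diag n (\<lambda>i. complex_of_real (d i))"
    have D: "mat_diag (Suc n) (\<lambda>i. complex_of_real (case_nat (Re e) d i)) =
        four_block_mat (mat 1 1 (\<lambda>_. e)) (0\<^sub>m 1 n) (0\<^sub>m n 1) ?D"
      using e by (intro eq_matI) (auto simp: mat_diag_def split: nat.splits)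
    have "A' * ?Z = four_block_mat (mat 1 1 (\<lambda>_. e)) (0\<^sub>m 1 n) (0\<^sub>m n 1) (A3 * P)"
      unfolding block using P A3 by (simp add: mult_four_block_mat[of _ 1 1 _ n _ n _ _ 1 _ n])
    also have "\<dots> = ?Z * mat_diag (Suc n) (\<lambda>i. complex_of_real (case_nat (Re e) d i))"
      unfolding D AP using P left_mult_zero_mat[of ?D n n 1]
      by (simp add: mult_four_block_mat[of _ 1 1 _ n _ n _ _ 1 _ n])
    finally have AZ: "A' * ?Z = ?Z * mat_diag (Suc n) (\<lambda>i. complex_of_real (case_nat (Re e) d i))" .
    have "A * (W * ?Z) = (W * mat_adjoint W) * (A * (W * ?Z))"
      using W A Z by (simp add: WW)
    also have "\<dots> = W * (A' * ?Z)" using W A Z by (simp add: A'_def assoc)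
    finally show ?thesis unfolding AZ using W Z by (simp add: assoc)
  qed
  ultimately show ?case using W Z by (intro exI[of _ "W * ?Z"] exI[of _ "case_nat (Re e) d"]) auto
qed

section \<open>The Sylvester equation with Hermitian coefficients\<close>

lemma cscalar_prod_mult_mat_vec_double_sum:
  fixes Y :: "complex mat"
  assumes "Y \<in> carrier_mat M N" "v \<in> carrier_vec N" "w \<in> carrier_vec M"
  shows "(Y *\<^sub>v v) \<bullet>c w = (\<Sum>(i, j)\<in>{..<M} \<times> {..<N}. Y $$ (i, j) * v $ j * cnj (w $ i))"
proof -
  have "(Y *\<^sub>v v) \<bullet>c w = (\<Sum>i<M. (\<Sum>j<N. Y $$ (i, j) * v $ j) * cnj (w $ i))"
    using assms by (simp add: scalar_prod_def atLeast0LessThan)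
  thus ?thesis by (simp add: sum_distrib_right sum.cartesian_product)
qed

text \<open>For fixed \<open>v\<close> and \<open>w\<close> the form \<open>\<langle>X v, w\<rangle>\<close> is the sum of \<open>c p / s p\<close> over the index pairs \<open>p = (i, j)\<close>,
  where \<open>s p = d j - e i\<close> and \<open>c p\<close> is a term of \<open>\<langle>Y v, w\<rangle>\<close>. The Bohr-Favard inequality asks for a bound on the
  sum of \<open>c p * sin (s p * t)\<close>. Because \<open>s p\<close> is a difference, \<open>cis (s p * t)\<close> splits into a phase for \<open>j\<close> and a
  phase for \<open>i\<close>, which the vectors absorb without changing their norms.\<close>

lemma difference_quotient_multiplier_norm:
  fixes X Y :: "complex mat" and d e :: "nat \<Rightarrow> real"
  assumes X: "X \<in> carrier_mat M N" and Y: "Y \<in> carrier_mat M N"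
    and XY: "\<And>i j. i < M \<Longrightarrow> j < N \<Longrightarrow> X $$ (i, j) * of_real (d j - e i) = Y $$ (i, j)"
    and gap: "\<And>i j. i < M \<Longrightarrow> j < N \<Longrightarrow> \<bar>d j - e i\<bar> \<ge> \<delta>" and \<delta>: "\<delta> > 0"
  shows "spectral_norm X \<le> pi / (2 * \<delta>) * spectral_norm Y"
proof (rule spectral_norm_leI_cscalar[OF X])
  show "pi / (2 * \<delta>) * spectral_norm Y \<ge> 0" using \<delta> by simp
  fix v w :: "complex vec" assume v: "v \<in> carrier_vec N" and w: "w \<in> carrier_vec M"
  define c where "c = (\<lambda>(i, j). Y $$ (i, j) * v $ j * cnj (w $ i))"
  define s where "s = (\<lambda>(i, j). d j - e i)"
  let ?I = "{..<M} \<times> {..<N}"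
  have "(X *\<^sub>v v) \<bullet>c w = (\<Sum>p\<in>?I. c p / of_real (s p))"
    unfolding cscalar_prod_mult_mat_vec_double_sum[OF X v w]
  proof (intro sum.cong refl)
    fix p assume "p \<in> ?I"
    then obtain i j where p: "p = (i, j)" "i < M" "j < N" by auto
    have "X $$ (i, j) = Y $$ (i, j) / of_real (d j - e i)"
      using XY[OF p(2,3)] gap[OF p(2,3)] \<delta> by (auto simp: field_simps simp del: of_real_diff)
    thus "(case p of (i, j) \<Rightarrow> X $$ (i, j) * v $ j * cnj (w $ i)) = c p / of_real (s p)"
      by (simp add: p c_def s_def)
  qed
  also have "cmod \<dots> \<le> pi / (2 * \<delta>) * (spectral_norm Y * vec_norm2 v * vec_norm2 w)"
  proof (rule bohr_favard_sine_sum[OF _ _ \<delta>])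
    show "\<And>p. p \<in> ?I \<Longrightarrow> \<delta> \<le> \<bar>s p\<bar>" using gap by (auto simp: s_def)
    fix t
    define vt where "vt \<sigma> = vec N (\<lambda>j. cis (\<sigma> * d j * t) * v $ j)" for \<sigma> :: real
    define wt where "wt \<sigma> = vec M (\<lambda>i. cis (\<sigma> * e i * t) * w $ i)" for \<sigma> :: real
    have vt: "vt \<sigma> \<in> carrier_vec N" "vec_norm2 (vt \<sigma>) = vec_norm2 v" for \<sigma>
      using v by (auto simp: vt_def vec_norm2_def norm_mult)
    have wt: "wt \<sigma> \<in> carrier_vec M" "vec_norm2 (wt \<sigma>) = vec_norm2 w" for \<sigma>
      using w by (auto simp: wt_def vec_norm2_def norm_mult)
    have le: "cmod ((Y *\<^sub>v vt \<sigma>) \<bullet>c wt \<sigma>) \<le> spectral_norm Y * vec_norm2 v * vec_norm2 w" for \<sigma>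
    proof -
      have "cmod ((Y *\<^sub>v vt \<sigma>) \<bullet>c wt \<sigma>) \<le> vec_norm2 (Y *\<^sub>v vt \<sigma>) * vec_norm2 (wt \<sigma>)"
        using Y vt wt by (intro cauchy_schwarz_cscalar[of _ M] mult_mat_vec_carrier) auto
      also have "\<dots> \<le> spectral_norm Y * vec_norm2 (vt \<sigma>) * vec_norm2 (wt \<sigma>)"
        by (intro mult_right_mono vec_norm2_mult_mat_vec_le[OF Y vt(1)]) simp
      finally show ?thesis by (simp only: vt wt)
    qed
    have expand: "(Y *\<^sub>v vt \<sigma>) \<bullet>c wt \<sigma> = (\<Sum>p\<in>?I. c p * cis (\<sigma> * (s p * t)))" for \<sigma>
      unfolding cscalar_prod_mult_mat_vec_double_sum[OF Y vt(1) wt(1)]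
    proof (intro sum.cong refl)
      fix p assume "p \<in> ?I"
      then obtain i j where p: "p = (i, j)" "i < M" "j < N" by auto
      have "cis (\<sigma> * (s p * t)) = cis (\<sigma> * d j * t) * cnj (cis (\<sigma> * e i * t))"
        by (simp add: p s_def cis_cnj cis_mult algebra_simps)
      thus "(case p of (i, j) \<Rightarrow> Y $$ (i, j) * vt \<sigma> $ j * cnj (wt \<sigma> $ i)) = c p * cis (\<sigma> * (s p * t))"
        using p by (simp add: c_def vt_def wt_def)
    qed
    have "c p * of_real (sin (s p * t)) = (c p * cis (1 * (s p * t)) - c p * cis (-1 * (s p * t))) / (2 * \<i>)" for p
      by (simp add: complex_eq_iff)
    hence "(\<Sum>p\<in>?I. c p * of_real (sin (s p * t))) =
        ((Y *\<^sub>v vt 1) \<bullet>c wt 1 - (Y *\<^sub>v vt (-1)) \<bullet>c wt (-1)) / (2 * \<i>)"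
      unfolding expand by (simp only: sum_subtractf sum_divide_distrib[symmetric])
    also have "cmod \<dots> \<le> (spectral_norm Y * vec_norm2 v * vec_norm2 w + spectral_norm Y * vec_norm2 v * vec_norm2 w) / 2"
      unfolding norm_divide using norm_triangle_le_diff[OF add_mono[OF le[of 1] le[of "-1"]]]
      by (simp add: norm_mult)
    finally show "cmod (\<Sum>p\<in>?I. c p * of_real (sin (s p * t))) \<le> spectral_norm Y * vec_norm2 v * vec_norm2 w"
      by simp
  qed
  finally show "cmod ((X *\<^sub>v v) \<bullet>c w) \<le> pi / (2 * \<delta>) * spectral_norm Y * vec_norm2 v * vec_norm2 w"
    by (simp add: mult_ac)
qed

lemma spectral_norm_unitary_le:
  assumes P: "P \<in> carrier_mat n n" "unitary_mat P"
  shows "spectral_norm P \<le> 1"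
  using vec_norm2_unitary[OF P] by (intro spectral_norm_leI[OF P(1)]) auto

lemma spectral_norm_unitary_sandwich_le:
  assumes P: "P \<in> carrier_mat m m" "unitary_mat P" and Q: "Q \<in> carrier_mat n n" "unitary_mat Q"
    and X: "X \<in> carrier_mat m n"
  shows "spectral_norm (P * X * Q) \<le> spectral_norm X"
proof -
  have "spectral_norm (P * X * Q) \<le> spectral_norm (P * X) * spectral_norm Q"
    using P Q X by (intro spectral_norm_mult) auto
  also have "\<dots> \<le> (spectral_norm P * spectral_norm X) * spectral_norm Q"
    using P X by (intro mult_right_mono spectral_norm_mult) auto
  also have "\<dots> \<le> (1 * spectral_norm X) * 1"
    by (intro mult_mono spectral_norm_unitary_le[OF P] spectral_norm_unitary_le[OF Q]) auto
  finally show ?thesis by simp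
qed

lemma adjoint_diagonalization:
  assumes A: "A \<in> carrier_mat n n" "mat_adjoint A = A" and P: "P \<in> carrier_mat n n"
    and AP: "A * P = P * mat_diag n (\<lambda>i. complex_of_real (d i))"
  shows "mat_adjoint P * A = mat_diag n (\<lambda>i. complex_of_real (d i)) * mat_adjoint P"
proof -
  have "mat_adjoint (mat_diag n (\<lambda>i. complex_of_real (d i))) = mat_diag n (\<lambda>i. complex_of_real (d i))"
    by (rule eq_matI) (auto simp: mat_diag_def)
  thus ?thesis using arg_cong[OF AP, of mat_adjoint] A P
    by (simp add: mat_adjoint_mult[of _ n n _ n])
qed

text \<open>In eigenbases of \<open>A\<close> and \<open>B\<close> the Sylvester operator multiplies entries by differences of
  eigenvalues.\<close>

lemma sylvester_diagonal_form:
  fixes A B X :: "complex mat"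
  assumes A: "A \<in> carrier_mat N N" and B: "B \<in> carrier_mat M M" "mat_adjoint B = B"
    and P: "P \<in> carrier_mat N N" and AP: "A * P = P * mat_diag N (\<lambda>i. complex_of_real (d i))"
    and Q: "Q \<in> carrier_mat M M" and BQ: "B * Q = Q * mat_diag M (\<lambda>i. complex_of_real (e i))"
    and X: "X \<in> carrier_mat M N" and ij: "i < M" "j < N"
  shows "(mat_adjoint Q * X * P) $$ (i, j) * of_real (d j - e i) = (mat_adjoint Q * (X * A - B * X) * P) $$ (i, j)"
proof -
  let ?D = "mat_diag N (\<lambda>i. complex_of_real (d i))" and ?E = "mat_diag M (\<lambda>i. complex_of_real (e i))"
  let ?X = "mat_adjoint Q * X * P"
  have X': "?X \<in> carrier_mat M N" using X P Q by auto
  have "mat_adjoint Q * (X * A - B * X) * P = mat_adjoint Q * (X * A) * P - mat_adjoint Q * (B * X) * P"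
    using A B P Q X by (simp add: mult_minus_distrib_mat[of _ M M _ N] minus_mult_distrib_mat[of _ M N _ _ N])
  also have "mat_adjoint Q * (X * A) * P = ?X * ?D"
  proof -
    have "mat_adjoint Q * (X * A) * P = mat_adjoint Q * X * (A * P)"
      using A P Q X by (simp add: assoc_mult_mat[of _ M M _ N _ N] assoc_mult_mat[of _ M N _ N _ N])
    thus ?thesis unfolding AP
      using P Q X by (simp add: assoc_mult_mat[of _ M M _ N _ N] assoc_mult_mat[of _ M N _ N _ N])
  qed
  also have "mat_adjoint Q * (B * X) * P = ?E * ?X"
  proof -
    have "mat_adjoint Q * (B * X) * P = (mat_adjoint Q * B) * X * P"
      using B P Q X by (simp add: assoc_mult_mat[of _ M M _ M _ N])
    also have "\<dots> = ?E * ?X" unfolding adjoint_diagonalization[OF B Q BQ]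
      using P Q X by (simp add: assoc_mult_mat[of _ M M _ M _ N] assoc_mult_mat[of _ M M _ N _ N])
    finally show ?thesis .
  qed
  also have "(?X * ?D - ?E * ?X) $$ (i, j) = ?X $$ (i, j) * of_real (d j - e i)"
    unfolding mat_diag_mult_right[OF X'] mat_diag_mult_left[OF X'] using ij by (simp add: algebra_simps)
  finally show ?thesis by simp
qed

lemma sylvester_norm_le:
  fixes A B X :: "complex mat"
  assumes A: "A \<in> carrier_mat N N" and B: "B \<in> carrier_mat M M" "mat_adjoint B = B"
    and P: "P \<in> carrier_mat N N" "unitary_mat P" and AP: "A * P = P * mat_diag N (\<lambda>i. complex_of_real (d i))"
    and Q: "Q \<in> carrier_mat M M" "unitary_mat Q" and BQ: "B * Q = Q * mat_diag M (\<lambda>i. complex_of_real (e i))"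
    and gap: "\<And>i j. i < M \<Longrightarrow> j < N \<Longrightarrow> \<bar>d j - e i\<bar> \<ge> \<delta>" and \<delta>: "\<delta> > 0"
    and X: "X \<in> carrier_mat M N"
  shows "spectral_norm X \<le> pi / (2 * \<delta>) * spectral_norm (X * A - B * X)"
proof -
  let ?X = "mat_adjoint Q * X * P" and ?Y = "mat_adjoint Q * (X * A - B * X) * P"
  have Q': "mat_adjoint Q \<in> carrier_mat M M" "unitary_mat (mat_adjoint Q)" using Q unitary_mat_adjoint by auto
  have P': "mat_adjoint P \<in> carrier_mat N N" "unitary_mat (mat_adjoint P)" using P unitary_mat_adjoint by auto
  have Y: "X * A - B * X \<in> carrier_mat M N" using X A B by auto
  have "X = (Q * mat_adjoint Q) * X * (P * mat_adjoint P)"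
    using X by (simp add: unitary_matD[OF P] unitary_matD[OF Q])
  also have "\<dots> = Q * ?X * mat_adjoint P"
    using X P Q by (simp add: assoc_mult_mat[of _ M M _ M _ N] assoc_mult_mat[of _ M M _ N _ N] assoc_mult_mat[of _ M N _ N _ N])
  finally have "spectral_norm X = spectral_norm (Q * ?X * mat_adjoint P)" by simp
  also have "\<dots> \<le> spectral_norm ?X"
    using P Q X by (intro spectral_norm_unitary_sandwich_le[OF Q P']) auto
  also have "\<dots> \<le> pi / (2 * \<delta>) * spectral_norm ?Y"
    by (rule difference_quotient_multiplier_norm[OF _ _ sylvester_diagonal_form[OF A B P(1) AP Q(1) BQ X] gap \<delta>])
       (use P Q X Y in auto)
  also have "\<dots> \<le> pi / (2 * \<delta>) * spectral_norm (X * A - B * X)"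
    using \<delta> by (intro mult_left_mono spectral_norm_unitary_sandwich_le[OF Q' P(1,2) Y]) auto
  finally show ?thesis .
qed

lemma sylvester_solvable:
  fixes A B Y :: "complex mat"
  assumes A: "A \<in> carrier_mat N N" and B: "B \<in> carrier_mat M M" "mat_adjoint B = B"
    and P: "P \<in> carrier_mat N N" "unitary_mat P" and AP: "A * P = P * mat_diag N (\<lambda>i. complex_of_real (d i))"
    and Q: "Q \<in> carrier_mat M M" "unitary_mat Q" and BQ: "B * Q = Q * mat_diag M (\<lambda>i. complex_of_real (e i))"
    and gap: "\<And>i j. i < M \<Longrightarrow> j < N \<Longrightarrow> d j \<noteq> e i"
    and Y: "Y \<in> carrier_mat M N"
  shows "\<exists>X\<in>carrier_mat M N. X * A - B * X = Y"
proof -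
  note sandwich = assoc_mult_mat[of _ M M _ M _ N] assoc_mult_mat[of _ M M _ N _ N] assoc_mult_mat[of _ M N _ N _ N]
  define Z where "Z = mat M N (\<lambda>(i, j). (mat_adjoint Q * Y * P) $$ (i, j) / of_real (d j - e i))"
  have Z: "Z \<in> carrier_mat M N" by (simp add: Z_def)
  define X where "X = Q * Z * mat_adjoint P"
  have X: "X \<in> carrier_mat M N" using P Q Z by (auto simp: X_def)
  have "mat_adjoint Q * X * P = (mat_adjoint Q * Q) * Z * (mat_adjoint P * P)"
    using P Q Z by (simp add: X_def sandwich)
  hence QXP: "mat_adjoint Q * X * P = Z" using Z by (simp add: unitary_matD[OF P] unitary_matD[OF Q])
  have "mat_adjoint Q * (X * A - B * X) * P = mat_adjoint Q * Y * P"
  proof (rule eq_matI)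
    fix i j assume "i < dim_row (mat_adjoint Q * Y * P)" "j < dim_col (mat_adjoint Q * Y * P)"
    hence ij: "i < M" "j < N" using P Q by auto
    show "(mat_adjoint Q * (X * A - B * X) * P) $$ (i, j) = (mat_adjoint Q * Y * P) $$ (i, j)"
      unfolding sylvester_diagonal_form[OF A B P(1) AP Q(1) BQ X ij, symmetric] QXP
      using gap[OF ij] ij by (simp add: Z_def del: of_real_diff)
  qed (use P Q in auto)
  hence "(Q * mat_adjoint Q) * (X * A - B * X) * (P * mat_adjoint P) = (Q * mat_adjoint Q) * Y * (P * mat_adjoint P)"
  proof -
    assume eq: "mat_adjoint Q * (X * A - B * X) * P = mat_adjoint Q * Y * P"
    have "(Q * mat_adjoint Q) * W * (P * mat_adjoint P) = Q * (mat_adjoint Q * W * P) * mat_adjoint P"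
      if "W \<in> carrier_mat M N" for W
      using that P Q by (simp add: sandwich)
    thus ?thesis using eq X A B Y by (simp add: minus_carrier_mat)
  qed
  hence "X * A - B * X = Y"
    using X A B Y by (simp add: unitary_matD[OF P] unitary_matD[OF Q] left_mult_one_mat[of _ M N] right_mult_one_mat[of _ M N])
  thus ?thesis using X by blast
qed

section \<open>Singular values and the Hermitian dilation\<close>

text \<open>The smaller of the two Gram matrices of \<open>G\<close>, whose characteristic polynomial defines the singular
  values.\<close>

definition gram :: "complex mat \<Rightarrow> complex mat" where
  "gram G = (if dim_row G \<le> dim_col G then G * mat_adjoint G else mat_adjoint G * G)"

lemma gram_carrier: "gram G \<in> carrier_mat (min (dim_row G) (dim_col G)) (min (dim_row G) (dim_col G))"
  by (auto simp: gram_def min_def)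

lemma char_poly_neq_0: "A \<in> carrier_mat n n \<Longrightarrow> char_poly (A :: complex mat) \<noteq> 0"
  using degree_monic_char_poly[of A n] by auto

lemma set_mset_sv: "set_mset (sv G) = {sqrt (Re z) | z. eigenvalue (gram G) z}"
  using char_poly_neq_0[OF gram_carrier] eigenvalue_root_char_poly[OF gram_carrier]
  by (auto simp: sv_def gram_def[symmetric])

lemma size_sv: "size (sv G) = min (dim_row G) (dim_col G)"
  using degree_monic_char_poly[OF gram_carrier, of G]
  by (simp add: sv_def gram_def[symmetric] size_proots_complex)

lemma abs_in_sv_ext:
  assumes "eigenvector (gram G) a (complex_of_real (l\<^sup>2))"
  shows "\<bar>l\<bar> \<in># sv_ext G"
proof -
  have "sqrt (Re (complex_of_real (l\<^sup>2))) = \<bar>l\<bar>" by simp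
  hence "\<bar>l\<bar> \<in># sv G" unfolding set_mset_sv eigenvalue_def using assms by (metis (mono_tags, lifting) mem_Collect_eq)
  thus ?thesis by (simp add: sv_ext_def)
qed

lemma sv_nonneg:
  assumes "\<mu> \<in># sv G"
  shows "\<mu> \<ge> 0"
proof -
  obtain z a where \<mu>: "\<mu> = sqrt (Re z)" and a: "eigenvector (gram G) a z"
    using assms unfolding set_mset_sv eigenvalue_def by auto
  obtain K k l where K: "K \<in> carrier_mat k l" "gram G = mat_adjoint K * K"
  proof (cases "dim_row G \<le> dim_col G")
    case True
    thus ?thesis using that[of "mat_adjoint G" "dim_col G" "dim_row G"] by (simp add: gram_def)
  next
    case False
    thus ?thesis using that[of G "dim_row G" "dim_col G"] by (simp add: gram_def)
  qed
  have a': "a \<in> carrier_vec l" "a \<noteq> 0\<^sub>v l" "gram G *\<^sub>v a = z \<cdot>\<^sub>v a"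
    using a K by (auto simp: eigenvector_def)
  have "z * complex_of_real ((vec_norm2 a)\<^sup>2) = (gram G *\<^sub>v a) \<bullet>c a"
    using a' unfolding vec_norm2_cscalar by (simp add: smult_scalar_prod_distrib[of _ l])
  also have "\<dots> = (mat_adjoint K *\<^sub>v (K *\<^sub>v a)) \<bullet>c a"
    using K a' by (simp add: assoc_mult_mat_vec[of _ l k _ l])
  also have "\<dots> = (K *\<^sub>v a) \<bullet>c (K *\<^sub>v a)"
    using K a' cscalar_prod_mult_mat_vec[of "mat_adjoint K" l k "K *\<^sub>v a" a] by auto
  also have "\<dots> = complex_of_real ((vec_norm2 (K *\<^sub>v a))\<^sup>2)" by (rule vec_norm2_cscalar[symmetric])
  finally have "Re z * (vec_norm2 a)\<^sup>2 = (vec_norm2 (K *\<^sub>v a))\<^sup>2"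
    by (metis Re_complex_of_real times_complex.sel(1) Im_complex_of_real mult_zero_right diff_zero)
  moreover have "(vec_norm2 a)\<^sup>2 > 0" using vec_norm2_pos[OF a'(1,2)] by simp
  ultimately have "Re z \<ge> 0" by (metis zero_le_power2 zero_le_mult_iff not_le)
  thus ?thesis by (simp add: \<mu>)
qed

lemma sigma_max_in_sv:
  assumes "min (dim_row G) (dim_col G) \<ge> 1"
  shows "sigma_max G \<in># sv G"
proof -
  let ?L = "sorted_list_of_multiset (sv G)"
  have len: "length ?L = min (dim_row G) (dim_col G)"
    by (metis mset_sorted_list_of_multiset size_mset size_sv)
  hence "rev ?L ! 0 \<in> set (rev ?L)" using assms by (intro nth_mem) auto
  thus ?thesis by (simp add: sigma_max_def sigma_def)
qed

lemma sv_le_sigma_max: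
  assumes "\<mu> \<in># sv G"
  shows "\<mu> \<le> sigma_max G"
proof -
  let ?L = "sorted_list_of_multiset (sv G)"
  have "\<mu> \<in> set ?L" using assms by simp
  then obtain i where i: "i < length ?L" "?L ! i = \<mu>" by (metis in_set_conv_nth)
  have "?L ! i \<le> ?L ! (length ?L - 1)"
    using i(1) by (intro sorted_nth_mono) auto
  moreover have "rev ?L ! 0 = ?L ! (length ?L - 1)"
    using i(1) by (subst rev_nth) auto
  ultimately show ?thesis using i(2) by (simp add: sigma_max_def sigma_def)
qed

lemma sigma_min_eq:
  assumes "min (dim_row G) (dim_col G) \<ge> 1"
  shows "sigma_min G = sorted_list_of_multiset (sv G) ! 0"
proof -
  let ?L = "sorted_list_of_multiset (sv G)"
  have len: "length ?L = min (dim_row G) (dim_col G)"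
    by (metis mset_sorted_list_of_multiset size_mset size_sv)
  have "rev ?L ! (length ?L - 1) = ?L ! 0"
    using assms by (subst rev_nth) (auto simp: len)
  thus ?thesis by (simp add: sigma_min_def sigma_def len)
qed

lemma sigma_min_in_sv:
  assumes "min (dim_row G) (dim_col G) \<ge> 1"
  shows "sigma_min G \<in># sv G"
proof -
  let ?L = "sorted_list_of_multiset (sv G)"
  have len: "length ?L = min (dim_row G) (dim_col G)"
    by (metis mset_sorted_list_of_multiset size_mset size_sv)
  hence "?L ! 0 \<in> set ?L" using assms by (intro nth_mem) auto
  thus ?thesis by (simp add: sigma_min_eq[OF assms])
qed

lemma sigma_min_le_sv:
  assumes "\<mu> \<in># sv G"
  shows "sigma_min G \<le> \<mu>"
proof -
  let ?L = "sorted_list_of_multiset (sv G)"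
  have "sv G \<noteq> {#}" using assms by auto
  hence "min (dim_row G) (dim_col G) \<ge> 1" using size_sv[of G] by (metis One_nat_def Suc_leI nonempty_has_size)
  moreover have "\<mu> \<in> set ?L" using assms by simp
  then obtain i where i: "i < length ?L" "?L ! i = \<mu>" by (metis in_set_conv_nth)
  have "?L ! 0 \<le> ?L ! i" using i(1) by (intro sorted_nth_mono) auto
  ultimately show ?thesis using i(2) by (simp add: sigma_min_eq)
qed

text \<open>Also known as the Jordan-Wielandt matrix of \<open>G\<close>.\<close>

definition hermitian_dilation :: "complex mat \<Rightarrow> complex mat" where
  "hermitian_dilation G =
     four_block_mat (0\<^sub>m (dim_row G) (dim_row G)) G (mat_adjoint G) (0\<^sub>m (dim_col G) (dim_col G))"

lemma hermitian_dilation_carrier: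
  "G \<in> carrier_mat p q \<Longrightarrow> hermitian_dilation G \<in> carrier_mat (p + q) (p + q)"
  by (auto simp: hermitian_dilation_def)

lemma mat_adjoint_hermitian_dilation: "mat_adjoint (hermitian_dilation G) = hermitian_dilation G"
  unfolding hermitian_dilation_def
  by (subst mat_adjoint_four_block[of _ "dim_row G" "dim_row G" _ "dim_col G" _ "dim_col G"]) auto

lemma hermitian_dilation_mult_vec:
  assumes "G \<in> carrier_mat p q" "a \<in> carrier_vec p" "b \<in> carrier_vec q"
  shows "hermitian_dilation G *\<^sub>v (a @\<^sub>v b) = (G *\<^sub>v b) @\<^sub>v (mat_adjoint G *\<^sub>v a)"
proof -
  have z: "0\<^sub>m k k *\<^sub>v v = 0\<^sub>v k" if "v \<in> carrier_vec k" for k and v :: "complex vec"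
    using that by (intro eq_vecI) auto
  have "hermitian_dilation G *\<^sub>v (a @\<^sub>v b) =
      (0\<^sub>m p p *\<^sub>v a + G *\<^sub>v b) @\<^sub>v (mat_adjoint G *\<^sub>v a + 0\<^sub>m q q *\<^sub>v b)"
    unfolding hermitian_dilation_def using assms
    by (subst four_block_mat_mult_vec[of _ p p _ q _ q]) auto
  also have "0\<^sub>m p p *\<^sub>v a + G *\<^sub>v b = G *\<^sub>v b"
    unfolding z[OF assms(2)] using assms by (intro left_zero_vec mult_mat_vec_carrier)
  also have "mat_adjoint G *\<^sub>v a + 0\<^sub>m q q *\<^sub>v b = mat_adjoint G *\<^sub>v a"
    unfolding z[OF assms(3)] using assms by (intro right_zero_vec mult_mat_vec_carrier) auto
  finally show ?thesis .
qed

lemma carrier_vec_splitE: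
  assumes "x \<in> carrier_vec (p + q)"
  obtains a b where "a \<in> carrier_vec p" "b \<in> carrier_vec q" "x = a @\<^sub>v b"
  using vec_first_last_append[OF assms] by (metis vec_first_carrier vec_last_carrier)

lemma vec_norm2_hermitian_dilation_le:
  assumes G: "G \<in> carrier_mat p q" and x: "x \<in> carrier_vec (p + q)"
  shows "vec_norm2 (hermitian_dilation G *\<^sub>v x) \<le> spectral_norm G * vec_norm2 x"
proof -
  obtain a b where ab: "a \<in> carrier_vec p" "b \<in> carrier_vec q" "x = a @\<^sub>v b"
    using carrier_vec_splitE[OF x] .
  have "(vec_norm2 (hermitian_dilation G *\<^sub>v x))\<^sup>2 = (vec_norm2 (G *\<^sub>v b))\<^sup>2 + (vec_norm2 (mat_adjoint G *\<^sub>v a))\<^sup>2"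
    unfolding ab(3) hermitian_dilation_mult_vec[OF G ab(1,2)] by (rule vec_norm2_append)
  also have "\<dots> \<le> (spectral_norm G * vec_norm2 b)\<^sup>2 + (spectral_norm G * vec_norm2 a)\<^sup>2"
    using vec_norm2_mult_mat_vec_le[OF G ab(2)] vec_norm2_mult_mat_vec_le[of "mat_adjoint G" q p a] G ab(1)
    by (intro add_mono power_mono) auto
  also have "\<dots> = (spectral_norm G * vec_norm2 x)\<^sup>2"
    unfolding ab(3) power_mult_distrib vec_norm2_append by (simp add: algebra_simps)
  finally show ?thesis by (rule power2_le_imp_le) simp
qed

text \<open>If \<open>(a, b)\<close> is an eigenvector then \<open>G b = l a\<close> and \<open>G\<^sup>H a = l b\<close>. For \<open>l \<noteq> 0\<close> both halves are nonzero, and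
  each is an eigenvector of a Gram matrix for \<open>l\<^sup>2\<close>. For \<open>l = 0\<close> there are two cases. If \<open>G\<close> is not square,
  0 is one of the additional values in \<open>sv_ext G\<close>. If \<open>G\<close> is square, it is singular, and so is its Gram matrix.\<close>

lemma hermitian_dilation_eigenvalue:
  assumes G: "G \<in> carrier_mat p q" and x: "x \<in> carrier_vec (p + q)" "x \<noteq> 0\<^sub>v (p + q)"
    and eig: "hermitian_dilation G *\<^sub>v x = complex_of_real l \<cdot>\<^sub>v x"
  shows "\<bar>l\<bar> \<in># sv_ext G"
proof -
  obtain a b where ab: "a \<in> carrier_vec p" "b \<in> carrier_vec q" "x = a @\<^sub>v b"
    using carrier_vec_splitE[OF x(1)] .
  let ?l = "complex_of_real l"
  have "?l \<cdot>\<^sub>v (a @\<^sub>v b) = (?l \<cdot>\<^sub>v a) @\<^sub>v (?l \<cdot>\<^sub>v b)" by (intro eq_vecI) auto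
  with eig have "(G *\<^sub>v b) @\<^sub>v (mat_adjoint G *\<^sub>v a) = (?l \<cdot>\<^sub>v a) @\<^sub>v (?l \<cdot>\<^sub>v b)"
    unfolding ab(3) hermitian_dilation_mult_vec[OF G ab(1,2)] by simp
  moreover have "G *\<^sub>v b \<in> carrier_vec p" "?l \<cdot>\<^sub>v a \<in> carrier_vec p" using G ab by auto
  ultimately have Gb: "G *\<^sub>v b = ?l \<cdot>\<^sub>v a" and Ga: "mat_adjoint G *\<^sub>v a = ?l \<cdot>\<^sub>v b"
    using append_vec_eq by blast+
  have GG: "(G * mat_adjoint G) *\<^sub>v a = complex_of_real (l\<^sup>2) \<cdot>\<^sub>v a"
    using G ab Ga Gb by (simp add: assoc_mult_mat_vec[of _ p q _ p] mult_mat_vec[of _ p q] smult_smult_assoc power2_eq_square)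
  have GG': "(mat_adjoint G * G) *\<^sub>v b = complex_of_real (l\<^sup>2) \<cdot>\<^sub>v b"
    using G ab Ga Gb by (simp add: assoc_mult_mat_vec[of _ q p _ q] mult_mat_vec[of _ q p] smult_smult_assoc power2_eq_square)
  have x0: "a \<noteq> 0\<^sub>v p \<or> b \<noteq> 0\<^sub>v q"
  proof (rule ccontr)
    assume "\<not> ?thesis"
    hence "x = 0\<^sub>v (p + q)" unfolding ab(3) by (intro eq_vecI) auto
    thus False using x(2) by simp
  qed
  show ?thesis
  proof (cases "l = 0")
    case False
    have both: "a \<noteq> 0\<^sub>v p" "b \<noteq> 0\<^sub>v q"
    proof -
      have smult0: "v = 0\<^sub>v k" if "?l \<cdot>\<^sub>v v = 0\<^sub>v k" "v \<in> carrier_vec k" for v k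
      proof -
        have "vec_norm2 (?l \<cdot>\<^sub>v v) = 0" using that by simp
        hence "vec_norm2 v = 0" using False by simp
        thus ?thesis using vec_norm2_pos[OF that(2)] by auto
      qed
      have z: "K *\<^sub>v 0\<^sub>v k = 0\<^sub>v j" if "K \<in> carrier_mat j k" for K :: "complex mat" and j k
        using that by (intro eq_vecI) auto
      have "b = 0\<^sub>v q" if a: "a = 0\<^sub>v p"
        by (rule smult0[OF _ ab(2)], unfold Ga[symmetric] a, rule z) (simp add: G)
      moreover have "a = 0\<^sub>v p" if b: "b = 0\<^sub>v q"
        by (rule smult0[OF _ ab(1)], unfold Gb[symmetric] b, rule z[OF G])
      ultimately show "a \<noteq> 0\<^sub>v p" "b \<noteq> 0\<^sub>v q" using x0 by blast+
    qed
    show ?thesis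
    proof (cases "p \<le> q")
      case True
      thus ?thesis using GG ab both G
        by (intro abs_in_sv_ext[of _ a]) (auto simp: eigenvector_def gram_def)
    next
      case False
      thus ?thesis using GG' ab both G
        by (intro abs_in_sv_ext[of _ b]) (auto simp: eigenvector_def gram_def)
    qed
  next
    case l: True
    show ?thesis
    proof (cases "p = q")
      case False
      thus ?thesis using l G by (auto simp: sv_ext_def)
    next
      case True
      \<comment> \<open>A kernel vector of either factor makes the determinant of the Gram matrix vanish.\<close>
      have "det G = 0 \<or> det (mat_adjoint G) = 0"
        using x0
      proof
        assume "a \<noteq> 0\<^sub>v p"
        hence "det (mat_adjoint G) = 0"
          using True G ab Ga l by (subst det_0_iff_vec_prod_zero_field[of _ p]) (auto intro!: exI[of _ a])
        thus ?thesis ..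
      next
        assume "b \<noteq> 0\<^sub>v q"
        hence "det G = 0"
          using True G ab Gb l by (subst det_0_iff_vec_prod_zero_field[of _ p]) (auto intro!: exI[of _ b])
        thus ?thesis ..
      qed
      hence "det (G * mat_adjoint G) = 0" using G True by (subst det_mult[of _ p]) auto
      then obtain c where "c \<in> carrier_vec p" "c \<noteq> 0\<^sub>v p" "(G * mat_adjoint G) *\<^sub>v c = 0\<^sub>v p"
        using det_0_iff_vec_prod_zero_field[of "G * mat_adjoint G" p] G True by auto
      thus ?thesis using G True l
        by (intro abs_in_sv_ext[of _ c]) (auto simp: eigenvector_def gram_def)
    qed
  qed
qed

lemma diagonalization_column_eigenvector:
  fixes A :: "complex mat"
  assumes A: "A \<in> carrier_mat n n" and P: "P \<in> carrier_mat n n" "unitary_mat P"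
    and AP: "A * P = P * mat_diag n (\<lambda>i. complex_of_real (d i))" and i: "i < n"
  shows "A *\<^sub>v col P i = complex_of_real (d i) \<cdot>\<^sub>v col P i" "col P i \<in> carrier_vec n" "col P i \<noteq> 0\<^sub>v n"
proof -
  have "A *\<^sub>v col P i = col (A * P) i" by (rule col_mult2[OF A P(1) i, symmetric])
  also have "\<dots> = complex_of_real (d i) \<cdot>\<^sub>v col P i"
    unfolding AP mat_diag_mult_right[OF P(1)] using P i by (intro eq_vecI) (auto simp: mult.commute)
  finally show "A *\<^sub>v col P i = complex_of_real (d i) \<cdot>\<^sub>v col P i" .
  show c: "col P i \<in> carrier_vec n" using P by (intro carrier_vecI) simp
  show "col P i \<noteq> 0\<^sub>v n"
  proof
    assume 0: "col P i = 0\<^sub>v n"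
    have "(mat_adjoint P * P) $$ (i, i) = row (mat_adjoint P) i \<bullet> col P i"
      using P i by (subst index_mult_mat) auto
    also have "\<dots> = 0" unfolding 0 using P i by (simp add: scalar_prod_def)
    finally show False using unitary_matD[OF P] i by simp
  qed
qed

text \<open>Here \<open>y\<close> holds the coordinates of \<open>x\<close> in an eigenbasis of \<open>A\<close>.\<close>

lemma hermitian_shift_norm:
  fixes A :: "complex mat"
  assumes A: "A \<in> carrier_mat n n" and P: "P \<in> carrier_mat n n" "unitary_mat P"
    and AP: "A * P = P * mat_diag n (\<lambda>i. complex_of_real (d i))" and x: "x \<in> carrier_vec n"
  obtains y where "y \<in> carrier_vec n" "vec_norm2 y = vec_norm2 x"
    "vec_norm2 (A *\<^sub>v x - complex_of_real \<mu> \<cdot>\<^sub>v x) = vec_norm2 (vec n (\<lambda>i. complex_of_real (d i - \<mu>) * y $ i))"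
proof -
  let ?D = "mat_diag n (\<lambda>i. complex_of_real (d i))"
  define y where "y = mat_adjoint P *\<^sub>v x"
  have y: "y \<in> carrier_vec n" using P x by (auto simp: y_def)
  have xy: "x = P *\<^sub>v y"
    using P x assoc_mult_mat_vec[of P n n "mat_adjoint P" n x] by (simp add: y_def unitary_matD[OF P])
  have "A *\<^sub>v x = P *\<^sub>v (?D *\<^sub>v y)"
    using A P y AP by (simp add: xy flip: assoc_mult_mat_vec[of _ n n _ n])
  moreover have Dy: "?D *\<^sub>v y = vec n (\<lambda>i. complex_of_real (d i) * y $ i)"
  proof (rule eq_vecI)
    fix i assume "i < dim_vec (vec n (\<lambda>i. complex_of_real (d i) * y $ i))"
    hence i: "i < n" by simp
    have "(?D *\<^sub>v y) $ i = (\<Sum>j\<in>{0..<n}. (if i = j then complex_of_real (d j) else 0) * y $ j)"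
      using i y by (simp add: mat_diag_def scalar_prod_def)
    also have "\<dots> = (\<Sum>j\<in>{0..<n}. if i = j then complex_of_real (d j) * y $ j else 0)"
      by (intro sum.cong) auto
    finally show "(?D *\<^sub>v y) $ i = vec n (\<lambda>i. complex_of_real (d i) * y $ i) $ i" using i by simp
  qed (simp add: mat_diag_def)
  ultimately have "A *\<^sub>v x - complex_of_real \<mu> \<cdot>\<^sub>v x =
      P *\<^sub>v (vec n (\<lambda>i. complex_of_real (d i) * y $ i)) - P *\<^sub>v (complex_of_real \<mu> \<cdot>\<^sub>v y)"
    using P y by (simp add: xy mult_mat_vec)
  also have "\<dots> = P *\<^sub>v (vec n (\<lambda>i. complex_of_real (d i) * y $ i) - complex_of_real \<mu> \<cdot>\<^sub>v y)"
    using P y by (subst mult_minus_distrib_mat_vec[of _ n n]) auto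
  also have "vec n (\<lambda>i. complex_of_real (d i) * y $ i) - complex_of_real \<mu> \<cdot>\<^sub>v y =
      vec n (\<lambda>i. complex_of_real (d i - \<mu>) * y $ i)"
    using y by (intro eq_vecI) (auto simp: algebra_simps)
  finally have "vec_norm2 (A *\<^sub>v x - complex_of_real \<mu> \<cdot>\<^sub>v x) = vec_norm2 (vec n (\<lambda>i. complex_of_real (d i - \<mu>) * y $ i))"
    using vec_norm2_unitary[OF P] by simp
  moreover have "vec_norm2 y = vec_norm2 x" unfolding xy by (rule vec_norm2_unitary[OF P y, symmetric])
  ultimately show ?thesis using that y by blast
qed

lemma hermitian_shift_norm_ge:
  fixes A :: "complex mat"
  assumes A: "A \<in> carrier_mat n n" and P: "P \<in> carrier_mat n n" "unitary_mat P"
    and AP: "A * P = P * mat_diag n (\<lambda>i. complex_of_real (d i))" and x: "x \<in> carrier_vec n"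
    and c: "c \<ge> 0" "\<And>i. i < n \<Longrightarrow> \<bar>d i - \<mu>\<bar> \<ge> c"
  shows "c * vec_norm2 x \<le> vec_norm2 (A *\<^sub>v x - complex_of_real \<mu> \<cdot>\<^sub>v x)"
proof -
  obtain y where y: "y \<in> carrier_vec n" "vec_norm2 y = vec_norm2 x"
    "vec_norm2 (A *\<^sub>v x - complex_of_real \<mu> \<cdot>\<^sub>v x) = vec_norm2 (vec n (\<lambda>i. complex_of_real (d i - \<mu>) * y $ i))"
    using hermitian_shift_norm[OF A P AP x] by metis
  have "c * vec_norm2 y = vec_norm2 (complex_of_real c \<cdot>\<^sub>v y)" using c by simp
  also have "\<dots> \<le> vec_norm2 (vec n (\<lambda>i. complex_of_real (d i - \<mu>) * y $ i))"
    unfolding vec_norm2_L2_set using y(1) c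
    by (auto simp: norm_mult intro!: L2_set_mono mult_right_mono simp del: of_real_diff)
  finally show ?thesis using y by simp
qed

lemma hermitian_norm_le:
  fixes A :: "complex mat"
  assumes A: "A \<in> carrier_mat n n" and P: "P \<in> carrier_mat n n" "unitary_mat P"
    and AP: "A * P = P * mat_diag n (\<lambda>i. complex_of_real (d i))" and x: "x \<in> carrier_vec n"
    and c: "c \<ge> 0" "\<And>i. i < n \<Longrightarrow> \<bar>d i\<bar> \<le> c"
  shows "vec_norm2 (A *\<^sub>v x) \<le> c * vec_norm2 x"
proof -
  obtain y where y: "y \<in> carrier_vec n" "vec_norm2 y = vec_norm2 x"
    "vec_norm2 (A *\<^sub>v x - complex_of_real 0 \<cdot>\<^sub>v x) = vec_norm2 (vec n (\<lambda>i. complex_of_real (d i - 0) * y $ i))"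
    using hermitian_shift_norm[OF A P AP x] by metis
  have "vec_norm2 (vec n (\<lambda>i. complex_of_real (d i - 0) * y $ i)) \<le> vec_norm2 (complex_of_real c \<cdot>\<^sub>v y)"
    unfolding vec_norm2_L2_set using y(1) c
    by (auto simp: norm_mult intro!: L2_set_mono mult_right_mono)
  also have "\<dots> = c * vec_norm2 x" using c y by simp
  finally have "vec_norm2 (A *\<^sub>v x - complex_of_real 0 \<cdot>\<^sub>v x) \<le> c * vec_norm2 x" using y(3) by simp
  moreover have "A *\<^sub>v x - complex_of_real 0 \<cdot>\<^sub>v x = A *\<^sub>v x" using A x by (intro eq_vecI) auto
  ultimately show ?thesis by simp
qed

section \<open>The coupled Sylvester equations\<close>

lemma hermitian_dilation_diagonalization:
  assumes G: "G \<in> carrier_mat p q"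
  obtains P d where "P \<in> carrier_mat (p + q) (p + q)" "unitary_mat P"
    "hermitian_dilation G * P = P * mat_diag (p + q) (\<lambda>i. complex_of_real (d i))"
    "\<And>i. i < p + q \<Longrightarrow> \<bar>d i\<bar> \<in># sv_ext G"
proof -
  note H = hermitian_dilation_carrier[OF G]
  obtain P d where P: "P \<in> carrier_mat (p + q) (p + q)" "unitary_mat P"
    and HP: "hermitian_dilation G * P = P * mat_diag (p + q) (\<lambda>i. complex_of_real (d i))"
    using hermitian_unitary_diagonalization[OF H mat_adjoint_hermitian_dilation] by blast
  have "\<bar>d i\<bar> \<in># sv_ext G" if "i < p + q" for i
    using diagonalization_column_eigenvector[OF H P HP that] by (intro hermitian_dilation_eigenvalue[OF G])
  thus ?thesis using that[OF P HP] by blast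
qed

lemma hermitian_dilation_add:
  assumes "G \<in> carrier_mat p q" "E \<in> carrier_mat p q"
  shows "hermitian_dilation (G + E) = hermitian_dilation G + hermitian_dilation E"
  unfolding hermitian_dilation_def using assms
  by (subst add_four_block_mat[of _ p p _ q _ q]) (auto simp: mat_adjoint_add)

text \<open>A form of Weyl's inequality that orders no eigenvalues. Let \<open>x\<close> be an eigenvector of the perturbed
  dilation for \<open>d i\<close>. Then \<open>(H - d i) x\<close>, with the dilation \<open>H\<close> of \<open>G\<close>, has norm at most \<open>\<parallel>E\<parallel> \<parallel>x\<parallel>\<close>. But the norm
  is also at least the distance of \<open>d i\<close> from the spectrum of \<open>H\<close> times \<open>\<parallel>x\<parallel>\<close>.\<close>

lemma singular_value_perturbation:
  assumes G: "G \<in> carrier_mat p q" and E: "E \<in> carrier_mat p q"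
    and P: "P \<in> carrier_mat (p + q) (p + q)" "unitary_mat P"
    and HP: "hermitian_dilation (G + E) * P = P * mat_diag (p + q) (\<lambda>i. complex_of_real (d i))"
    and i: "i < p + q"
  shows "\<exists>\<nu>. \<nu> \<in># sv_ext G \<and> \<bar>\<bar>d i\<bar> - \<nu>\<bar> \<le> spectral_norm E"
proof (rule ccontr)
  assume contr: "\<not> ?thesis"
  note HG = hermitian_dilation_carrier[OF G] and HE = hermitian_dilation_carrier[OF E]
  have HGE: "hermitian_dilation (G + E) \<in> carrier_mat (p + q) (p + q)"
    using G E by (intro hermitian_dilation_carrier) auto
  obtain Q g where Q: "Q \<in> carrier_mat (p + q) (p + q)" "unitary_mat Q"
    and HQ: "hermitian_dilation G * Q = Q * mat_diag (p + q) (\<lambda>i. complex_of_real (g i))"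
    and g: "\<And>j. j < p + q \<Longrightarrow> \<bar>g j\<bar> \<in># sv_ext G"
    using hermitian_dilation_diagonalization[OF G] by blast
  define x where "x = col P i"
  have x: "hermitian_dilation (G + E) *\<^sub>v x = complex_of_real (d i) \<cdot>\<^sub>v x" "x \<in> carrier_vec (p + q)" "x \<noteq> 0\<^sub>v (p + q)"
    unfolding x_def by (rule diagonalization_column_eigenvector[OF HGE P HP i])+
  define c where "c = Min ((\<lambda>j. \<bar>g j - d i\<bar>) ` {..<p + q})"
  have c_le: "c \<le> \<bar>g j - d i\<bar>" if "j < p + q" for j
    unfolding c_def using that by (intro Min_le) auto
  have "c \<in> (\<lambda>j. \<bar>g j - d i\<bar>) ` {..<p + q}" unfolding c_def using i by (intro Min_in) auto
  then obtain j where j: "j < p + q" "c = \<bar>g j - d i\<bar>" by auto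
  have "spectral_norm E < \<bar>\<bar>d i\<bar> - \<bar>g j\<bar>\<bar>" using contr g[OF j(1)] by force
  also have "\<dots> \<le> c" unfolding j(2) by linarith
  finally have c: "spectral_norm E < c" .
  have "c * vec_norm2 x \<le> vec_norm2 (hermitian_dilation G *\<^sub>v x - complex_of_real (d i) \<cdot>\<^sub>v x)"
    by (rule hermitian_shift_norm_ge[OF HG Q HQ x(2) order.trans[OF spectral_norm_nonneg less_imp_le[OF c]] c_le])
  also have "hermitian_dilation G *\<^sub>v x - complex_of_real (d i) \<cdot>\<^sub>v x = (-1) \<cdot>\<^sub>v (hermitian_dilation E *\<^sub>v x)"
    unfolding x(1)[symmetric] hermitian_dilation_add[OF G E] add_mult_distrib_mat_vec[OF HG HE x(2)]
    using HG HE x(2) by (intro eq_vecI) auto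
  also have "vec_norm2 \<dots> \<le> spectral_norm E * vec_norm2 x"
    using vec_norm2_hermitian_dilation_le[OF E x(2)] by simp
  finally show False using c vec_norm2_pos[OF x(2,3)] by simp
qed

text \<open>Signs of eigenvalues of dilations do no harm because singular values are nonnegative:
  \<open>\<bar>d - e\<bar> \<ge> \<bar>\<bar>d\<bar> - \<bar>e\<bar>\<bar>\<close>.\<close>

lemma perturbed_gap:
  assumes G1: "G1 \<in> carrier_mat r r" and E1: "E1 \<in> carrier_mat r r"
    and G2: "G2 \<in> carrier_mat p q" and E2: "E2 \<in> carrier_mat p q"
    and gap: "\<And>\<mu> \<nu>. \<mu> \<in># sv G1 \<Longrightarrow> \<nu> \<in># sv_ext G2 \<Longrightarrow> \<bar>\<mu> - \<nu>\<bar> \<ge> \<delta>"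
    and P: "P \<in> carrier_mat (r + r) (r + r)" "unitary_mat P"
    and HP: "hermitian_dilation (G1 + E1) * P = P * mat_diag (r + r) (\<lambda>i. complex_of_real (d i))"
    and Q: "Q \<in> carrier_mat (p + q) (p + q)" "unitary_mat Q"
    and HQ: "hermitian_dilation (G2 + E2) * Q = Q * mat_diag (p + q) (\<lambda>i. complex_of_real (e i))"
    and i: "i < p + q" and j: "j < r + r"
  shows "\<bar>d j - e i\<bar> \<ge> \<delta> - spectral_norm E1 - spectral_norm E2"
proof -
  have "sv_ext G1 = sv G1" using G1 by (simp add: sv_ext_def)
  then obtain \<mu> where \<mu>: "\<mu> \<in># sv G1" "\<bar>\<bar>d j\<bar> - \<mu>\<bar> \<le> spectral_norm E1"
    using singular_value_perturbation[OF G1 E1 P HP j] by auto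
  obtain \<nu> where \<nu>: "\<nu> \<in># sv_ext G2" "\<bar>\<bar>e i\<bar> - \<nu>\<bar> \<le> spectral_norm E2"
    using singular_value_perturbation[OF G2 E2 Q HQ i] by auto
  from gap[OF \<mu>(1) \<nu>(1)] \<mu>(2) \<nu>(2) show ?thesis by linarith
qed

lemma spectral_norm_block_diag_ge:
  assumes X: "X \<in> carrier_mat p r" and W: "W \<in> carrier_mat q s"
  defines "Z \<equiv> four_block_mat X (0\<^sub>m p s) (0\<^sub>m q r) W"
  shows "spectral_norm X \<le> spectral_norm Z" "spectral_norm W \<le> spectral_norm Z"
proof -
  have Z: "Z \<in> carrier_mat (p + q) (r + s)" using X W by (simp add: Z_def)
  have app: "Z *\<^sub>v (a @\<^sub>v b) = (X *\<^sub>v a) @\<^sub>v (W *\<^sub>v b)" if ab: "a \<in> carrier_vec r" "b \<in> carrier_vec s" for a b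
  proof -
    have "0\<^sub>m p s *\<^sub>v b = 0\<^sub>v p" "0\<^sub>m q r *\<^sub>v a = 0\<^sub>v q" using ab by (auto intro!: eq_vecI)
    thus ?thesis unfolding Z_def using X W ab by (subst four_block_mat_mult_vec[of _ p r _ s _ q]) auto
  qed
  have norm: "(vec_norm2 (X *\<^sub>v a))\<^sup>2 + (vec_norm2 (W *\<^sub>v b))\<^sup>2 \<le> (spectral_norm Z)\<^sup>2 * ((vec_norm2 a)\<^sup>2 + (vec_norm2 b)\<^sup>2)"
    if ab: "a \<in> carrier_vec r" "b \<in> carrier_vec s" for a b
  proof -
    have "vec_norm2 (Z *\<^sub>v (a @\<^sub>v b)) \<le> spectral_norm Z * vec_norm2 (a @\<^sub>v b)"
      using ab by (intro vec_norm2_mult_mat_vec_le[OF Z]) auto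
    hence "(vec_norm2 (Z *\<^sub>v (a @\<^sub>v b)))\<^sup>2 \<le> (spectral_norm Z * vec_norm2 (a @\<^sub>v b))\<^sup>2"
      by (intro power_mono) auto
    thus ?thesis unfolding app[OF ab] vec_norm2_append power_mult_distrib .
  qed
  show "spectral_norm X \<le> spectral_norm Z"
  proof (rule spectral_norm_leI[OF X])
    fix a :: "complex vec" assume a: "a \<in> carrier_vec r"
    have "(vec_norm2 (X *\<^sub>v a))\<^sup>2 \<le> (vec_norm2 (X *\<^sub>v a))\<^sup>2 + (vec_norm2 (W *\<^sub>v 0\<^sub>v s))\<^sup>2" by simp
    also have "\<dots> \<le> (spectral_norm Z * vec_norm2 a)\<^sup>2"
      using norm[OF a, of "0\<^sub>v s"] by (simp add: power_mult_distrib)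
    finally show "vec_norm2 (X *\<^sub>v a) \<le> spectral_norm Z * vec_norm2 a"
      by (rule power2_le_imp_le) simp
  qed simp
  show "spectral_norm W \<le> spectral_norm Z"
  proof (rule spectral_norm_leI[OF W])
    fix b :: "complex vec" assume b: "b \<in> carrier_vec s"
    have "(vec_norm2 (W *\<^sub>v b))\<^sup>2 \<le> (vec_norm2 (X *\<^sub>v 0\<^sub>v r))\<^sup>2 + (vec_norm2 (W *\<^sub>v b))\<^sup>2" by simp
    also have "\<dots> \<le> (spectral_norm Z * vec_norm2 b)\<^sup>2"
      using norm[OF _ b, of "0\<^sub>v r"] by (simp add: power_mult_distrib)
    finally show "vec_norm2 (W *\<^sub>v b) \<le> spectral_norm Z * vec_norm2 b"
      by (rule power2_le_imp_le) simp
  qed simp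
qed

lemma spectral_norm_block_antidiag_le:
  assumes Y: "Y \<in> carrier_mat p s" and W: "W \<in> carrier_mat q r"
  shows "spectral_norm (four_block_mat (0\<^sub>m p r) Y W (0\<^sub>m q s)) \<le> max (spectral_norm Y) (spectral_norm W)"
proof (rule spectral_norm_leI)
  let ?M = "max (spectral_norm Y) (spectral_norm W)"
  show "four_block_mat (0\<^sub>m p r) Y W (0\<^sub>m q s) \<in> carrier_mat (p + q) (r + s)" by simp
  show M: "?M \<ge> 0" by (simp add: le_max_iff_disj)
  fix x :: "complex vec" assume x: "x \<in> carrier_vec (r + s)"
  obtain a b where ab: "a \<in> carrier_vec r" "b \<in> carrier_vec s" "x = a @\<^sub>v b"
    using carrier_vec_splitE[OF x] .
  have "0\<^sub>m p r *\<^sub>v a = 0\<^sub>v p" "0\<^sub>m q s *\<^sub>v b = 0\<^sub>v q" using ab by (auto intro!: eq_vecI)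
  hence "four_block_mat (0\<^sub>m p r) Y W (0\<^sub>m q s) *\<^sub>v x = (Y *\<^sub>v b) @\<^sub>v (W *\<^sub>v a)"
    unfolding ab(3) using Y W ab by (subst four_block_mat_mult_vec[of _ p r _ s _ q]) auto
  hence "(vec_norm2 (four_block_mat (0\<^sub>m p r) Y W (0\<^sub>m q s) *\<^sub>v x))\<^sup>2 = (vec_norm2 (Y *\<^sub>v b))\<^sup>2 + (vec_norm2 (W *\<^sub>v a))\<^sup>2"
    by (simp only: vec_norm2_append)
  also have "\<dots> \<le> (?M * vec_norm2 b)\<^sup>2 + (?M * vec_norm2 a)\<^sup>2"
  proof (intro add_mono power_mono)
    show "vec_norm2 (Y *\<^sub>v b) \<le> ?M * vec_norm2 b"
      by (rule order.trans[OF vec_norm2_mult_mat_vec_le[OF Y ab(2)] mult_right_mono]) auto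
    show "vec_norm2 (W *\<^sub>v a) \<le> ?M * vec_norm2 a"
      by (rule order.trans[OF vec_norm2_mult_mat_vec_le[OF W ab(1)] mult_right_mono]) auto
  qed auto
  also have "\<dots> = (?M * vec_norm2 x)\<^sup>2"
    unfolding ab(3) power_mult_distrib vec_norm2_append by (simp add: algebra_simps)
  finally show "vec_norm2 (four_block_mat (0\<^sub>m p r) Y W (0\<^sub>m q s) *\<^sub>v x) \<le> ?M * vec_norm2 x"
    by (rule power2_le_imp_le) (use M in simp)
qed

lemma four_block_mat_offdiag_inject:
  assumes "A \<in> carrier_mat n1 m1" "B \<in> carrier_mat n1 m2" "C \<in> carrier_mat n2 m1" "D \<in> carrier_mat n2 m2"
    and "A' \<in> carrier_mat n1 m1" "B' \<in> carrier_mat n1 m2" "C' \<in> carrier_mat n2 m1" "D' \<in> carrier_mat n2 m2"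
    and eq: "four_block_mat A B C D = four_block_mat A' B' C' D'"
  shows "B = B'" "C = C'"
proof -
  have e: "four_block_mat A B C D $$ (i, j) = four_block_mat A' B' C' D' $$ (i, j)" for i j by (simp only: eq)
  show "B = B'"
  proof (rule eq_matI)
    fix i j assume "i < dim_row B'" "j < dim_col B'"
    thus "B $$ (i, j) = B' $$ (i, j)" using e[of i "m1 + j"] assms(1-8) by auto
  qed (use assms in auto)
  show "C = C'"
  proof (rule eq_matI)
    fix i j assume "i < dim_row C'" "j < dim_col C'"
    thus "C $$ (i, j) = C' $$ (i, j)" using e[of "n1 + i" j] assms(1-8) by auto
  qed (use assms in auto)
qed

text \<open>The off-diagonal blocks of the Sylvester operator of two dilations are the two coupled equations, and
  they involve the diagonal blocks of the unknown only. This makes the diagonal blocks of any solution of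
  the large equation a solution of the coupled equations.\<close>

lemma sylvester_dilation_blocks:
  fixes A B :: "complex mat"
  assumes A: "A \<in> carrier_mat r r" and B: "B \<in> carrier_mat p q"
    and X: "X1 \<in> carrier_mat p r" "X2 \<in> carrier_mat p r" "X3 \<in> carrier_mat q r" "X4 \<in> carrier_mat q r"
  shows "four_block_mat X1 X2 X3 X4 * hermitian_dilation A - hermitian_dilation B * four_block_mat X1 X2 X3 X4 =
    four_block_mat (X2 * mat_adjoint A - B * X3) (X1 * A - B * X4)
      (X4 * mat_adjoint A - mat_adjoint B * X1) (X3 * A - mat_adjoint B * X2)"
proof -
  have 1: "four_block_mat X1 X2 X3 X4 * hermitian_dilation A =
      four_block_mat (X2 * mat_adjoint A) (X1 * A) (X4 * mat_adjoint A) (X3 * A)"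
    unfolding hermitian_dilation_def using A X
    by (subst mult_four_block_mat[of _ p r _ r _ q _ _ r _ r]) auto
  have 2: "hermitian_dilation B * four_block_mat X1 X2 X3 X4 =
      four_block_mat (B * X3) (B * X4) (mat_adjoint B * X1) (mat_adjoint B * X2)"
    unfolding hermitian_dilation_def using B X
    by (subst mult_four_block_mat[of _ p p _ q _ q _ _ r _ r]) auto
  show ?thesis unfolding 1 2 using A B X by (intro eq_matI) auto
qed

lemma coupled_sylvester_norm_le:
  fixes A B :: "complex mat"
  assumes A: "A \<in> carrier_mat r r" and B: "B \<in> carrier_mat p q"
    and P: "P \<in> carrier_mat (r + r) (r + r)" "unitary_mat P"
    and HP: "hermitian_dilation A * P = P * mat_diag (r + r) (\<lambda>i. complex_of_real (d i))"
    and Q: "Q \<in> carrier_mat (p + q) (p + q)" "unitary_mat Q"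
    and HQ: "hermitian_dilation B * Q = Q * mat_diag (p + q) (\<lambda>i. complex_of_real (e i))"
    and gap: "\<And>i j. i < p + q \<Longrightarrow> j < r + r \<Longrightarrow> \<bar>d j - e i\<bar> \<ge> \<delta>" and \<delta>: "\<delta> > 0"
    and X: "\<Gamma> \<in> carrier_mat p r" "\<Omega> \<in> carrier_mat q r"
  shows "max (spectral_norm \<Gamma>) (spectral_norm \<Omega>) \<le> pi / (2 * \<delta>) *
    max (spectral_norm (\<Gamma> * A - B * \<Omega>)) (spectral_norm (\<Omega> * mat_adjoint A - mat_adjoint B * \<Gamma>))"
proof -
  let ?X = "four_block_mat \<Gamma> (0\<^sub>m p r) (0\<^sub>m q r) \<Omega>"
  let ?Y = "\<Gamma> * A - B * \<Omega>" and ?W = "\<Omega> * mat_adjoint A - mat_adjoint B * \<Gamma>"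
  have "max (spectral_norm \<Gamma>) (spectral_norm \<Omega>) \<le> spectral_norm ?X"
    using spectral_norm_block_diag_ge[OF X] by simp
  also have "\<dots> \<le> pi / (2 * \<delta>) * spectral_norm (?X * hermitian_dilation A - hermitian_dilation B * ?X)"
    by (rule sylvester_norm_le[OF hermitian_dilation_carrier[OF A] hermitian_dilation_carrier[OF B]
        mat_adjoint_hermitian_dilation P HP Q HQ gap \<delta>]) (use X in auto)
  also have "?X * hermitian_dilation A - hermitian_dilation B * ?X = four_block_mat (0\<^sub>m p r) ?Y ?W (0\<^sub>m q r)"
    using A B X by (subst sylvester_dilation_blocks[OF A B X(1) _ _ X(2)]) auto
  also have "pi / (2 * \<delta>) * spectral_norm \<dots> \<le> pi / (2 * \<delta>) * max (spectral_norm ?Y) (spectral_norm ?W)"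
    using A B X \<delta> by (intro mult_left_mono spectral_norm_block_antidiag_le minus_carrier_mat) auto
  finally show ?thesis .
qed

lemma coupled_sylvester_solvable:
  fixes A B :: "complex mat"
  assumes A: "A \<in> carrier_mat r r" and B: "B \<in> carrier_mat p q"
    and P: "P \<in> carrier_mat (r + r) (r + r)" "unitary_mat P"
    and HP: "hermitian_dilation A * P = P * mat_diag (r + r) (\<lambda>i. complex_of_real (d i))"
    and Q: "Q \<in> carrier_mat (p + q) (p + q)" "unitary_mat Q"
    and HQ: "hermitian_dilation B * Q = Q * mat_diag (p + q) (\<lambda>i. complex_of_real (e i))"
    and gap: "\<And>i j. i < p + q \<Longrightarrow> j < r + r \<Longrightarrow> d j \<noteq> e i"
    and Y: "Y \<in> carrier_mat p r" "W \<in> carrier_mat q r"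
  shows "\<exists>\<Gamma>\<in>carrier_mat p r. \<exists>\<Omega>\<in>carrier_mat q r.
    \<Gamma> * A - B * \<Omega> = Y \<and> \<Omega> * mat_adjoint A - mat_adjoint B * \<Gamma> = W"
proof -
  let ?Y = "four_block_mat (0\<^sub>m p r) Y W (0\<^sub>m q r)"
  have "?Y \<in> carrier_mat (p + q) (r + r)" by simp
  then obtain X where X: "X \<in> carrier_mat (p + q) (r + r)"
    and eq: "X * hermitian_dilation A - hermitian_dilation B * X = ?Y"
    using sylvester_solvable[OF hermitian_dilation_carrier[OF A] hermitian_dilation_carrier[OF B]
        mat_adjoint_hermitian_dilation P HP Q HQ gap, of ?Y] by blast
  obtain X1 X2 X3 X4 where s: "split_block X p r = (X1, X2, X3, X4)" by (cases "split_block X p r") auto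
  have "dim_row X = p + q" "dim_col X = r + r" using X by auto
  note Xs = split_block[OF s this]
  have "X1 * A - B * X4 = Y" "X4 * mat_adjoint A - mat_adjoint B * X1 = W"
    using eq unfolding Xs(5) sylvester_dilation_blocks[OF A B Xs(1-4)]
    by (rule four_block_mat_offdiag_inject[rotated 8, of _ _ _ _ _ _ _ _ p r r q];
        use A B Xs(1-4) Y in \<open>auto intro!: minus_carrier_mat\<close>)+
  thus ?thesis using Xs(1,4) by blast
qed

text \<open>On vectors with vanishing first half the dilation of \<open>G\<close> acts as \<open>G\<close>.\<close>

lemma spectral_norm_le_sigma_max:
  assumes G: "G \<in> carrier_mat p q" and pq: "p \<ge> 1" "q \<ge> 1"
  shows "spectral_norm G \<le> sigma_max G"
proof -
  have mx: "sigma_max G \<in># sv G" using G pq by (intro sigma_max_in_sv) auto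
  have c: "sigma_max G \<ge> 0" by (rule sv_nonneg[OF mx])
  obtain P d where P: "P \<in> carrier_mat (p + q) (p + q)" "unitary_mat P"
    and HP: "hermitian_dilation G * P = P * mat_diag (p + q) (\<lambda>i. complex_of_real (d i))"
    and d: "\<And>i. i < p + q \<Longrightarrow> \<bar>d i\<bar> \<in># sv_ext G"
    using hermitian_dilation_diagonalization[OF G] by blast
  have d_le: "\<bar>d i\<bar> \<le> sigma_max G" if "i < p + q" for i
    using d[OF that] c sv_le_sigma_max[of _ G] by (auto simp: sv_ext_def split: if_splits)
  show ?thesis
  proof (rule spectral_norm_leI[OF G c])
    fix b :: "complex vec" assume b: "b \<in> carrier_vec q"
    have "vec_norm2 (hermitian_dilation G *\<^sub>v (0\<^sub>v p @\<^sub>v b)) \<le> sigma_max G * vec_norm2 (0\<^sub>v p @\<^sub>v b)"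
      using b by (intro hermitian_norm_le[OF hermitian_dilation_carrier[OF G] P HP _ c d_le]) auto
    also have "vec_norm2 (0\<^sub>v p @\<^sub>v b) = vec_norm2 b"
      using vec_norm2_append[of "0\<^sub>v p" b] by (simp add: power2_eq_iff_nonneg)
    also have "vec_norm2 (hermitian_dilation G *\<^sub>v (0\<^sub>v p @\<^sub>v b)) \<ge> vec_norm2 (G *\<^sub>v b)"
      unfolding hermitian_dilation_mult_vec[OF G zero_carrier_vec b]
      by (rule power2_le_imp_le) (simp_all add: vec_norm2_append)
    finally show "vec_norm2 (G *\<^sub>v b) \<le> sigma_max G * vec_norm2 b" by simp
  qed
qed

text \<open>The dilation of \<open>G\<close> acts as \<open>G\<close> on one half of the space and as \<open>G\<^sup>H\<close> on the other, so that one lower bound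
  for the dilation serves both.\<close>

lemma sigma_min_le_norm:
  assumes G: "G \<in> carrier_mat r r" and r: "r \<ge> 1" and x: "x \<in> carrier_vec r"
  shows "sigma_min G * vec_norm2 x \<le> vec_norm2 (G *\<^sub>v x)"
    "sigma_min G * vec_norm2 x \<le> vec_norm2 (mat_adjoint G *\<^sub>v x)"
proof -
  have c: "sigma_min G \<ge> 0" using G r by (intro sv_nonneg[OF sigma_min_in_sv]) auto
  note H = hermitian_dilation_carrier[OF G]
  obtain P d where P: "P \<in> carrier_mat (r + r) (r + r)" "unitary_mat P"
    and HP: "hermitian_dilation G * P = P * mat_diag (r + r) (\<lambda>i. complex_of_real (d i))"
    and d: "\<And>i. i < r + r \<Longrightarrow> \<bar>d i\<bar> \<in># sv_ext G"
    using hermitian_dilation_diagonalization[OF G] by blast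
  have d_ge: "sigma_min G \<le> \<bar>d i - 0\<bar>" if "i < r + r" for i
    using d[OF that] G sigma_min_le_sv[of "\<bar>d i\<bar>" G] by (simp add: sv_ext_def)
  have ge: "sigma_min G * vec_norm2 y \<le> vec_norm2 (hermitian_dilation G *\<^sub>v y)" if y: "y \<in> carrier_vec (r + r)" for y
  proof -
    have "sigma_min G * vec_norm2 y \<le> vec_norm2 (hermitian_dilation G *\<^sub>v y - complex_of_real 0 \<cdot>\<^sub>v y)"
      by (rule hermitian_shift_norm_ge[OF H P HP y c d_ge])
    also have "hermitian_dilation G *\<^sub>v y - complex_of_real 0 \<cdot>\<^sub>v y = hermitian_dilation G *\<^sub>v y"
      using H y by (intro eq_vecI) auto
    finally show ?thesis .
  qed
  have z: "K *\<^sub>v 0\<^sub>v r = 0\<^sub>v r" if "K \<in> carrier_mat r r" for K :: "complex mat"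
    using that by (intro eq_vecI) auto
  have eq: "vec_norm2 (a @\<^sub>v b) = sqrt ((vec_norm2 a)\<^sup>2 + (vec_norm2 b)\<^sup>2)" for a b
    using vec_norm2_append[of a b] by (metis real_sqrt_abs abs_of_nonneg vec_norm2_nonneg)
  show "sigma_min G * vec_norm2 x \<le> vec_norm2 (G *\<^sub>v x)"
    using ge[of "0\<^sub>v r @\<^sub>v x"] x G unfolding hermitian_dilation_mult_vec[OF G zero_carrier_vec x]
    by (simp add: eq z)
  show "sigma_min G * vec_norm2 x \<le> vec_norm2 (mat_adjoint G *\<^sub>v x)"
    using ge[of "x @\<^sub>v 0\<^sub>v r"] x G unfolding hermitian_dilation_mult_vec[OF G x zero_carrier_vec]
    by (simp add: eq z)
qed

lemma spectral_norm_mult_ge_left: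
  assumes A: "A \<in> carrier_mat r r" and X: "X \<in> carrier_mat r k" and s: "s > 0"
    and below: "\<And>x. x \<in> carrier_vec r \<Longrightarrow> s * vec_norm2 x \<le> vec_norm2 (A *\<^sub>v x)"
  shows "s * spectral_norm X \<le> spectral_norm (A * X)"
proof -
  have "spectral_norm X \<le> spectral_norm (A * X) / s"
  proof (rule spectral_norm_leI[OF X])
    fix v :: "complex vec" assume v: "v \<in> carrier_vec k"
    have "s * vec_norm2 (X *\<^sub>v v) \<le> vec_norm2 (A *\<^sub>v (X *\<^sub>v v))" using X v by (intro below) auto
    also have "\<dots> = vec_norm2 ((A * X) *\<^sub>v v)" using A X v by (simp add: assoc_mult_mat_vec)
    also have "\<dots> \<le> spectral_norm (A * X) * vec_norm2 v"
      using A X v by (intro vec_norm2_mult_mat_vec_le) auto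
    finally show "vec_norm2 (X *\<^sub>v v) \<le> spectral_norm (A * X) / s * vec_norm2 v"
      using s by (simp add: field_simps)
  qed (use s in simp)
  thus ?thesis using s by (simp add: field_simps)
qed

lemma spectral_norm_mult_ge_right:
  assumes A: "A \<in> carrier_mat r r" and X: "X \<in> carrier_mat k r" and s: "s > 0"
    and below: "\<And>x. x \<in> carrier_vec r \<Longrightarrow> s * vec_norm2 x \<le> vec_norm2 (mat_adjoint A *\<^sub>v x)"
  shows "s * spectral_norm X \<le> spectral_norm (X * A)"
  using spectral_norm_mult_ge_left[of "mat_adjoint A" r "mat_adjoint X" k s] A X s below
    spectral_norm_adjoint[of "X * A"]
  by (simp add: mat_adjoint_mult[of X k r A r] del: spectral_norm_adjoint)
     (simp)

text \<open>Use the equation in which the larger of the two unknowns is multiplied by \<open>A\<close> or its adjoint: that term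
  has at least \<open>s\<close> times the norm of this unknown, and the other one at most \<open>t\<close> times.\<close>

lemma coupled_sylvester_norm_le_separated:
  fixes A B :: "complex mat"
  assumes A: "A \<in> carrier_mat r r" and B: "B \<in> carrier_mat p q"
    and belowA: "\<And>x. x \<in> carrier_vec r \<Longrightarrow> s * vec_norm2 x \<le> vec_norm2 (A *\<^sub>v x)"
    and belowA': "\<And>x. x \<in> carrier_vec r \<Longrightarrow> s * vec_norm2 x \<le> vec_norm2 (mat_adjoint A *\<^sub>v x)"
    and aboveB: "spectral_norm B \<le> t" and st: "\<delta> \<le> s - t" and \<delta>: "\<delta> > 0"
    and X: "\<Gamma> \<in> carrier_mat p r" "\<Omega> \<in> carrier_mat q r"
  shows "max (spectral_norm \<Gamma>) (spectral_norm \<Omega>) \<le> 1 / \<delta> *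
    max (spectral_norm (\<Gamma> * A - B * \<Omega>)) (spectral_norm (\<Omega> * mat_adjoint A - mat_adjoint B * \<Gamma>))"
proof -
  have t: "t \<ge> 0" using aboveB spectral_norm_nonneg[of B] by linarith
  have s: "s > 0" using st \<delta> t by linarith
  have key: "\<delta> * spectral_norm X1 \<le> spectral_norm (X1 * A1 - B1 * X2)"
    if A1: "A1 \<in> carrier_mat r r" and B1: "B1 \<in> carrier_mat k l" "spectral_norm B1 \<le> t"
      and X1: "X1 \<in> carrier_mat k r" and X2: "X2 \<in> carrier_mat l r"
      and le: "spectral_norm X2 \<le> spectral_norm X1"
      and below: "\<And>x. x \<in> carrier_vec r \<Longrightarrow> s * vec_norm2 x \<le> vec_norm2 (mat_adjoint A1 *\<^sub>v x)"
    for A1 B1 X1 X2 k l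
  proof -
    have XA: "X1 * A1 \<in> carrier_mat k r" and BX: "B1 * X2 \<in> carrier_mat k r" using A1 B1 X1 X2 by auto
    have "s * spectral_norm X1 \<le> spectral_norm (X1 * A1)"
      by (rule spectral_norm_mult_ge_right[OF A1 X1 s below])
    also have "X1 * A1 = (X1 * A1 - B1 * X2) + B1 * X2" using A1 B1 X1 X2 by (intro eq_matI) auto
    also have "spectral_norm \<dots> \<le> spectral_norm (X1 * A1 - B1 * X2) + spectral_norm (B1 * X2)"
      using XA BX by (intro spectral_norm_add[of _ k r] minus_carrier_mat)
    also have "spectral_norm (B1 * X2) \<le> t * spectral_norm X1"
      by (rule order.trans[OF spectral_norm_mult[OF B1(1) X2] mult_mono[OF B1(2) le t]]) simp
    finally have "(s - t) * spectral_norm X1 \<le> spectral_norm (X1 * A1 - B1 * X2)"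
      by (simp add: algebra_simps)
    moreover have "\<delta> * spectral_norm X1 \<le> (s - t) * spectral_norm X1"
      using st by (intro mult_right_mono) auto
    ultimately show ?thesis by linarith
  qed
  have "\<delta> * max (spectral_norm \<Gamma>) (spectral_norm \<Omega>) \<le>
      max (spectral_norm (\<Gamma> * A - B * \<Omega>)) (spectral_norm (\<Omega> * mat_adjoint A - mat_adjoint B * \<Gamma>))"
  proof (cases "spectral_norm \<Omega> \<le> spectral_norm \<Gamma>")
    case True
    with key[OF A B aboveB X True belowA'] show ?thesis by (simp add: max_absorb1 le_max_iff_disj)
  next
    case False
    hence le: "spectral_norm \<Gamma> \<le> spectral_norm \<Omega>" by simp
    have "\<delta> * spectral_norm \<Omega> \<le> spectral_norm (\<Omega> * mat_adjoint A - mat_adjoint B * \<Gamma>)"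
      using A B aboveB belowA by (intro key[OF _ _ _ X(2,1) le]) auto
    thus ?thesis using le by (simp add: max_absorb2 le_max_iff_disj)
  qed
  hence "max (spectral_norm \<Gamma>) (spectral_norm \<Omega>) \<le>
      max (spectral_norm (\<Gamma> * A - B * \<Omega>)) (spectral_norm (\<Omega> * mat_adjoint A - mat_adjoint B * \<Gamma>)) / \<delta>"
    by (simp only: pos_le_divide_eq[OF \<delta>] mult.commute)
  thus ?thesis by (simp only: times_divide_eq_left mult_1)
qed

section \<open>Small solutions of quadratic systems\<close>

text \<open>The carrier of matrices with fixed dimensions is not a type, so limits of matrices are taken entry by
  entry.\<close>

definition entrywise_tendsto :: "nat \<Rightarrow> nat \<Rightarrow> (nat \<Rightarrow> complex mat) \<Rightarrow> complex mat \<Rightarrow> bool" where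
  "entrywise_tendsto n m X L \<longleftrightarrow> (\<forall>k. X k \<in> carrier_mat n m) \<and> L \<in> carrier_mat n m \<and>
     (\<forall>i<n. \<forall>j<m. (\<lambda>k. X k $$ (i, j)) \<longlonglongrightarrow> L $$ (i, j))"

lemma entrywise_tendsto_const: "A \<in> carrier_mat n m \<Longrightarrow> entrywise_tendsto n m (\<lambda>_. A) A"
  by (simp add: entrywise_tendsto_def)

lemma entrywise_tendsto_minus:
  assumes "entrywise_tendsto n m X K" "entrywise_tendsto n m Y L"
  shows "entrywise_tendsto n m (\<lambda>k. X k - Y k) (K - L)"
proof -
  have "(\<lambda>k. (X k - Y k) $$ (i, j)) \<longlonglongrightarrow> (K - L) $$ (i, j)" if ij: "i < n" "j < m" for i j
  proof -
    have "(\<lambda>k. X k $$ (i, j) - Y k $$ (i, j)) \<longlonglongrightarrow> K $$ (i, j) - L $$ (i, j)"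
      using assms ij by (intro tendsto_diff) (auto simp: entrywise_tendsto_def)
    moreover have "(X k - Y k) $$ (i, j) = X k $$ (i, j) - Y k $$ (i, j)" for k
    proof -
      have "Y k \<in> carrier_mat n m" using assms by (simp add: entrywise_tendsto_def)
      thus ?thesis using ij by (intro index_minus_mat) auto
    qed
    moreover have "(K - L) $$ (i, j) = K $$ (i, j) - L $$ (i, j)"
    proof -
      have "L \<in> carrier_mat n m" using assms by (simp add: entrywise_tendsto_def)
      thus ?thesis using ij by (intro index_minus_mat) auto
    qed
    ultimately show ?thesis by simp
  qed
  thus ?thesis using assms by (auto simp: entrywise_tendsto_def intro!: minus_carrier_mat)
qed

lemma entrywise_tendsto_mult:
  assumes "entrywise_tendsto n l X K" "entrywise_tendsto l m Y L"
  shows "entrywise_tendsto n m (\<lambda>k. X k * Y k) (K * L)"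
proof -
  have entry: "(M * N) $$ (i, j) = (\<Sum>h\<in>{0..<l}. M $$ (i, h) * N $$ (h, j))"
    if "M \<in> carrier_mat n l" "N \<in> carrier_mat l m" "i < n" "j < m" for i j and M N :: "complex mat"
    using that by (simp add: scalar_prod_def)
  have "(\<lambda>k. (X k * Y k) $$ (i, j)) \<longlonglongrightarrow> (K * L) $$ (i, j)" if ij: "i < n" "j < m" for i j
  proof -
    have "(\<lambda>k. \<Sum>h\<in>{0..<l}. X k $$ (i, h) * Y k $$ (h, j)) \<longlonglongrightarrow> (\<Sum>h\<in>{0..<l}. K $$ (i, h) * L $$ (h, j))"
      using assms ij by (intro tendsto_sum tendsto_mult) (auto simp: entrywise_tendsto_def)
    moreover have "(X k * Y k) $$ (i, j) = (\<Sum>h\<in>{0..<l}. X k $$ (i, h) * Y k $$ (h, j))" for k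
      using assms ij by (intro entry) (auto simp: entrywise_tendsto_def)
    moreover have "(K * L) $$ (i, j) = (\<Sum>h\<in>{0..<l}. K $$ (i, h) * L $$ (h, j))"
      using assms ij by (intro entry) (auto simp: entrywise_tendsto_def)
    ultimately show ?thesis by simp
  qed
  thus ?thesis using assms by (auto simp: entrywise_tendsto_def intro!: mult_carrier_mat)
qed

lemma entrywise_tendsto_Suc: "entrywise_tendsto n m X L \<Longrightarrow> entrywise_tendsto n m (\<lambda>k. X (Suc k)) L"
  unfolding entrywise_tendsto_def by (auto intro: LIMSEQ_Suc)

lemma entrywise_tendsto_unique:
  assumes "entrywise_tendsto n m X K" "entrywise_tendsto n m X L"
  shows "K = L"
proof (rule eq_matI)
  fix i j assume "i < dim_row L" "j < dim_col L"
  hence "i < n" "j < m" using assms by (auto simp: entrywise_tendsto_def)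
  thus "K $$ (i, j) = L $$ (i, j)" using assms unfolding entrywise_tendsto_def by (meson LIMSEQ_unique)
qed (use assms in \<open>auto simp: entrywise_tendsto_def\<close>)

lemma spectral_norm_entrywise_limit_le:
  assumes X: "entrywise_tendsto n m X L" and b: "\<And>k. spectral_norm (X k) \<le> b"
  shows "spectral_norm L \<le> b"
proof (rule spectral_norm_leI)
  have Xk: "X k \<in> carrier_mat n m" for k using X by (simp add: entrywise_tendsto_def)
  show L: "L \<in> carrier_mat n m" using X by (simp add: entrywise_tendsto_def)
  show "b \<ge> 0" using b[of 0] spectral_norm_nonneg[of "X 0"] by linarith
  fix v :: "complex vec" assume v: "v \<in> carrier_vec m"
  have norm: "vec_norm2 (M *\<^sub>v v) = sqrt (\<Sum>i<n. (cmod (\<Sum>j\<in>{0..<m}. M $$ (i, j) * v $ j))\<^sup>2)"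
    if "M \<in> carrier_mat n m" for M
    using that v by (simp add: vec_norm2_def scalar_prod_def)
  have "(\<lambda>k. vec_norm2 (X k *\<^sub>v v)) \<longlonglongrightarrow> vec_norm2 (L *\<^sub>v v)"
    unfolding norm[OF Xk] norm[OF L] using X
    by (intro tendsto_intros) (auto simp: entrywise_tendsto_def)
  moreover have "vec_norm2 (X k *\<^sub>v v) \<le> b * vec_norm2 v" for k
    by (rule order.trans[OF vec_norm2_mult_mat_vec_le[OF Xk v] mult_right_mono[OF b]]) simp
  ultimately show "vec_norm2 (L *\<^sub>v v) \<le> b * vec_norm2 v"
    by (intro LIMSEQ_le_const2) auto
qed

lemma geometric_increments_convergent:
  fixes f :: "nat \<Rightarrow> complex"
  assumes "\<And>k. cmod (f (Suc k) - f k) \<le> K * q ^ k" "0 \<le> q" "q < 1"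
  shows "convergent f"
proof -
  have "summable (\<lambda>k. f (Suc k) - f k)"
    using assms by (intro summable_comparison_test[OF _ summable_mult[OF summable_geometric[of q]]]) auto
  hence "(\<lambda>n. \<Sum>k<n. f (Suc k) - f k) \<longlonglongrightarrow> (\<Sum>k. f (Suc k) - f k)" by (rule summable_LIMSEQ)
  hence "(\<lambda>n. (f n - f 0) + f 0) \<longlonglongrightarrow> (\<Sum>k. f (Suc k) - f k) + f 0"
    unfolding sum_lessThan_telescope by (intro tendsto_add tendsto_const)
  thus ?thesis by (auto simp: convergent_def)
qed

lemma entrywise_tendsto_geometric:
  assumes X: "\<And>k. X k \<in> carrier_mat n m"
    and inc: "\<And>k. spectral_norm (X (Suc k) - X k) \<le> K * q ^ k" and q: "0 \<le> q" "q < 1"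
  shows "\<exists>L. entrywise_tendsto n m X L"
proof -
  define L where "L = mat n m (\<lambda>(i, j). lim (\<lambda>k. X k $$ (i, j)))"
  have "(\<lambda>k. X k $$ (i, j)) \<longlonglongrightarrow> L $$ (i, j)" if ij: "i < n" "j < m" for i j
  proof -
    have "cmod (X (Suc k) $$ (i, j) - X k $$ (i, j)) \<le> K * q ^ k" for k
    proof -
      have d: "i < dim_row (X k)" "j < dim_col (X k)" using X[of k] ij by auto
      hence "cmod ((X (Suc k) - X k) $$ (i, j)) \<le> spectral_norm (X (Suc k) - X k)"
        by (intro cmod_index_le_spectral_norm) auto
      also have "(X (Suc k) - X k) $$ (i, j) = X (Suc k) $$ (i, j) - X k $$ (i, j)"
        using d by (rule index_minus_mat)
      finally show ?thesis using inc[of k] by linarith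
    qed
    hence "convergent (\<lambda>k. X k $$ (i, j))" using q by (rule geometric_increments_convergent)
    thus ?thesis using ij by (simp add: L_def convergent_LIMSEQ_iff)
  qed
  moreover have "L \<in> carrier_mat n m" by (simp add: L_def)
  ultimately have "entrywise_tendsto n m X L" using X by (simp add: entrywise_tendsto_def)
  thus ?thesis by blast
qed

lemma spectral_norm_triple_le:
  assumes "X \<in> carrier_mat a b" "C \<in> carrier_mat b d" "Y \<in> carrier_mat d e"
    and "spectral_norm X \<le> x" "spectral_norm C \<le> c" "spectral_norm Y \<le> y"
  shows "spectral_norm (X * C * Y) \<le> x * c * y"
proof -
  have nn: "0 \<le> spectral_norm X" "0 \<le> spectral_norm C" "0 \<le> spectral_norm Y" by simp_all
  have "spectral_norm (X * C * Y) \<le> spectral_norm (X * C) * spectral_norm Y"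
    using assms by (intro spectral_norm_mult) auto
  also have "\<dots> \<le> (spectral_norm X * spectral_norm C) * spectral_norm Y"
    using assms(1,2) by (intro mult_right_mono spectral_norm_mult) auto
  also have "\<dots> \<le> x * c * y"
    using order.trans[OF nn(1) assms(4)] order.trans[OF nn(2) assms(5)] assms(4-6)
    by (intro mult_mono mult_nonneg_nonneg) auto
  finally show ?thesis .
qed

lemma spectral_norm_triple_diff_le:
  assumes X: "X \<in> carrier_mat a b" "X' \<in> carrier_mat a b" and C: "C \<in> carrier_mat b d"
    and Y: "Y \<in> carrier_mat d e" "Y' \<in> carrier_mat d e"
    and "spectral_norm X \<le> t" "spectral_norm C \<le> c" "spectral_norm Y' \<le> t"
    and "spectral_norm (X' - X) \<le> h" "spectral_norm (Y' - Y) \<le> h"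
  shows "spectral_norm (X' * C * Y' - X * C * Y) \<le> 2 * t * c * h"
proof -
  have XC: "X * C \<in> carrier_mat a d" "X' * C \<in> carrier_mat a d" using X C by auto
  have "(X' - X) * C * Y' = X' * C * Y' - X * C * Y'"
    using X C Y XC by (simp add: minus_mult_distrib_mat[of _ a b _ _ d] minus_mult_distrib_mat[of _ a d _ _ e])
  moreover have "X * C * (Y' - Y) = X * C * Y' - X * C * Y"
    using XC Y by (simp add: mult_minus_distrib_mat[of _ a d _ e])
  moreover have "X' * C * Y' - X * C * Y = (X' * C * Y' - X * C * Y') + (X * C * Y' - X * C * Y)"
    using XC Y by (intro eq_matI) auto
  ultimately have "X' * C * Y' - X * C * Y = (X' - X) * C * Y' + X * C * (Y' - Y)" by simp
  also have "spectral_norm \<dots> \<le> spectral_norm ((X' - X) * C * Y') + spectral_norm (X * C * (Y' - Y))"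
    using X C Y by (intro spectral_norm_add[of _ a e] mult_carrier_mat[of _ a d] mult_carrier_mat[of _ a b] minus_carrier_mat) auto
  also have "\<dots> \<le> h * c * t + t * c * h"
    using assms by (intro add_mono spectral_norm_triple_le[of _ a b _ d _ e] minus_carrier_mat) auto
  finally show ?thesis by (simp add: mult_ac)
qed

text \<open>Solve the linear system repeatedly, with the quadratic term of the previous iterate on the right-hand
  side. All iterates stay in the ball of radius \<open>b\<close> because \<open>c (\<epsilon> + b \<epsilon> b) = b\<close>. The difference of two quadratic
  terms is at most \<open>2 b \<epsilon>\<close> times the difference of the arguments, so the increments shrink by the factor
  \<open>c (2 b \<epsilon>) = 1 - s\<close> with \<open>s = sqrt (1 - 4 (c \<epsilon>)\<^sup>2) > 0\<close>. Hence the iterates converge, and their limit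
  solves the system.\<close>

lemma quadratic_system_solvable:
  fixes A A' B B' R1 R2 C1 C2 :: "complex mat" and c \<epsilon> :: real
  assumes A: "A \<in> carrier_mat r r" "A' \<in> carrier_mat r r"
    and B: "B \<in> carrier_mat p q" "B' \<in> carrier_mat q p"
    and R: "R1 \<in> carrier_mat p r" "R2 \<in> carrier_mat q r"
    and C: "C1 \<in> carrier_mat r q" "C2 \<in> carrier_mat r p"
    and solv: "\<And>Y W. Y \<in> carrier_mat p r \<Longrightarrow> W \<in> carrier_mat q r \<Longrightarrow>
      \<exists>\<Gamma>\<in>carrier_mat p r. \<exists>\<Omega>\<in>carrier_mat q r. \<Gamma> * A - B * \<Omega> = Y \<and> \<Omega> * A' - B' * \<Gamma> = W"
    and bound: "\<And>\<Gamma> \<Omega>. \<Gamma> \<in> carrier_mat p r \<Longrightarrow> \<Omega> \<in> carrier_mat q r \<Longrightarrow>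
      max (spectral_norm \<Gamma>) (spectral_norm \<Omega>) \<le>
        c * max (spectral_norm (\<Gamma> * A - B * \<Omega>)) (spectral_norm (\<Omega> * A' - B' * \<Gamma>))"
    and norms: "spectral_norm R1 \<le> \<epsilon>" "spectral_norm R2 \<le> \<epsilon>" "spectral_norm C1 \<le> \<epsilon>" "spectral_norm C2 \<le> \<epsilon>"
    and c: "c > 0" and small: "4 * (c * \<epsilon>)\<^sup>2 < 1"
  shows "\<exists>\<Gamma>\<in>carrier_mat p r. \<exists>\<Omega>\<in>carrier_mat q r.
    \<Gamma> * A - B * \<Omega> = R1 - \<Gamma> * C1 * \<Omega> \<and> \<Omega> * A' - B' * \<Gamma> = R2 - \<Omega> * C2 * \<Gamma> \<and>
    max (spectral_norm \<Gamma>) (spectral_norm \<Omega>) \<le> 2 * (c * \<epsilon>) / (1 + sqrt (1 - 4 * (c * \<epsilon>)\<^sup>2))"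
proof -
  define s where "s = sqrt (1 - 4 * (c * \<epsilon>)\<^sup>2)"
  define b where "b = 2 * (c * \<epsilon>) / (1 + s)"
  define \<rho> where "\<rho> = 1 - s"
  have \<epsilon>: "\<epsilon> \<ge> 0" using norms(1) spectral_norm_nonneg[of R1] by linarith
  have s: "0 < s" "s \<le> 1" "s\<^sup>2 = 1 - 4 * (c * \<epsilon>)\<^sup>2" using small by (simp_all add: s_def)
  have b: "b \<ge> 0" using c \<epsilon> s by (simp add: b_def)
  have sb: "(1 + s) * b = 2 * (c * \<epsilon>)" using s by (simp add: b_def)
  have b_fixed: "c * (\<epsilon> + b * \<epsilon> * b) = b"
  proof -
    have "(1 + s)\<^sup>2 * (c * (\<epsilon> + b * \<epsilon> * b)) = c * \<epsilon> * ((1 + s)\<^sup>2 + ((1 + s) * b)\<^sup>2)"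
      by (simp add: power2_eq_square algebra_simps)
    also have "\<dots> = c * \<epsilon> * (1 + 2 * s + s\<^sup>2 + 4 * (c * \<epsilon>)\<^sup>2)"
      unfolding sb by (simp add: power2_eq_square algebra_simps)
    also have "\<dots> = (1 + s) * (2 * (c * \<epsilon>))" unfolding s(3) by (simp add: algebra_simps)
    also have "\<dots> = (1 + s)\<^sup>2 * b" unfolding sb[symmetric] by (simp add: power2_eq_square)
    finally show ?thesis using s by simp
  qed
  have \<rho>: "0 \<le> \<rho>" "\<rho> < 1" using s by (simp_all add: \<rho>_def)
  have \<rho>_eq: "c * (2 * b * \<epsilon>) = \<rho>"
  proof -
    have "(1 + s) * (c * (2 * b * \<epsilon>)) = 2 * (c * \<epsilon>) * ((1 + s) * b)" by (simp add: algebra_simps)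
    also have "\<dots> = 4 * (c * \<epsilon>)\<^sup>2" unfolding sb by (simp add: power2_eq_square)
    also have "\<dots> = 1 - s\<^sup>2" unfolding s(3) by simp
    also have "\<dots> = (1 + s) * \<rho>" by (simp add: \<rho>_def algebra_simps power2_eq_square)
    finally show ?thesis using s by simp
  qed
  define Sol where "Sol Y W = (SOME x. fst x \<in> carrier_mat p r \<and> snd x \<in> carrier_mat q r \<and>
    fst x * A - B * snd x = Y \<and> snd x * A' - B' * fst x = W)" for Y W
  have Sol: "fst (Sol Y W) \<in> carrier_mat p r \<and> snd (Sol Y W) \<in> carrier_mat q r \<and>
    fst (Sol Y W) * A - B * snd (Sol Y W) = Y \<and> snd (Sol Y W) * A' - B' * fst (Sol Y W) = W"
    if YW: "Y \<in> carrier_mat p r" "W \<in> carrier_mat q r" for Y W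
    unfolding Sol_def
  proof (rule someI_ex)
    obtain G O' where "G \<in> carrier_mat p r" "O' \<in> carrier_mat q r" "G * A - B * O' = Y" "O' * A' - B' * G = W"
      using solv[OF YW] by blast
    thus "\<exists>x. fst x \<in> carrier_mat p r \<and> snd x \<in> carrier_mat q r \<and> fst x * A - B * snd x = Y \<and> snd x * A' - B' * fst x = W"
      by (intro exI[of _ "(G, O')"]) simp
  qed
  define step where "step x = Sol (R1 - fst x * C1 * snd x) (R2 - snd x * C2 * fst x)" for x
  define X where "X k = (step ^^ k) (0\<^sub>m p r, 0\<^sub>m q r)" for k
  define \<Gamma> where "\<Gamma> k = fst (X k)" for k
  define \<Omega> where "\<Omega> k = snd (X k)" for k
  have X_Suc: "X (Suc k) = Sol (R1 - \<Gamma> k * C1 * \<Omega> k) (R2 - \<Omega> k * C2 * \<Gamma> k)" for k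
    by (simp add: X_def step_def \<Gamma>_def \<Omega>_def)
  have triple: "Y * C1 * W \<in> carrier_mat p r" "W * C2 * Y \<in> carrier_mat q r"
    if "Y \<in> carrier_mat p r" "W \<in> carrier_mat q r" for Y W
    using that C by auto
  have carr: "\<Gamma> k \<in> carrier_mat p r \<and> \<Omega> k \<in> carrier_mat q r" for k
  proof (induction k)
    case 0
    show ?case by (simp add: \<Gamma>_def \<Omega>_def X_def)
  next
    case (Suc k)
    have "R1 - \<Gamma> k * C1 * \<Omega> k \<in> carrier_mat p r" "R2 - \<Omega> k * C2 * \<Gamma> k \<in> carrier_mat q r"
      using Suc triple by (auto intro!: minus_carrier_mat)
    from Sol[OF this] show ?case unfolding \<Gamma>_def[of "Suc k"] \<Omega>_def[of "Suc k"] X_Suc by blast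
  qed
  hence \<Gamma>: "\<Gamma> k \<in> carrier_mat p r" and \<Omega>: "\<Omega> k \<in> carrier_mat q r" for k by auto
  note trip = triple[OF \<Gamma> \<Omega>]
  have eqs: "\<Gamma> (Suc k) * A - B * \<Omega> (Suc k) = R1 - \<Gamma> k * C1 * \<Omega> k"
    "\<Omega> (Suc k) * A' - B' * \<Gamma> (Suc k) = R2 - \<Omega> k * C2 * \<Gamma> k" for k
  proof -
    have "R1 - \<Gamma> k * C1 * \<Omega> k \<in> carrier_mat p r" "R2 - \<Omega> k * C2 * \<Gamma> k \<in> carrier_mat q r"
      using trip by (auto intro!: minus_carrier_mat)
    from Sol[OF this] show "\<Gamma> (Suc k) * A - B * \<Omega> (Suc k) = R1 - \<Gamma> k * C1 * \<Omega> k"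
      "\<Omega> (Suc k) * A' - B' * \<Gamma> (Suc k) = R2 - \<Omega> k * C2 * \<Gamma> k"
      unfolding \<Gamma>_def[of "Suc k"] \<Omega>_def[of "Suc k"] X_Suc by blast+
  qed
  have le_b: "max (spectral_norm (\<Gamma> k)) (spectral_norm (\<Omega> k)) \<le> b" for k
  proof (induction k)
    case 0
    show ?case using b by (simp add: \<Gamma>_def \<Omega>_def X_def)
  next
    case (Suc k)
    hence gb: "spectral_norm (\<Gamma> k) \<le> b" "spectral_norm (\<Omega> k) \<le> b" by auto
    have "spectral_norm (R1 - \<Gamma> k * C1 * \<Omega> k) \<le> \<epsilon> + b * \<epsilon> * b"
      by (rule order.trans[OF spectral_norm_minus[OF R(1) trip(1)]
            add_mono[OF norms(1) spectral_norm_triple_le[OF \<Gamma> C(1) \<Omega> gb(1) norms(3) gb(2)]]])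
    moreover have "spectral_norm (R2 - \<Omega> k * C2 * \<Gamma> k) \<le> \<epsilon> + b * \<epsilon> * b"
      by (rule order.trans[OF spectral_norm_minus[OF R(2) trip(2)]
            add_mono[OF norms(2) spectral_norm_triple_le[OF \<Omega> C(2) \<Gamma> gb(2) norms(4) gb(1)]]])
    ultimately have "c * max (spectral_norm (R1 - \<Gamma> k * C1 * \<Omega> k)) (spectral_norm (R2 - \<Omega> k * C2 * \<Gamma> k)) \<le> c * (\<epsilon> + b * \<epsilon> * b)"
      using c by (intro mult_left_mono) auto
    thus ?case using bound[OF \<Gamma> \<Omega>, of "Suc k" "Suc k"] unfolding eqs b_fixed by linarith
  qed
  hence gb: "spectral_norm (\<Gamma> k) \<le> b" "spectral_norm (\<Omega> k) \<le> b" for k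
    by (simp_all add: max.bounded_iff)
  have inc: "max (spectral_norm (\<Gamma> (Suc k) - \<Gamma> k)) (spectral_norm (\<Omega> (Suc k) - \<Omega> k)) \<le> b * \<rho> ^ k" for k
  proof (induction k)
    case 0
    have "\<Gamma> (Suc 0) - \<Gamma> 0 = \<Gamma> (Suc 0)" "\<Omega> (Suc 0) - \<Omega> 0 = \<Omega> (Suc 0)"
      using \<Gamma>[of "Suc 0"] \<Omega>[of "Suc 0"] by (auto simp: \<Gamma>_def[of 0] \<Omega>_def[of 0] X_def intro!: eq_matI)
    thus ?case using le_b[of "Suc 0"] by simp
  next
    case (Suc k)
    let ?h = "b * \<rho> ^ k"
    have h: "spectral_norm (\<Gamma> (Suc k) - \<Gamma> k) \<le> ?h" "spectral_norm (\<Omega> (Suc k) - \<Omega> k) \<le> ?h" using Suc by auto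
    \<comment> \<open>The linear part applied to an increment is minus the increment of the quadratic terms.\<close>
    have lin: "(Y' - Y) * K - D * (W' - W) = - (T' - T)"
      if "Y * K - D * W = S - T" "Y' * K - D * W' = S - T'"
        and "Y \<in> carrier_mat x y" "Y' \<in> carrier_mat x y" "K \<in> carrier_mat y y" "D \<in> carrier_mat x z"
        and "W \<in> carrier_mat z y" "W' \<in> carrier_mat z y" "S \<in> carrier_mat x y" "T \<in> carrier_mat x y" "T' \<in> carrier_mat x y"
      for Y Y' K D W W' S T T' :: "complex mat" and x y z
    proof -
      have "(Y' - Y) * K - D * (W' - W) = (Y' * K - Y * K) - (D * W' - D * W)"
        using that by (simp add: minus_mult_distrib_mat[of _ x y] mult_minus_distrib_mat[of _ x z])
      also have "\<dots> = (Y' * K - D * W') - (Y * K - D * W)"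
        using that(3-) by (intro eq_matI) auto
      also have "\<dots> = - (T' - T)" unfolding that(1,2) using that(9-) by (intro eq_matI) auto
      finally show ?thesis .
    qed
    have "spectral_norm ((\<Gamma> (Suc (Suc k)) - \<Gamma> (Suc k)) * A - B * (\<Omega> (Suc (Suc k)) - \<Omega> (Suc k))) \<le> 2 * b * \<epsilon> * ?h"
      unfolding lin[OF eqs(1) eqs(1) \<Gamma> \<Gamma> A(1) B(1) \<Omega> \<Omega> R(1) trip(1) trip(1)] spectral_norm_uminus
      by (rule spectral_norm_triple_diff_le[OF \<Gamma> \<Gamma> C(1) \<Omega> \<Omega> gb(1) norms(3) gb(2) h])
    moreover have "spectral_norm ((\<Omega> (Suc (Suc k)) - \<Omega> (Suc k)) * A' - B' * (\<Gamma> (Suc (Suc k)) - \<Gamma> (Suc k))) \<le> 2 * b * \<epsilon> * ?h"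
      unfolding lin[OF eqs(2) eqs(2) \<Omega> \<Omega> A(2) B(2) \<Gamma> \<Gamma> R(2) trip(2) trip(2)] spectral_norm_uminus
      by (rule spectral_norm_triple_diff_le[OF \<Omega> \<Omega> C(2) \<Gamma> \<Gamma> gb(2) norms(4) gb(1) h(2,1)])
    ultimately have "c * max (spectral_norm ((\<Gamma> (Suc (Suc k)) - \<Gamma> (Suc k)) * A - B * (\<Omega> (Suc (Suc k)) - \<Omega> (Suc k))))
        (spectral_norm ((\<Omega> (Suc (Suc k)) - \<Omega> (Suc k)) * A' - B' * (\<Gamma> (Suc (Suc k)) - \<Gamma> (Suc k)))) \<le> c * (2 * b * \<epsilon> * ?h)"
      using c by (intro mult_left_mono) auto
    also have "c * (2 * b * \<epsilon> * ?h) = b * \<rho> ^ Suc k" unfolding \<rho>_eq[symmetric] by (simp add: algebra_simps)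
    finally show ?case
      using bound[OF minus_carrier_mat[OF \<Gamma>[of k]] minus_carrier_mat[OF \<Omega>[of k]]]
        bound[of "\<Gamma> (Suc (Suc k)) - \<Gamma> (Suc k)" "\<Omega> (Suc (Suc k)) - \<Omega> (Suc k)"] \<Gamma> \<Omega>
      by (meson minus_carrier_mat order.trans)
  qed
  obtain G where G: "entrywise_tendsto p r \<Gamma> G"
    using entrywise_tendsto_geometric[of \<Gamma> p r b \<rho>] \<Gamma> inc \<rho> by (auto simp: max.bounded_iff)
  obtain H where H: "entrywise_tendsto q r \<Omega> H"
    using entrywise_tendsto_geometric[of \<Omega> q r b \<rho>] \<Omega> inc \<rho> by (auto simp: max.bounded_iff)
  have "entrywise_tendsto p r (\<lambda>k. \<Gamma> (Suc k) * A - B * \<Omega> (Suc k)) (G * A - B * H)"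
    by (rule entrywise_tendsto_minus[OF entrywise_tendsto_mult[OF entrywise_tendsto_Suc[OF G] entrywise_tendsto_const[OF A(1)]]
          entrywise_tendsto_mult[OF entrywise_tendsto_const[OF B(1)] entrywise_tendsto_Suc[OF H]]])
  moreover have "entrywise_tendsto p r (\<lambda>k. R1 - \<Gamma> k * C1 * \<Omega> k) (R1 - G * C1 * H)"
    by (rule entrywise_tendsto_minus[OF entrywise_tendsto_const[OF R(1)]
          entrywise_tendsto_mult[OF entrywise_tendsto_mult[OF G entrywise_tendsto_const[OF C(1)]] H]])
  ultimately have 1: "G * A - B * H = R1 - G * C1 * H"
    unfolding eqs by (rule entrywise_tendsto_unique)
  have "entrywise_tendsto q r (\<lambda>k. \<Omega> (Suc k) * A' - B' * \<Gamma> (Suc k)) (H * A' - B' * G)"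
    by (rule entrywise_tendsto_minus[OF entrywise_tendsto_mult[OF entrywise_tendsto_Suc[OF H] entrywise_tendsto_const[OF A(2)]]
          entrywise_tendsto_mult[OF entrywise_tendsto_const[OF B(2)] entrywise_tendsto_Suc[OF G]]])
  moreover have "entrywise_tendsto q r (\<lambda>k. R2 - \<Omega> k * C2 * \<Gamma> k) (R2 - H * C2 * G)"
    by (rule entrywise_tendsto_minus[OF entrywise_tendsto_const[OF R(2)]
          entrywise_tendsto_mult[OF entrywise_tendsto_mult[OF H entrywise_tendsto_const[OF C(2)]] G]])
  ultimately have 2: "H * A' - B' * G = R2 - H * C2 * G"
    unfolding eqs by (rule entrywise_tendsto_unique)
  have "spectral_norm G \<le> b" "spectral_norm H \<le> b"
    by (rule spectral_norm_entrywise_limit_le[OF G gb(1)], rule spectral_norm_entrywise_limit_le[OF H gb(2)])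
  moreover have "G \<in> carrier_mat p r" "H \<in> carrier_mat q r" using G H by (simp_all add: entrywise_tendsto_def)
  ultimately show ?thesis using 1 2 unfolding b_def s_def by (intro bexI[of _ G] bexI[of _ H]) auto
qed

section \<open>Solutions of the perturbed system and their bounds\<close>

text \<open>With \<open>s = sqrt (1 - 4 \<kappa>)\<close> the denominator on the left is \<open>(1 + s)\<^sup>2 / 2\<close>.\<close>

lemma smaller_root_form:
  fixes \<kappa> :: real
  assumes "\<kappa> < 1 / 4"
  shows "(1 + sqrt (1 - 4 * \<kappa>)) / (1 - 2 * \<kappa> + sqrt (1 - 4 * \<kappa>)) = 2 / (1 + sqrt (1 - 4 * \<kappa>))"
proof -
  define s where "s = sqrt (1 - 4 * \<kappa>)"
  have s: "s > 0" "s\<^sup>2 = 1 - 4 * \<kappa>" using assms by (simp_all add: s_def)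
  have "1 - 2 * \<kappa> + s = (1 + s) * ((1 + s) / 2)"
    using s(2) by (simp add: power2_eq_square field_simps)
  moreover have "x / (x * (x / 2)) = 2 / x" if "x > 0" for x :: real
    using that by simp
  from this[of "1 + s"] s(1) have "(1 + s) / ((1 + s) * ((1 + s) / 2)) = 2 / (1 + s)" by (simp only: add_pos_pos zero_less_one)
  ultimately show ?thesis unfolding s_def[symmetric] by (simp only:)
qed

theorem corollary4p2:
  fixes m n r :: nat
    and G Gt E U V G1 G2 E11 E12 E21 E22 :: "complex mat"
    and \<delta> \<delta>' \<epsilon> :: real
  assumes r: "1 \<le> r" "r < min m n"
    and G: "G \<in> carrier_mat m n" and E: "E \<in> carrier_mat m n" and Gt: "Gt = G + E"
    and U: "U \<in> carrier_mat m m" "unitary_mat U"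
    and V: "V \<in> carrier_mat n n" "unitary_mat V"
    and G1: "G1 \<in> carrier_mat r r" and E11: "E11 \<in> carrier_mat r r"
    and E12: "E12 \<in> carrier_mat r (n - r)"
    and E21: "E21 \<in> carrier_mat (m - r) r"
    and G2: "G2 \<in> carrier_mat (m - r) (n - r)" and E22: "E22 \<in> carrier_mat (m - r) (n - r)"
    and blocks_G: "mat_adjoint U * G * V =
      four_block_mat G1 (0\<^sub>m r (n - r)) (0\<^sub>m (m - r) r) G2"
    and blocks_Gt: "mat_adjoint U * Gt * V = four_block_mat (G1 + E11) E12 E21 (G2 + E22)"
    and \<delta>: "\<delta> = Min {\<bar>\<mu> - \<nu>\<bar> | \<mu> \<nu>. \<mu> \<in># sv G1 \<and> \<nu> \<in># sv_ext G2}"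
    and \<delta>': "\<delta>' = \<delta> - spectral_norm E11 - spectral_norm E22"
    and \<epsilon>: "\<epsilon> = max (spectral_norm E12) (spectral_norm E21)"
  shows
    "(let \<kappa> = (pi / 2)\<^sup>2 * (\<epsilon>\<^sup>2 / \<delta>'\<^sup>2);
          b = (1 + sqrt (1 - 4 * \<kappa>)) / (1 - 2 * \<kappa> + sqrt (1 - 4 * \<kappa>)) * (pi / 2) * (\<epsilon> / \<delta>')
      in \<delta>' > 0 \<and> \<kappa> < 1 / 4 \<longrightarrow>
        (\<exists>\<Gamma> \<in> carrier_mat (m - r) r. \<exists>\<Omega> \<in> carrier_mat (n - r) r.
            solves_system G1 G2 E11 E12 E21 E22 \<Gamma> \<Omega> \<and>
            max (spectral_norm \<Gamma>) (spectral_norm \<Omega>) \<le> b) \<and>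
        (\<epsilon> > 0 \<longrightarrow> b < pi * (\<epsilon> / \<delta>'))) \<and>
     (let \<kappa> = \<epsilon>\<^sup>2 / \<delta>'\<^sup>2;
          b = (1 + sqrt (1 - 4 * \<kappa>)) / (1 - 2 * \<kappa> + sqrt (1 - 4 * \<kappa>)) * (\<epsilon> / \<delta>')
      in sigma_min G1 > sigma_max G2 \<and> \<delta>' > 0 \<and> \<kappa> < 1 / 4 \<longrightarrow>
        (\<exists>\<Gamma> \<in> carrier_mat (m - r) r. \<exists>\<Omega> \<in> carrier_mat (n - r) r.
            solves_system G1 G2 E11 E12 E21 E22 \<Gamma> \<Omega> \<and>
            max (spectral_norm \<Gamma>) (spectral_norm \<Omega>) \<le> b) \<and>
        (\<epsilon> > 0 \<longrightarrow> b < 2 * (\<epsilon> / \<delta>')))"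
proof -
  define p where "p = m - r"
  define q where "q = n - r"
  have pq: "p \<ge> 1" "q \<ge> 1" using r by (auto simp: p_def q_def)
  note E12 = E12[folded q_def] and E21 = E21[folded p_def]
    and G2 = G2[folded p_def q_def] and E22 = E22[folded p_def q_def]
  define A where "A = G1 + E11"
  define B where "B = G2 + E22"
  have A: "A \<in> carrier_mat r r" and B: "B \<in> carrier_mat p q"
    using G1 E11 G2 E22 by (auto simp: A_def B_def)
  have gap: "\<delta> \<le> \<bar>\<mu> - \<nu>\<bar>" if "\<mu> \<in># sv G1" "\<nu> \<in># sv_ext G2" for \<mu> \<nu>
  proof -
    have "{\<bar>\<mu> - \<nu>\<bar> | \<mu> \<nu>. \<mu> \<in># sv G1 \<and> \<nu> \<in># sv_ext G2} =
        (\<lambda>(\<mu>, \<nu>). \<bar>\<mu> - \<nu>\<bar>) ` (set_mset (sv G1) \<times> set_mset (sv_ext G2))" by auto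
    hence "finite {\<bar>\<mu> - \<nu>\<bar> | \<mu> \<nu>. \<mu> \<in># sv G1 \<and> \<nu> \<in># sv_ext G2}" by simp
    thus ?thesis unfolding \<delta> using that by (intro Min_le) auto
  qed
  obtain P d where P: "P \<in> carrier_mat (r + r) (r + r)" "unitary_mat P"
    and HP: "hermitian_dilation A * P = P * mat_diag (r + r) (\<lambda>i. complex_of_real (d i))"
    using hermitian_dilation_diagonalization[OF A] by blast
  obtain Q e where Q: "Q \<in> carrier_mat (p + q) (p + q)" "unitary_mat Q"
    and HQ: "hermitian_dilation B * Q = Q * mat_diag (p + q) (\<lambda>i. complex_of_real (e i))"
    using hermitian_dilation_diagonalization[OF B] by blast
  have pgap: "\<delta>' \<le> \<bar>d j - e i\<bar>" if "i < p + q" "j < r + r" for i j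
    unfolding \<delta>' using that
    by (intro perturbed_gap[OF G1 E11 G2 E22 gap P HP[unfolded A_def] Q HQ[unfolded B_def]])
  \<comment> \<open>The two parts differ only in the constant \<open>c\<close> of the lower bound for the linear part.\<close>
  have core: "\<exists>\<Gamma>\<in>carrier_mat (m - r) r. \<exists>\<Omega>\<in>carrier_mat (n - r) r.
      solves_system G1 G2 E11 E12 E21 E22 \<Gamma> \<Omega> \<and>
      max (spectral_norm \<Gamma>) (spectral_norm \<Omega>) \<le> 2 * (c * \<epsilon>) / (1 + sqrt (1 - 4 * (c * \<epsilon>)\<^sup>2))"
    if pos: "\<delta>' > 0" and c: "c > 0" and small: "4 * (c * \<epsilon>)\<^sup>2 < 1"
      and bound: "\<And>\<Gamma> \<Omega>. \<Gamma> \<in> carrier_mat p r \<Longrightarrow> \<Omega> \<in> carrier_mat q r \<Longrightarrow>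
        max (spectral_norm \<Gamma>) (spectral_norm \<Omega>) \<le> c *
        max (spectral_norm (\<Gamma> * A - B * \<Omega>)) (spectral_norm (\<Omega> * mat_adjoint A - mat_adjoint B * \<Gamma>))"
    for c
  proof -
    have ne: "d j \<noteq> e i" if "i < p + q" "j < r + r" for i j using pgap[OF that] pos by auto
    have "\<exists>\<Gamma>\<in>carrier_mat p r. \<exists>\<Omega>\<in>carrier_mat q r.
        \<Gamma> * A - B * \<Omega> = E21 - \<Gamma> * E12 * \<Omega> \<and>
        \<Omega> * mat_adjoint A - mat_adjoint B * \<Gamma> = mat_adjoint E12 - \<Omega> * mat_adjoint E21 * \<Gamma> \<and>
        max (spectral_norm \<Gamma>) (spectral_norm \<Omega>) \<le> 2 * (c * \<epsilon>) / (1 + sqrt (1 - 4 * (c * \<epsilon>)\<^sup>2))"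
      by (rule quadratic_system_solvable[OF A _ B _ E21 _ E12 _
            coupled_sylvester_solvable[OF A B P HP Q HQ ne] bound _ _ _ _ c small])
         (use A B E12 E21 in \<open>simp_all add: \<epsilon>\<close>)
    thus ?thesis unfolding solves_system_def p_def q_def A_def B_def by blast
  qed
  have shrink: "2 / (1 + x) < 2" if "x > 0" for x :: real
    using that by (simp add: divide_less_eq)
  show ?thesis
    unfolding Let_def
  proof (intro conjI impI; (elim conjE)?)
    let ?\<kappa> = "(pi / 2)\<^sup>2 * (\<epsilon>\<^sup>2 / \<delta>'\<^sup>2)" and ?c = "pi / (2 * \<delta>')"
    assume pos: "\<delta>' > 0" and small: "?\<kappa> < 1 / 4"
    have \<kappa>: "?\<kappa> = (?c * \<epsilon>)\<^sup>2" by (simp add: power_mult_distrib power_divide)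
    have b: "(1 + sqrt (1 - 4 * ?\<kappa>)) / (1 - 2 * ?\<kappa> + sqrt (1 - 4 * ?\<kappa>)) * (pi / 2) * (\<epsilon> / \<delta>') =
        2 * (?c * \<epsilon>) / (1 + sqrt (1 - 4 * (?c * \<epsilon>)\<^sup>2))"
    proof -
      have "2 / D * (pi / 2) * (\<epsilon> / \<delta>') = 2 * (?c * \<epsilon>) / D" for D by simp
      thus ?thesis unfolding smaller_root_form[OF small] unfolding \<kappa> .
    qed
    show "\<exists>\<Gamma>\<in>carrier_mat (m - r) r. \<exists>\<Omega>\<in>carrier_mat (n - r) r.
        solves_system G1 G2 E11 E12 E21 E22 \<Gamma> \<Omega> \<and>
        max (spectral_norm \<Gamma>) (spectral_norm \<Omega>) \<le>
          (1 + sqrt (1 - 4 * ?\<kappa>)) / (1 - 2 * ?\<kappa> + sqrt (1 - 4 * ?\<kappa>)) * (pi / 2) * (\<epsilon> / \<delta>')"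
      unfolding b
    proof (rule core[OF pos])
      show "?c > 0" using pos by simp
      show "4 * (?c * \<epsilon>)\<^sup>2 < 1" using small unfolding \<kappa> by linarith
    qed (rule coupled_sylvester_norm_le[OF A B P HP Q HQ pgap pos])
    assume "\<epsilon> > 0"
    hence "pi * (\<epsilon> / \<delta>') > 0" using pos by simp
    moreover have "sqrt (1 - 4 * ?\<kappa>) > 0" using small unfolding real_sqrt_gt_0_iff by linarith
    hence "2 / (1 + sqrt (1 - 4 * ?\<kappa>)) < 2" by (rule shrink)
    ultimately have "2 / (1 + sqrt (1 - 4 * ?\<kappa>)) * (pi * (\<epsilon> / \<delta>') / 2) < 2 * (pi * (\<epsilon> / \<delta>') / 2)"
      by (intro mult_strict_right_mono) simp_all
    moreover have "D * (pi * (\<epsilon> / \<delta>') / 2) = D * (pi / 2) * (\<epsilon> / \<delta>')" for D by simp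
    ultimately have "2 / (1 + sqrt (1 - 4 * ?\<kappa>)) * (pi / 2) * (\<epsilon> / \<delta>') < 2 * (pi / 2) * (\<epsilon> / \<delta>')"
      by (simp only:)
    also have "2 * (pi / 2) * (\<epsilon> / \<delta>') = pi * (\<epsilon> / \<delta>')" by simp
    finally show "(1 + sqrt (1 - 4 * ?\<kappa>)) / (1 - 2 * ?\<kappa> + sqrt (1 - 4 * ?\<kappa>)) * (pi / 2) * (\<epsilon> / \<delta>') < pi * (\<epsilon> / \<delta>')"
      unfolding smaller_root_form[OF small] .
  next
    let ?\<kappa> = "\<epsilon>\<^sup>2 / \<delta>'\<^sup>2" and ?c = "1 / \<delta>'"
    assume sep: "sigma_max G2 < sigma_min G1" and pos: "\<delta>' > 0" and small: "?\<kappa> < 1 / 4"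
    have \<kappa>: "?\<kappa> = (?c * \<epsilon>)\<^sup>2" by (simp add: power_divide)
    have b: "(1 + sqrt (1 - 4 * ?\<kappa>)) / (1 - 2 * ?\<kappa> + sqrt (1 - 4 * ?\<kappa>)) * (\<epsilon> / \<delta>') =
        2 * (?c * \<epsilon>) / (1 + sqrt (1 - 4 * (?c * \<epsilon>)\<^sup>2))"
    proof -
      have "2 / D * (\<epsilon> / \<delta>') = 2 * (?c * \<epsilon>) / D" for D by simp
      thus ?thesis unfolding smaller_root_form[OF small] unfolding \<kappa> .
    qed
    \<comment> \<open>The perturbations change the extreme singular values by at most their norms.\<close>
    have belowA: "(sigma_min G1 - spectral_norm E11) * vec_norm2 x \<le> vec_norm2 (A *\<^sub>v x)"
      "(sigma_min G1 - spectral_norm E11) * vec_norm2 x \<le> vec_norm2 (mat_adjoint A *\<^sub>v x)"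
      if x: "x \<in> carrier_vec r" for x
    proof -
      have tri: "vec_norm2 (K *\<^sub>v x) \<le> vec_norm2 ((K + L) *\<^sub>v x) + spectral_norm L * vec_norm2 x"
        if K: "K \<in> carrier_mat r r" and L: "L \<in> carrier_mat r r" for K L
      proof -
        have "K *\<^sub>v x = (K + L) *\<^sub>v x + (- 1) \<cdot>\<^sub>v (L *\<^sub>v x)"
          unfolding add_mult_distrib_mat_vec[OF K L x] using K L x by (intro eq_vecI) auto
        also have "vec_norm2 \<dots> \<le> vec_norm2 ((K + L) *\<^sub>v x) + vec_norm2 ((- 1) \<cdot>\<^sub>v (L *\<^sub>v x))"
          using K L x by (intro vec_norm2_add[of _ r] mult_mat_vec_carrier[of _ r r]) auto
        also have "vec_norm2 ((- 1) \<cdot>\<^sub>v (L *\<^sub>v x)) \<le> spectral_norm L * vec_norm2 x"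
          using vec_norm2_mult_mat_vec_le[OF L x] by simp
        finally show ?thesis by simp
      qed
      show "(sigma_min G1 - spectral_norm E11) * vec_norm2 x \<le> vec_norm2 (A *\<^sub>v x)"
        using sigma_min_le_norm(1)[OF G1 r(1) x] tri[OF G1 E11] by (simp add: A_def algebra_simps)
      show "(sigma_min G1 - spectral_norm E11) * vec_norm2 x \<le> vec_norm2 (mat_adjoint A *\<^sub>v x)"
        using sigma_min_le_norm(2)[OF G1 r(1) x] tri[of "mat_adjoint G1" "mat_adjoint E11"] G1 E11
        by (simp add: A_def mat_adjoint_add[OF G1 E11] algebra_simps)
    qed
    have aboveB: "spectral_norm B \<le> sigma_max G2 + spectral_norm E22"
      using spectral_norm_add[OF G2 E22] spectral_norm_le_sigma_max[OF G2 pq] by (simp add: B_def)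
    have "\<delta> \<le> \<bar>sigma_min G1 - sigma_max G2\<bar>"
    proof (rule gap)
      show "sigma_min G1 \<in># sv G1" using G1 r by (intro sigma_min_in_sv) auto
      have "sigma_max G2 \<in># sv G2" using G2 pq by (intro sigma_max_in_sv) auto
      thus "sigma_max G2 \<in># sv_ext G2" by (simp add: sv_ext_def)
    qed
    hence st: "\<delta>' \<le> (sigma_min G1 - spectral_norm E11) - (sigma_max G2 + spectral_norm E22)"
      using sep by (simp add: \<delta>')
    show "\<exists>\<Gamma>\<in>carrier_mat (m - r) r. \<exists>\<Omega>\<in>carrier_mat (n - r) r.
        solves_system G1 G2 E11 E12 E21 E22 \<Gamma> \<Omega> \<and>
        max (spectral_norm \<Gamma>) (spectral_norm \<Omega>) \<le>
          (1 + sqrt (1 - 4 * ?\<kappa>)) / (1 - 2 * ?\<kappa> + sqrt (1 - 4 * ?\<kappa>)) * (\<epsilon> / \<delta>')"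
      unfolding b
    proof (rule core[OF pos])
      show "?c > 0" using pos by simp
      show "4 * (?c * \<epsilon>)\<^sup>2 < 1" using small unfolding \<kappa> by linarith
    qed (rule coupled_sylvester_norm_le_separated[OF A B belowA aboveB st pos])
    assume "\<epsilon> > 0"
    hence "\<epsilon> / \<delta>' > 0" using pos by simp
    moreover have "sqrt (1 - 4 * ?\<kappa>) > 0" using small unfolding real_sqrt_gt_0_iff by linarith
    hence "2 / (1 + sqrt (1 - 4 * ?\<kappa>)) < 2" by (rule shrink)
    ultimately show "(1 + sqrt (1 - 4 * ?\<kappa>)) / (1 - 2 * ?\<kappa> + sqrt (1 - 4 * ?\<kappa>)) * (\<epsilon> / \<delta>') < 2 * (\<epsilon> / \<delta>')"
      unfolding smaller_root_form[OF small]
      by (intro mult_strict_right_mono)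
  qed
qed

end
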